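(* Let $X$ be a subordinator with drift $\delta>0$ and Lévy measure $\Pi$ with $\beta(\Pi)<1$, and let $q\ge 0$. Suppose that $\Pi$ is purely atomic and that its set of atoms $G\subset(0,\infty)$ has a possible (finite) accumulation point only at zero. Then, for every integer $k\ge 1$ and every $x>0$, $$U^{(q)}\text{ is }(k+1)\text{-times differentiable at }x\quad\Longleftrightarrow\quad x\notin G_k .$$ In particular, if $x>0$ cannot be reached by atomic jumps only (that is, $x\notin\bigcup_{k\ge1}G_k$), then $U^{(q)}$ is infinitely differentiable at $x$.
   Context: A subordinator is a Lévy process $X=(X_t)_{t\ge0}$ with $X_0=0$ and almost surely non-decreasing paths; $X_t=\delta t+\sum_{s\le t}\Delta_s$ with drift $\delta$ and jumps $\Delta_s$ governed by a Poisson random measure with Lévy measure $\Pi$, a measure on $(0,\infty)$ with $\int_0^\infty(1\wedge x)\,\Pi(dx)<\infty$. The Blumenthal–Getoor index is $\beta(\Pi)=\inf\{\gamma>0:\int_0^1x^\gamma\,\Pi(dx)<\infty\}$. For $q\ge0$ the $q$-potential measure is $U^{(q)}(dx)=\mathbb{E}\left[\int_0^\infty e^{-qt}\mathbf 1_{\{X_t\in dx\}}\,dt\right]$, and $U^{(q)}(x)=U^{(q)}([0,x])$ denotes its distribution function. $G$ denotes the set of atoms of $\Pi$, and for $k\ge1$ $$G_k=\Big\{x>0: x=\sum_{i=1}^{j}g_i,\ g_i\in G,\ 1\le j\le k\Big\}$$ (the $g_i$ need not be distinct). *)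

theory Defs
  imports "HOL-Probability.Probability"
begin

text \<open>Measures on \<open>(0,\<infinity>)\<close> are represented as Borel measures on the real line that give no
  mass to \<open>(-\<infinity>,0]\<close>.\<close>

definition levy_measure :: "real measure \<Rightarrow> bool" where
  "levy_measure \<nu> \<longleftrightarrow>
     sets \<nu> = sets borel \<and> emeasure \<nu> {..0} = 0 \<and> (\<integral>\<^sup>+ x. ennreal (min 1 x) \<partial>\<nu>) < \<infinity>"

definition blumenthal_getoor_index :: "real measure \<Rightarrow> real" where
  "blumenthal_getoor_index \<nu> =
     Inf {\<gamma>. \<gamma> > 0 \<and> (\<integral>\<^sup>+ x\<in>{0<..1}. ennreal (x powr \<gamma>) \<partial>\<nu>) < \<infinity>}"

text \<open>The Poisson probabilities are written out because \<open>poisson_pmf\<close> is specified for a positive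
  rate only, while sets of intensity zero have to be allowed.\<close>

definition poisson_random_measure ::
  "'a measure \<Rightarrow> 'b measure \<Rightarrow> ('a \<Rightarrow> 'b measure) \<Rightarrow> bool" where
  "poisson_random_measure M \<mu> N \<longleftrightarrow>
     (\<forall>\<omega>\<in>space M. sets (N \<omega>) = sets \<mu>) \<and>
     (\<forall>A\<in>sets \<mu>. (\<lambda>\<omega>. emeasure (N \<omega>) A) \<in> borel_measurable M) \<and>
     (\<forall>A\<in>sets \<mu>. emeasure \<mu> A < \<infinity> \<longrightarrow>
        (\<forall>n. measure M {\<omega> \<in> space M. emeasure (N \<omega>) A = of_nat n} =
             measure \<mu> A ^ n / fact n * exp (- measure \<mu> A))) \<and>
     (\<forall>A\<in>sets \<mu>. emeasure \<mu> A = \<infinity> \<longrightarrow> (AE \<omega> in M. emeasure (N \<omega>) A = \<infinity>)) \<and>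
     (\<forall>(n::nat) A. (\<forall>i<n. A i \<in> sets \<mu>) \<and> disjoint_family_on A {..<n} \<longrightarrow>
        prob_space.indep_vars M (\<lambda>_. borel) (\<lambda>i \<omega>. emeasure (N \<omega>) (A i)) {..<n})"

text \<open>A process is a function \<open>X\<close> of time and outcome; only times \<open>t \<ge> 0\<close> are relevant.\<close>

definition levy_process :: "'a measure \<Rightarrow> (real \<Rightarrow> 'a \<Rightarrow> real) \<Rightarrow> bool" where
  "levy_process M X \<longleftrightarrow>
     prob_space M \<and>
     (\<forall>t\<ge>0. X t \<in> borel_measurable M) \<and>
     (AE \<omega> in M. X 0 \<omega> = 0) \<and>
     (\<forall>(n::nat) t. 0 \<le> t 0 \<and> (\<forall>i<n. t i \<le> t (Suc i)) \<longrightarrow>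
        prob_space.indep_vars M (\<lambda>_. borel) (\<lambda>i \<omega>. X (t (Suc i)) \<omega> - X (t i) \<omega>) {..<n}) \<and>
     (\<forall>s t. 0 \<le> s \<and> s \<le> t \<longrightarrow>
        distr M borel (\<lambda>\<omega>. X t \<omega> - X s \<omega>) = distr M borel (X (t - s))) \<and>
     (AE \<omega> in M. \<forall>t\<ge>0. ((\<lambda>s. X s \<omega>) \<longlongrightarrow> X t \<omega>) (at_right t) \<and>
        (t > 0 \<longrightarrow> (\<exists>l. ((\<lambda>s. X s \<omega>) \<longlongrightarrow> l) (at_left t))))"

definition jump :: "(real \<Rightarrow> 'a \<Rightarrow> real) \<Rightarrow> 'a \<Rightarrow> real \<Rightarrow> real" where
  "jump X \<omega> s = X s \<omega> - Lim (at_left s) (\<lambda>r. X r \<omega>)"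

text \<open>The jumps are governed by a Poisson random measure: almost surely, the random measure
  \<open>N\<close> with intensity \<open>dt \<otimes> \<nu>(dx)\<close> on \<open>(0,\<infinity>) \<times> (0,\<infinity>)\<close> counts the points \<open>(s, \<Delta>\<^sub>s)\<close>
  with \<open>\<Delta>\<^sub>s \<noteq> 0\<close>. Introducing \<open>N\<close> existentially means that the counting variables have to be
  measurable only up to a null set, where the paths of \<open>X\<close> may be irregular.\<close>

definition subordinator ::
  "'a measure \<Rightarrow> (real \<Rightarrow> 'a \<Rightarrow> real) \<Rightarrow> real \<Rightarrow> real measure \<Rightarrow> bool" where
  "subordinator M X \<delta> \<nu> \<longleftrightarrow>
     levy_process M X \<and>
     (AE \<omega> in M. mono_on {0..} (\<lambda>t. X t \<omega>)) \<and>
     0 \<le> \<delta> \<and> levy_measure \<nu> \<and>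
     (\<exists>N. poisson_random_measure M (density lborel (indicator {0<..}) \<Otimes>\<^sub>M \<nu>) N \<and>
        (AE \<omega> in M. \<forall>A\<in>sets (borel \<Otimes>\<^sub>M borel).
           emeasure (N \<omega>) A =
           emeasure (count_space UNIV) {s. s > 0 \<and> jump X \<omega> s \<noteq> 0 \<and> (s, jump X \<omega> s) \<in> A})) \<and>
     (AE \<omega> in M. \<forall>t\<ge>0. (jump X \<omega> has_sum (X t \<omega> - \<delta> * t)) {0<..t})"

definition potential_measure ::
  "'a measure \<Rightarrow> (real \<Rightarrow> 'a \<Rightarrow> real) \<Rightarrow> real \<Rightarrow> real set \<Rightarrow> ennreal" where
  "potential_measure M X q A =
     (\<integral>\<^sup>+ \<omega>. (\<integral>\<^sup>+ t\<in>{0..}. ennreal (exp (- q * t)) * indicator A (X t \<omega>) \<partial>lborel) \<partial>M)"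

definition potential_cdf ::
  "'a measure \<Rightarrow> (real \<Rightarrow> 'a \<Rightarrow> real) \<Rightarrow> real \<Rightarrow> real \<Rightarrow> real" where
  "potential_cdf M X q x = enn2real (potential_measure M X q {0..x})"

definition atoms :: "real measure \<Rightarrow> real set" where
  "atoms \<nu> = {x. emeasure \<nu> {x} > 0}"

definition purely_atomic :: "real measure \<Rightarrow> bool" where
  "purely_atomic \<nu> \<longleftrightarrow> (AE x in \<nu>. x \<in> atoms \<nu>)"

definition sums_upto :: "real set \<Rightarrow> nat \<Rightarrow> real set" where
  "sums_upto G k =
     {x. x > 0 \<and> (\<exists>j g. 1 \<le> j \<and> j \<le> k \<and> (\<forall>i\<in>{1..j}. g i \<in> G) \<and> x = (\<Sum>i=1..j. g i))}"

text \<open>Being \<open>n + 1\<close> times differentiable at \<open>x\<close> requires the \<open>n\<close>-th derivative to exist in a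
  neighbourhood of \<open>x\<close> and to be differentiable at \<open>x\<close>; \<open>deriv\<close> takes an arbitrary value
  where no derivative exists, so the existence in the neighbourhood has to be demanded.\<close>

primrec times_differentiable_at :: "nat \<Rightarrow> (real \<Rightarrow> real) \<Rightarrow> real \<Rightarrow> bool" where
  "times_differentiable_at 0 f x \<longleftrightarrow> True"
| "times_differentiable_at (Suc n) f x \<longleftrightarrow>
     (\<forall>\<^sub>F y in nhds x. times_differentiable_at n f y) \<and> (deriv ^^ n) f differentiable (at x)"

end

theory Submission
  imports Defs
begin

text \<open>Let \<open>g\<^sub>n\<close> be the atoms and \<open>a\<^sub>n\<close> their masses. On \<open>(0,\<infinity>)\<close> the distribution function \<open>U\<close> of the potential
  measure solves \<open>\<delta> U'(x) = 1 - q U(x) + (\<Sum>n. a\<^sub>n (U(x - g\<^sub>n) - U(x)))\<close>, it vanishes on \<open>(-\<infinity>,0]\<close> and it is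
  Lipschitz. For finitely many atoms this follows from the Kolmogorov equation for sums of independent
  Poisson variables, integrated along the drift; the general case is a limit.

  Since \<open>\<Sum>n. a\<^sub>n min(1, g\<^sub>n\<^sup>\<gamma>)\<close> is finite for some \<open>\<gamma> < 1\<close>, the small jumps on the right-hand side cost
  only \<open>\<gamma>\<close> derivatives while the equation gains a full one. Hence near \<open>x\<close> the function \<open>U\<close> can be
  bootstrapped as long as it is smooth near all the points \<open>x - g\<^sub>n\<close>, and the only initial singularity is
  the kink of \<open>U\<close> at \<open>0\<close>, where the one-sided derivatives are \<open>0\<close> and \<open>1/\<delta>\<close>. It propagates to the points
  that are sums of \<open>k\<close> atoms but of no fewer, where it becomes a kink of the \<open>k\<close>-th derivative; all its
  contributions have the same sign.\<close>

section \<open>Local regularity of solutions of the renewal equation\<close>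

text \<open>The order of smoothness has to be hit exactly. Regularity is therefore measured by
  classes in which the derivatives up to order k exist and the k-th one is Lipschitz: a kink of the
  k-th derivative is still inside class k but outside class k + 1, which is where the k + 1 of the
  claim comes from. The obstacle is infinite activity: the total mass \<open>\<Sum>n. a n\<close>
  may diverge, so the right-hand side cannot be split into a convolution and a multiple of U. Its
  series converges only through the smallness of U(x - g n) - U(x), which consumes regularity of U.
  All bounds must be uniform over infinitely many shifts; they are, because only finitely many
  shifts are neither close to 0 nor so large that x - g n is negative. The limit is taken in the
  equation for primitives, since that form needs no derivative of the approximations and survives
  pointwise convergence. The drift replaces killing as the source of finiteness: X t is at least
  \<delta> t, so only times up to x / \<delta> matter, also for q = 0.\<close>

text \<open>The second difference is the increment over a step s of y \<mapsto> f (y + t) - f y. The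
  mean value theorem extracts the factor s, and the Hoelder bound for \<open>f'\<close> at distance
  t gives the rest. The bound is not symmetric in s and t; both readings are used.\<close>

lemma double_difference_bound:
  fixes f f' :: "real \<Rightarrow> real"
  assumes der: "\<And>y. y \<in> {p..p + s + t} \<Longrightarrow> (f has_real_derivative f' y) (at y)"
    and bound: "\<And>y z. \<lbrakk>y \<in> {p..p + s + t}; z \<in> {p..p + s + t}\<rbrakk> \<Longrightarrow> \<bar>f' y - f' z\<bar> \<le> K * \<bar>y - z\<bar> powr \<alpha>"
    and "0 \<le> s" "0 \<le> t"
  shows "\<bar>f (p + s + t) - f (p + s) - f (p + t) + f p\<bar> \<le> K * s * t powr \<alpha>"
proof (cases "s = 0")
  case False
  define \<phi> where "\<phi> = (\<lambda>y. f (y + t) - f y)"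
  have d: "(\<phi> has_real_derivative (f' (y + t) - f' y)) (at y)" if "p \<le> y" "y \<le> p + s" for y
    unfolding \<phi>_def using that assms(3,4)
    by (intro derivative_intros DERIV_shift[THEN iffD1] der) auto
  obtain z where z: "p < z" "z < p + s" "\<phi> (p + s) - \<phi> p = (p + s - p) * (f' (z + t) - f' z)"
    using MVT2[of p "p + s" \<phi> "\<lambda>y. f' (y + t) - f' y"] d False assms(3) by auto
  have "\<bar>f' (z + t) - f' z\<bar> \<le> K * \<bar>z + t - z\<bar> powr \<alpha>"
    by (rule bound) (use z assms in auto)
  hence "\<bar>s * (f' (z + t) - f' z)\<bar> \<le> s * (K * t powr \<alpha>)"
    unfolding abs_mult using assms by (intro mult_mono) auto
  moreover have "f (p + s + t) - f (p + s) - f (p + t) + f p = \<phi> (p + s) - \<phi> p"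
    by (simp add: \<phi>_def)
  ultimately show ?thesis
    using z by (simp add: mult_ac)
qed auto

text \<open>For \<gamma> \<le> \<alpha> the second argument of the minimum alone gives the full
  exponent 1. Otherwise, if g \<le> h, a power 1 - \<gamma> of g is exchanged for one of h in the
  first argument; if g > h, the exponent \<alpha> - \<gamma> is negative, so passing from g to h in
  the second argument increases it.\<close>

lemma powr_interpolation:
  fixes g h :: real
  assumes "0 < g" "g \<le> 1" "0 < h" "h \<le> 1" "0 < \<gamma>" "\<gamma> < 1" "0 \<le> \<alpha>"
  shows "min (g * h powr \<alpha>) (h * g powr \<alpha>) \<le> g powr \<gamma> * h powr (min 1 (\<alpha> + (1 - \<gamma>)))"
proof (cases "\<gamma> \<le> \<alpha>")
  case True
  have "h * g powr \<alpha> \<le> h * g powr \<gamma>"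
    using assms True by (intro mult_left_mono powr_mono') auto
  hence "min (g * h powr \<alpha>) (h * g powr \<alpha>) \<le> h * g powr \<gamma>"
    by (rule min.coboundedI2)
  thus ?thesis using True assms by (simp add: mult.commute)
next
  case False
  have h: "h powr 1 = h" and g: "g powr 1 = g" using assms by auto
  have "min (g * h powr \<alpha>) (h * g powr \<alpha>) \<le> g powr \<gamma> * h powr (\<alpha> + (1 - \<gamma>))"
  proof (cases "g \<le> h")
    case True
    have "g * h powr \<alpha> = g powr \<gamma> * g powr (1 - \<gamma>) * h powr \<alpha>"
      using g by (simp flip: powr_add)
    also have "\<dots> \<le> g powr \<gamma> * h powr (1 - \<gamma>) * h powr \<alpha>"
      using True assms by (intro mult_right_mono mult_left_mono powr_mono2) auto
    finally show ?thesis by (simp add: powr_add mult_ac min.coboundedI1)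
  next
    case gh: False
    have "h * g powr \<alpha> = g powr \<gamma> * h * g powr (\<alpha> - \<gamma>)"
      by (simp add: powr_diff assms field_simps)
    also have "\<dots> \<le> g powr \<gamma> * h * h powr (\<alpha> - \<gamma>)"
      using gh False assms by (intro mult_left_mono powr_mono2') auto
    also have "\<dots> = g powr \<gamma> * h powr (\<alpha> + (1 - \<gamma>))"
      using h by (simp add: mult.assoc powr_add powr_diff field_simps)
    finally show ?thesis by (simp add: min.coboundedI2)
  qed
  thus ?thesis using False by (simp add: min_def)
qed

text \<open>Termwise differentiation with Weierstrass majorant
  \<open>K * (a n * min 1 (g n))\<close>. The assumptions at shifted points concern only indices of
  positive weight, so singular terms can be removed by setting their weight to 0.\<close>

lemma difference_series_has_derivative:
  fixes f f' :: "real \<Rightarrow> real" and a g :: "nat \<Rightarrow> real"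
  assumes a: "\<And>n. 0 \<le> a n" and summ: "summable (\<lambda>n. a n * min 1 (g n))"
    and g: "\<And>n. 0 < a n \<Longrightarrow> 0 \<le> g n"
    and "r > 0"
    and der0: "\<And>y. y \<in> ball x r \<Longrightarrow> (f has_real_derivative f' y) (at y)"
    and der: "\<And>y n. \<lbrakk>y \<in> ball x r; 0 < a n\<rbrakk> \<Longrightarrow> (f has_real_derivative f' (y - g n)) (at (y - g n))"
    and b0: "\<And>n. 0 < a n \<Longrightarrow> \<bar>f (x - g n) - f x\<bar> \<le> K0 * min 1 (g n)"
    and b: "\<And>n y. \<lbrakk>y \<in> ball x r; 0 < a n\<rbrakk> \<Longrightarrow> \<bar>f' (y - g n) - f' y\<bar> \<le> K * min 1 (g n)"
  shows "((\<lambda>y. \<Sum>n. a n * (f (y - g n) - f y)) has_real_derivative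
           (\<Sum>n. a n * (f' (x - g n) - f' x))) (at x)"
proof (rule has_field_derivative_series'(2)[where S = "ball x r" and x0 = x])
  fix n y assume y: "y \<in> ball x r"
  have "((\<lambda>y. a n * (f (y - g n) - f y)) has_real_derivative a n * (f' (y - g n) - f' y)) (at y)"
  proof (cases "a n = 0")
    case False
    hence "0 < a n" using a[of n] by simp
    with der[OF y] have "(f has_real_derivative f' (y - g n)) (at (y + - g n))" by simp
    hence "((\<lambda>y. f (y - g n)) has_real_derivative f' (y - g n)) (at y)"
      unfolding DERIV_shift by simp
    thus ?thesis by (auto intro!: derivative_eq_intros der0 y)
  qed auto
  thus "((\<lambda>y. a n * (f (y - g n) - f y)) has_real_derivative a n * (f' (y - g n) - f' y))
          (at y within ball x r)"
    by (rule DERIV_subset) auto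
next
  show "uniformly_convergent_on (ball x r) (\<lambda>n x. \<Sum>i<n. a i * (f' (x - g i) - f' x))"
  proof (rule Weierstrass_m_test')
    show "summable (\<lambda>n. K * (a n * min 1 (g n)))" by (intro summable_mult summ)
    fix n y assume y: "y \<in> ball x r"
    show "norm (a n * (f' (y - g n) - f' y)) \<le> K * (a n * min 1 (g n))"
      using b[OF y, of n] a[of n]
      by (cases "a n = 0") (auto simp: abs_mult mult.left_commute[of K] intro!: mult_left_mono)
  qed
next
  show "summable (\<lambda>n. a n * (f (x - g n) - f x))"
  proof (rule summable_comparison_test')
    show "summable (\<lambda>n. K0 * (a n * min 1 (g n)))" by (intro summable_mult summ)
    fix n
    show "norm (a n * (f (x - g n) - f x)) \<le> K0 * (a n * min 1 (g n))"
      using b0[of n] a[of n]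
      by (cases "a n = 0") (auto simp: abs_mult mult.left_commute[of K0] intro!: mult_left_mono)
  qed
qed (use \<open>r > 0\<close> in auto)

lemma has_real_derivative_shift_within:
  fixes f :: "real \<Rightarrow> real"
  assumes "(f has_real_derivative f') (at (x - c) within (\<lambda>y. y - c) ` S)"
  shows "((\<lambda>y. f (y - c)) has_real_derivative f') (at x within S)"
proof -
  have "((\<lambda>y. y - c) has_real_derivative 1) (at x within S)"
    by (auto intro!: derivative_eq_intros)
  from DERIV_image_chain[OF assms this] show ?thesis by (simp add: o_def)
qed

lemma has_real_derivative_unique_within:
  fixes f :: "real \<Rightarrow> real"
  assumes "(f has_real_derivative l) (at x within S)" "(f has_real_derivative l') (at x within S)"
    and "at x within S \<noteq> bot"
  shows "l = l'"
  using assms unfolding has_field_derivative_iff by (metis tendsto_unique)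

lemma image_diff_halflines:
  fixes c x :: real
  shows "(\<lambda>y. y - c) ` {..x} = {..x - c}" "(\<lambda>y. y - c) ` {x..} = {x - c..}"
  by (auto simp: image_iff intro!: bexI[of _ "_ + c"])

lemma at_within_halflines_neq_bot:
  fixes x :: real
  shows "at x within {..x} \<noteq> bot" "at x within {x..} \<noteq> bot"
proof -
  have "at_left x \<le> at x within {..x}" "at_right x \<le> at x within {x..}"
    by (auto intro!: at_le)
  thus "at x within {..x} \<noteq> bot" "at x within {x..} \<noteq> bot"
    using trivial_limit_at_left_real[of x] trivial_limit_at_right_real[of x] by (metis bot_unique)+
qed

text \<open>The analytic facts on which the regularity part rests. The value 0 on the left and the
  slope \<open>1 / \<delta>\<close> on the right form the kink at 0 from which every other
  singularity descends. The bound r in \<open>locally_finite\<close> matters, as infinitely many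
  atoms may tend to infinity.\<close>

locale drift_renewal_equation =
  fixes g a :: "nat \<Rightarrow> real" and U :: "real \<Rightarrow> real" and \<delta> q \<gamma> L :: real
  assumes g_pos: "0 < g n"
    and a_nonneg: "0 \<le> a n"
    and gamma: "0 < \<gamma>" "\<gamma> < 1"
    and summable_powr: "summable (\<lambda>n. a n * min 1 (g n powr \<gamma>))"
    and locally_finite: "0 < e \<Longrightarrow> finite {n. 0 < a n \<and> e \<le> g n \<and> g n \<le> r}"
    and delta_pos: "0 < \<delta>"
    and U_nonpos: "x \<le> 0 \<Longrightarrow> U x = 0"
    and U_lipschitz: "\<bar>U x - U y\<bar> \<le> L * \<bar>x - y\<bar>"
    and U_deriv: "0 < x \<Longrightarrow> (U has_real_derivative
       (1 - q * U x + (\<Sum>n. a n * (U (x - g n) - U x))) / \<delta>) (at x)"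
    and U_right_deriv: "(U has_real_derivative 1 / \<delta>) (at 0 within {0..})"
begin

abbreviation D :: "nat \<Rightarrow> real \<Rightarrow> real" where
  "D i \<equiv> (deriv ^^ i) U"

lemma min_g_le: "min 1 (g n) \<le> min 1 (g n powr \<gamma>)"
proof (cases "g n \<le> 1")
  case True
  have "g n powr 1 \<le> g n powr \<gamma>"
    using True gamma g_pos[of n] by (intro powr_mono') auto
  thus ?thesis using g_pos[of n] by (simp add: min_def)
next
  case False
  hence "1 \<le> g n powr \<gamma>" using gamma by (intro ge_one_powr_ge_zero) auto
  thus ?thesis by simp
qed

lemma summable_min: "summable (\<lambda>n. a n * min 1 (g n))"
  by (rule summable_comparison_test'[OF summable_powr])
     (use a_nonneg g_pos in \<open>auto simp: abs_mult less_imp_le intro!: mult_left_mono min_g_le\<close>)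

section \<open>Local smoothness with constants uniform over the atoms\<close>

text \<open>\<open>D k\<close> has to be Lipschitz but not differentiable: level k still admits a
  kink of \<open>D k\<close>, and level 0 holds around every point.\<close>

definition smooth_on :: "nat \<Rightarrow> real \<Rightarrow> real \<Rightarrow> real \<Rightarrow> bool" where
  "smooth_on k x r C \<longleftrightarrow>
     (\<forall>y\<in>ball x r. \<forall>i<k. (D i has_real_derivative D (Suc i) y) (at y)) \<and>
     (\<forall>y\<in>ball x r. \<forall>z\<in>ball x r. \<forall>i\<le>k. \<bar>D i y - D i z\<bar> \<le> C * \<bar>y - z\<bar>)"

definition smooth_near :: "nat \<Rightarrow> real \<Rightarrow> bool" where
  "smooth_near k x \<longleftrightarrow> (\<exists>r>0. \<exists>C. smooth_on k x r C)"

lemma smooth_on_mono: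
  assumes "smooth_on k x r C" "r' \<le> r" "C \<le> C'"
  shows "smooth_on k x r' C'"
proof -
  have "ball x r' \<subseteq> ball x r" using assms(2) by auto
  moreover have "C * \<bar>y - z\<bar> \<le> C' * \<bar>y - z\<bar>" for y z
    using assms(3) by (intro mult_right_mono) auto
  ultimately show ?thesis
    using assms(1) unfolding smooth_on_def by (meson order_trans subsetD)
qed

lemma D_neg:
  assumes "y < 0"
  shows "D i y = 0" "(D i has_real_derivative 0) (at y)"
proof -
  have "\<forall>y<0. D i y = 0 \<and> (D i has_real_derivative 0) (at y)"
  proof (induction i)
    case 0
    have "(U has_real_derivative 0) (at y)" if "y < 0" for y
      by (rule has_field_derivative_transform_within_open[of "\<lambda>_. 0" _ _ "{..<0}"])
         (use that U_nonpos in auto)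
    thus ?case using U_nonpos by auto
  next
    case (Suc i)
    have zero: "D (Suc i) y = 0" if "y < 0" for y
      using Suc that by (auto intro: DERIV_imp_deriv)
    have "(D (Suc i) has_real_derivative 0) (at y)" if "y < 0" for y
      by (rule has_field_derivative_transform_within_open[of "\<lambda>_. 0" _ _ "{..<0}"])
         (use that zero in auto)
    with zero show ?case by blast
  qed
  thus "D i y = 0" "(D i has_real_derivative 0) (at y)" using assms by auto
qed

lemma smooth_near_neg:
  assumes "x < 0"
  shows "smooth_near k x"
proof -
  have neg: "y < 0" if "y \<in> ball x (- x)" for y
    using that by (auto simp: dist_real_def)
  have "smooth_on k x (- x) 0"
    unfolding smooth_on_def
  proof (intro conjI ballI allI impI)
    fix y z i assume y: "y \<in> ball x (- x)"
    show "(D i has_real_derivative D (Suc i) y) (at y)"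
      using D_neg(2)[OF neg[OF y], of i] D_neg(1)[OF neg[OF y], of "Suc i"] by simp
    assume z: "z \<in> ball x (- x)"
    show "\<bar>D i y - D i z\<bar> \<le> 0 * \<bar>y - z\<bar>"
      using D_neg(1)[OF neg[OF y], of i] D_neg(1)[OF neg[OF z], of i] by simp
  qed
  thus ?thesis using assms unfolding smooth_near_def by (intro exI[of _ "- x"]) auto
qed

text \<open>One constant for all n. The bound by \<open>K * min 1 (g n)\<close> is the majorant of
  the differentiated series; the last bound controls increments at shifted points, which may be far
  from x.\<close>

definition uniformly_smooth :: "nat \<Rightarrow> real \<Rightarrow> real \<Rightarrow> real \<Rightarrow> bool" where
  "uniformly_smooth k x r K \<longleftrightarrow> smooth_on k x r K \<and> (\<forall>n. 0 < a n \<longrightarrow>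
     (\<forall>y\<in>ball x r. (\<forall>i<k. (D i has_real_derivative D (Suc i) (y - g n)) (at (y - g n))) \<and>
        (\<forall>i\<le>k. \<bar>D i (y - g n) - D i y\<bar> \<le> K * min 1 (g n) \<and>
           (\<forall>z\<in>ball x r. \<bar>D i (y - g n) - D i (z - g n)\<bar> \<le> K * \<bar>y - z\<bar>))))"

lemma smooth_on_bounded:
  assumes "smooth_on k x r C" "y \<in> ball x r" "r \<le> 1" "i \<le> k" "0 \<le> C"
  shows "\<bar>D i y\<bar> \<le> \<bar>D i x\<bar> + C"
proof -
  have "x \<in> ball x r" using assms(2) by (auto simp: dist_real_def)
  hence "\<bar>D i y - D i x\<bar> \<le> C * \<bar>y - x\<bar>"
    using assms unfolding smooth_on_def by blast
  also have "\<dots> \<le> C * 1"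
    using assms by (intro mult_left_mono) (auto simp: dist_real_def)
  finally show ?thesis by linarith
qed

text \<open>For g n < r0 / 2 the shifted ball stays in the ball of radius r0 about x. The atoms in F
  are finitely many, so their radii have a positive minimum and their constants a maximum. Beyond x
  + 1 the shifted ball lies in the negative half-line, where all derivatives vanish.\<close>

lemma uniformly_smooth_exists:
  assumes "smooth_near k x" and shift: "\<And>n. 0 < a n \<Longrightarrow> smooth_near k (x - g n)"
    and "0 < x"
  obtains r K where "0 < r" "r \<le> 1" "r \<le> x" "0 \<le> K" "uniformly_smooth k x r K"
proof -
  obtain r1 C0 where r1: "0 < r1" "smooth_on k x r1 C0"
    using assms(1) unfolding smooth_near_def by auto
  define r0 where "r0 = Min {r1, x, 1}"
  have r0: "0 < r0" "r0 \<le> 1" "r0 \<le> x" "r0 \<le> r1"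
    using r1 \<open>0 < x\<close> by (auto simp: r0_def)
  have sm0: "smooth_on k x r0 C0" using smooth_on_mono[OF r1(2) r0(4)] by simp
  define F where "F = {n. 0 < a n \<and> r0 / 2 \<le> g n \<and> g n \<le> x + 1}"
  have "finite F" unfolding F_def using locally_finite[of "r0 / 2"] r0 by simp
  have "\<forall>n\<in>F. \<exists>r C. 0 < r \<and> smooth_on k (x - g n) r C"
    using shift unfolding F_def smooth_near_def by blast
  then obtain rr CC where rC: "\<And>n. n \<in> F \<Longrightarrow> 0 < rr n \<and> smooth_on k (x - g n) (rr n) (CC n)"
    by metis
  define r where "r = Min (insert (r0 / 2) (rr ` F))"
  define K1 where "K1 = Max (insert \<bar>C0\<bar> ((\<lambda>n. \<bar>CC n\<bar>) ` F))"
  have r: "0 < r" "r \<le> r0 / 2" "\<And>n. n \<in> F \<Longrightarrow> r \<le> rr n"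
  proof -
    show "r \<le> r0 / 2" unfolding r_def by (rule Min_le) (use \<open>finite F\<close> in auto)
  qed (use \<open>finite F\<close> rC r0 in \<open>auto simp: r_def\<close>)
  have K1: "0 \<le> K1" "C0 \<le> K1" "\<And>n. n \<in> F \<Longrightarrow> CC n \<le> K1"
  proof -
    have "\<bar>C0\<bar> \<le> K1" using \<open>finite F\<close> by (auto simp: K1_def)
    thus "0 \<le> K1" "C0 \<le> K1" by auto
    fix n assume "n \<in> F"
    hence "\<bar>CC n\<bar> \<le> K1" using \<open>finite F\<close> by (auto simp: K1_def)
    thus "CC n \<le> K1" by auto
  qed
  have sm: "smooth_on k x r0 K1" "smooth_on k x r K1"
    using r r0 K1 by (auto intro: smooth_on_mono[OF sm0])
  have smF: "smooth_on k (x - g n) r K1" if "n \<in> F" for n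
    using rC[OF that] r(3)[OF that] K1(3)[OF that] by (blast intro: smooth_on_mono)
  \<comment> \<open>B bounds the sum of the absolute values of \<open>D i\<close> at y and at y - g
    n for n in F: each is at most its value at the centre plus the oscillation K1, the radius being
    below 1.\<close>
  define B where "B = (\<Sum>i\<le>k. \<bar>D i x\<bar>) + K1 + (\<Sum>n\<in>F. \<Sum>i\<le>k. \<bar>D i (x - g n)\<bar>) + K1"
  \<comment> \<open>All atoms but the small ones satisfy r0 / 2 \<le> min 1 (g n), so division by r0
    / 2 turns the bound B into a multiple of \<open>min 1 (g n)\<close>.\<close>
  define K where "K = K1 + B / (r0 / 2)"
  have sumF0: "0 \<le> (\<Sum>n\<in>F. \<Sum>i\<le>k. \<bar>D i (x - g n)\<bar>)" "0 \<le> (\<Sum>i\<le>k. \<bar>D i x\<bar>)"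
    by (auto intro!: sum_nonneg)
  have B0: "0 \<le> B" unfolding B_def using sumF0 K1 by linarith
  have "K1 \<le> K" "0 \<le> K" using B0 r0 K1(1) by (auto simp: K_def)
  have BK: "B \<le> K * min 1 t" if "r0 / 2 \<le> t" for t
  proof -
    have "B = B / (r0 / 2) * (r0 / 2)" using r0 by simp
    also have "\<dots> \<le> K * min 1 t"
      using that r0 B0 K1 by (intro mult_mono) (auto simp: K_def)
    finally show ?thesis .
  qed
  have Dx: "\<bar>D i y\<bar> \<le> B - K1 - (\<Sum>n\<in>F. \<Sum>i\<le>k. \<bar>D i (x - g n)\<bar>)" if "i \<le> k" "y \<in> ball x r" for i y
  proof -
    have "\<bar>D i x\<bar> \<le> (\<Sum>i\<le>k. \<bar>D i x\<bar>)" using that by (intro member_le_sum) auto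
    thus ?thesis using smooth_on_bounded[OF sm(2) that(2) _ that(1) K1(1)] r r0
      by (simp add: B_def)
  qed
  have "uniformly_smooth k x r K"
    unfolding uniformly_smooth_def
  proof (intro conjI allI impI ballI)
    show "smooth_on k x r K" using smooth_on_mono[OF sm(2)] \<open>K1 \<le> K\<close> by simp
  next
    fix n y i assume n: "0 < a n" and y: "y \<in> ball x r"
    consider "g n < r0 / 2" | "n \<in> F" | "x + 1 < g n" "n \<notin> F"
      using n unfolding F_def by fastforce
    note cases = this
    have near: "y - g n \<in> ball x r0" "y \<in> ball x r0" if "g n < r0 / 2"
      using that y r g_pos[of n] by (auto simp: dist_real_def)
    have far: "y - g n < 0" if "x + 1 < g n" "y \<in> ball x r" for y
      using that r r0 by (auto simp: dist_real_def)
    have ballF: "y - g n \<in> ball (x - g n) r" if "y \<in> ball x r" for y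
      using that by (auto simp: dist_real_def)
    show "(D i has_real_derivative D (Suc i) (y - g n)) (at (y - g n))" if i: "i < k"
      using cases
    proof cases
      case 1
      thus ?thesis using sm(1) near i unfolding smooth_on_def by blast
    next
      case 2
      thus ?thesis using smF[OF 2] ballF[OF y] i unfolding smooth_on_def by blast
    next
      case 3
      thus ?thesis using D_neg[OF far[OF 3(1) y]] by metis
    qed
    assume i: "i \<le> k"
    show "\<bar>D i (y - g n) - D i y\<bar> \<le> K * min 1 (g n)"
      using cases
    proof cases
      case 1
      have "\<bar>D i (y - g n) - D i y\<bar> \<le> K1 * \<bar>y - g n - y\<bar>"
        using sm(1) near[OF 1] i unfolding smooth_on_def by blast
      also have "\<dots> \<le> K * min 1 (g n)"
        using 1 r0 g_pos[of n] \<open>K1 \<le> K\<close> K1 by (intro mult_mono) auto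
      finally show ?thesis .
    next
      case 2
      have "\<bar>D i (x - g n)\<bar> \<le> (\<Sum>i\<le>k. \<bar>D i (x - g n)\<bar>)"
        using i by (intro member_le_sum) auto
      also have "\<dots> \<le> (\<Sum>n\<in>F. \<Sum>i\<le>k. \<bar>D i (x - g n)\<bar>)"
        using 2 \<open>finite F\<close> by (intro member_le_sum) (auto intro: sum_nonneg)
      finally have "\<bar>D i (y - g n) - D i y\<bar> \<le> B"
        using smooth_on_bounded[OF smF[OF 2] ballF[OF y] _ i K1(1)] Dx[OF i y] r r0 by linarith
      also have "\<dots> \<le> K * min 1 (g n)" using 2 by (intro BK) (auto simp: F_def)
      finally show ?thesis .
    next
      case 3
      have "\<bar>D i (y - g n) - D i y\<bar> \<le> B"
        using D_neg(1)[OF far[OF 3(1) y], of i] Dx[OF i y] sumF0 K1 by linarith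
      also have "\<dots> \<le> K * min 1 (g n)" using 3 r0 \<open>0 < x\<close> by (intro BK) auto
      finally show ?thesis .
    qed
    fix z assume z: "z \<in> ball x r"
    have "\<bar>D i (y - g n) - D i (z - g n)\<bar> \<le> K1 * \<bar>y - z\<bar>"
      using cases
    proof cases
      case 1
      hence "z - g n \<in> ball x r0" using z r g_pos[of n] by (auto simp: dist_real_def)
      hence "\<bar>D i (y - g n) - D i (z - g n)\<bar> \<le> K1 * \<bar>(y - g n) - (z - g n)\<bar>"
        using sm(1) near[OF 1] i unfolding smooth_on_def by blast
      thus ?thesis by simp
    next
      case 2
      have "\<bar>D i (y - g n) - D i (z - g n)\<bar> \<le> K1 * \<bar>(y - g n) - (z - g n)\<bar>"
        using smF[OF 2] ballF[OF y] ballF[OF z] i unfolding smooth_on_def by blast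
      thus ?thesis by simp
    next
      case 3
      thus ?thesis using D_neg(1)[OF far[OF 3(1) y], of i] D_neg(1)[OF far[OF 3(1) z], of i] K1
        by simp
    qed
    also have "\<dots> \<le> K * \<bar>y - z\<bar>" using \<open>K1 \<le> K\<close> by (intro mult_right_mono) auto
    finally show "\<bar>D i (y - g n) - D i (z - g n)\<bar> \<le> K * \<bar>y - z\<bar>" .
  qed
  thus ?thesis using that[of r K] r r0 \<open>0 \<le> K\<close> by auto
qed

text \<open>The case i = k goes beyond the hypothesis: \<open>D k\<close> itself becomes
  differentiable. For k > 0 the equation expresses it through \<open>D (k - 1)\<close>, whose
  difference series may be differentiated term by term; for k = 0 this is \<open>U_deriv\<close>.
  The constant 1 disappears with the first differentiation.\<close>

lemma higher_deriv_eq: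
  assumes us: "uniformly_smooth k x r K" and "r \<le> x" and "i \<le> k" and "y \<in> ball x r"
  shows "(D i has_real_derivative D (Suc i) y) (at y)"
    and "D (Suc i) y = ((if i = 0 then 1 else 0) - q * D i y + (\<Sum>n. a n * (D i (y - g n) - D i y))) / \<delta>"
proof -
  have "\<forall>y\<in>ball x r. (D i has_real_derivative D (Suc i) y) (at y) \<and>
    D (Suc i) y = ((if i = 0 then 1 else 0) - q * D i y + (\<Sum>n. a n * (D i (y - g n) - D i y))) / \<delta>"
    using \<open>i \<le> k\<close>
  proof (induction i)
    case 0
    show ?case
    proof
      fix y assume "y \<in> ball x r"
      hence "0 < y" using \<open>r \<le> x\<close> by (auto simp: dist_real_def)
      from U_deriv[OF this] DERIV_imp_deriv[OF U_deriv[OF this]]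
      show "(D 0 has_real_derivative D (Suc 0) y) (at y) \<and> D (Suc 0) y =
         ((if (0::nat) = 0 then 1 else 0) - q * D 0 y + (\<Sum>n. a n * (D 0 (y - g n) - D 0 y))) / \<delta>"
        by simp
    qed
  next
    case (Suc i)
    define c where "c = (if i = 0 then 1 else 0 :: real)"
    have IH: "(D i has_real_derivative D (Suc i) y) (at y)"
      "D (Suc i) y = (c - q * D i y + (\<Sum>n. a n * (D i (y - g n) - D i y))) / \<delta>"
      if "y \<in> ball x r" for y
      unfolding c_def using Suc.IH[OF Suc_leD[OF Suc.prems]] that by blast+
    show ?case
    proof
      fix y assume y: "y \<in> ball x r"
      obtain s where s: "0 < s" "ball y s \<subseteq> ball x r"
        using y open_ball by (meson open_contains_ball)
      have "((\<lambda>y. \<Sum>n. a n * (D i (y - g n) - D i y)) has_real_derivative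
              (\<Sum>n. a n * (D (Suc i) (y - g n) - D (Suc i) y))) (at y)"
      proof (rule difference_series_has_derivative[where r = s and K = K and ?K0.0 = K])
        fix n assume n: "0 < a n"
        note us' = us[unfolded uniformly_smooth_def, THEN conjunct2, rule_format, OF n]
        show "\<bar>D i (y - g n) - D i y\<bar> \<le> K * min 1 (g n)"
          using us'[OF y] Suc.prems by (meson Suc_leD)
        fix y' assume "y' \<in> ball y s"
        hence y': "y' \<in> ball x r" using s by blast
        show "(D i has_real_derivative D (Suc i) (y' - g n)) (at (y' - g n))"
          using us'[OF y'] Suc.prems by (meson Suc_le_lessD)
        show "\<bar>D (Suc i) (y' - g n) - D (Suc i) y'\<bar> \<le> K * min 1 (g n)"
          using us'[OF y'] Suc.prems by blast
      qed (use s a_nonneg g_pos summable_min IH(1) in \<open>auto intro: less_imp_le simp del: funpow.simps\<close>)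
      hence "((\<lambda>y. (c - q * D i y + (\<Sum>n. a n * (D i (y - g n) - D i y))) / \<delta>) has_real_derivative
              (0 - q * D (Suc i) y + (\<Sum>n. a n * (D (Suc i) (y - g n) - D (Suc i) y))) / \<delta>) (at y)"
        using IH(1)[OF y] delta_pos
        by (auto intro!: derivative_eq_intros simp del: funpow.simps)
      hence "(D (Suc i) has_real_derivative
              (0 - q * D (Suc i) y + (\<Sum>n. a n * (D (Suc i) (y - g n) - D (Suc i) y))) / \<delta>) (at y)"
        by (rule has_field_derivative_transform_within_open[where S = "ball x r"])
           (use y IH(2) in \<open>auto simp del: funpow.simps\<close>)
      moreover from DERIV_imp_deriv[OF this] have "D (Suc (Suc i)) y =
          (0 - q * D (Suc i) y + (\<Sum>n. a n * (D (Suc i) (y - g n) - D (Suc i) y))) / \<delta>" by simp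
      ultimately show "(D (Suc i) has_real_derivative D (Suc (Suc i)) y) (at y) \<and>
        D (Suc (Suc i)) y = ((if Suc i = 0 then 1 else 0) - q * D (Suc i) y +
           (\<Sum>n. a n * (D (Suc i) (y - g n) - D (Suc i) y))) / \<delta>"
        by simp
    qed
  qed
  thus "(D i has_real_derivative D (Suc i) y) (at y)"
    "D (Suc i) y = ((if i = 0 then 1 else 0) - q * D i y + (\<Sum>n. a n * (D i (y - g n) - D i y))) / \<delta>"
    using \<open>y \<in> ball x r\<close> by blast+
qed

text \<open>If the derivative of order \<open>k + 1\<close> is Hoelder with exponent \<open>\<alpha>\<close>, then the second differences of the
  \<open>k\<close>-th one over steps \<open>g\<close> and \<open>h\<close> are at most \<open>K g h\<^sup>\<alpha>\<close> and \<open>K h g\<^sup>\<alpha>\<close>, and interpolating between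
  the two bounds raises the exponent to \<open>min 1 (\<alpha> + 1 - \<gamma>)\<close>. The induction starts from mere
  boundedness (\<open>\<alpha> = 0\<close>).\<close>

lemma deriv_lipschitz_bootstrap:
  assumes us: "uniformly_smooth k x r K" and r: "0 < r" "r \<le> x" "r \<le> 1" and K: "0 \<le> K"
  obtains r' K' where "0 < r'" "r' \<le> r"
    "\<And>y z. \<lbrakk>y \<in> ball x r'; z \<in> ball x r'\<rbrakk> \<Longrightarrow> \<bar>D (Suc k) y - D (Suc k) z\<bar> \<le> K' * \<bar>y - z\<bar>"
proof -
  define \<eta> where "\<eta> = 1 - \<gamma>"
  define T where "T = (\<Sum>n. a n * min 1 (g n powr \<gamma>))"
  have \<eta>: "0 < \<eta>" using gamma by (simp add: \<eta>_def)
  have sm: "smooth_on k x r K" using us by (simp add: uniformly_smooth_def)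
  note deq = higher_deriv_eq(2)[OF us r(2) order_refl]
  note dk = higher_deriv_eq(1)[OF us r(2) order_refl]
  have step: "\<bar>D k (y - g n) - D k y\<bar> \<le> K * min 1 (g n)"
    and lip_shift: "z \<in> ball x r \<Longrightarrow> \<bar>D k (y - g n) - D k (z - g n)\<bar> \<le> K * \<bar>y - z\<bar>"
    if "0 < a n" "y \<in> ball x r" for n y z
    using us that by (auto simp: uniformly_smooth_def)
  have lip: "\<bar>D k y - D k z\<bar> \<le> K * \<bar>y - z\<bar>" if "y \<in> ball x r" "z \<in> ball x r" for y z
    using sm that by (auto simp: smooth_on_def)
  have term_le: "norm (a n * (D k (y - g n) - D k y)) \<le> K * (a n * min 1 (g n))"
    if "y \<in> ball x r" for n y
    using step[OF _ that, of n] a_nonneg[of n]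
    by (cases "a n = 0") (auto simp: abs_mult mult.left_commute[of K] intro!: mult_left_mono)
  have summ: "summable (\<lambda>n. a n * (D k (y - g n) - D k y))" if "y \<in> ball x r" for y
    by (rule summable_comparison_test'[OF summable_mult[OF summable_min, of K]])
       (use term_le[OF that] in auto)
  have "\<exists>r' K'. 0 < r' \<and> r' \<le> r \<and> 0 \<le> K' \<and> (\<forall>y\<in>ball x r'. \<forall>z\<in>ball x r'.
     \<bar>D (Suc k) y - D (Suc k) z\<bar> \<le> K' * \<bar>y - z\<bar> powr (min 1 (real j * \<eta>)))" for j
  proof (induction j)
    case 0
    define B where "B = (1 + \<bar>q\<bar> * (\<bar>D k x\<bar> + K) + K * (\<Sum>n. a n * min 1 (g n))) / \<delta>"
    have B: "\<bar>D (Suc k) y\<bar> \<le> B" if y: "y \<in> ball x r" for y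
    proof -
      have "\<bar>\<Sum>n. a n * (D k (y - g n) - D k y)\<bar> \<le> (\<Sum>n. K * (a n * min 1 (g n)))"
        using norm_suminf_le[OF term_le[OF y] summable_mult[OF summable_min]] by simp
      also have "\<dots> = K * (\<Sum>n. a n * min 1 (g n))"
        by (rule suminf_mult[OF summable_min])
      finally have 1: "\<bar>\<Sum>n. a n * (D k (y - g n) - D k y)\<bar> \<le> K * (\<Sum>n. a n * min 1 (g n))" .
      have 2: "\<bar>q * D k y\<bar> \<le> \<bar>q\<bar> * (\<bar>D k x\<bar> + K)"
        unfolding abs_mult using smooth_on_bounded[OF sm y r(3) order_refl K]
        by (intro mult_left_mono) auto
      have "\<bar>(if k = 0 then 1 else 0) - q * D k y + (\<Sum>n. a n * (D k (y - g n) - D k y))\<bar>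
          \<le> 1 + \<bar>q\<bar> * (\<bar>D k x\<bar> + K) + K * (\<Sum>n. a n * min 1 (g n))"
        using 1 2 by auto
      thus ?thesis
        unfolding deq[OF y] B_def abs_divide using delta_pos by (simp add: divide_right_mono)
    qed
    have "\<bar>D (Suc k) y - D (Suc k) z\<bar> \<le> 2 * B * \<bar>y - z\<bar> powr (min 1 (real 0 * \<eta>))"
      if "y \<in> ball x r" "z \<in> ball x r" for y z
      \<comment> \<open>For y = z the right-hand side is 0, because \<open>0 powr 0 = 0\<close>;
        hence the case distinction.\<close>
      using B[OF that(1)] B[OF that(2)] by (cases "y = z") auto
    moreover have "0 \<le> B" using B[of x] r by (auto intro: order_trans[OF abs_ge_zero])
    ultimately show ?case using r by (intro exI[of _ r] exI[of _ "2 * B"]) auto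
  next
    case (Suc j)
    define \<alpha> where "\<alpha> = min 1 (real j * \<eta>)"
    define \<beta> where "\<beta> = min 1 (\<alpha> + (1 - \<gamma>))"
    have \<beta>: "\<beta> = min 1 (real (Suc j) * \<eta>)" "\<beta> \<le> 1"
      using \<eta> by (auto simp: \<beta>_def \<alpha>_def \<eta>_def min_def algebra_simps)
    have \<alpha>: "0 \<le> \<alpha>" using \<eta> by (simp add: \<alpha>_def)
    from Suc obtain r1 K1 where r1: "0 < r1" "r1 \<le> r" "0 \<le> K1"
      and hoelder: "\<And>y z. \<lbrakk>y \<in> ball x r1; z \<in> ball x r1\<rbrakk> \<Longrightarrow>
        \<bar>D (Suc k) y - D (Suc k) z\<bar> \<le> K1 * \<bar>y - z\<bar> powr \<alpha>"
      unfolding \<alpha>_def by metis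
    \<comment> \<open>Halving keeps the whole interval from z - g n to y inside the ball of radius
      r1 as long as g n < r2.\<close>
    define r2 where "r2 = r1 / 2"
    have r2: "0 < r2" "r2 \<le> r" "r2 < 1" using r1 r by (auto simp: r2_def)
    \<comment> \<open>K1 serves the atoms below r2. For the others both increments are at most K h,
      and the factor \<open>min 1 (g n powr \<gamma>) / r2 powr \<gamma>\<close>, which is at least
      1, supplies the weight needed for summation.\<close>
    define W where "W = K1 + 2 * K / r2 powr \<gamma>"
    have W: "0 \<le> W" "K1 \<le> W" "2 * K / r2 powr \<gamma> \<le> W" using r1 K by (auto simp: W_def)
    have main: "\<bar>D (Suc k) y - D (Suc k) z\<bar> \<le> ((\<bar>q\<bar> * K + W * T) / \<delta>) * \<bar>y - z\<bar> powr \<beta>"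
      if y: "y \<in> ball x r2" and z: "z \<in> ball x r2" and "z < y" for y z
    proof -
      have yr: "y \<in> ball x r" and zr: "z \<in> ball x r" using y z r2 by auto
      define h where "h = y - z"
      have "\<bar>x - y\<bar> < 1 / 2" "\<bar>x - z\<bar> < 1 / 2"
        using y z r1 r by (auto simp: dist_real_def r2_def)
      hence h: "0 < h" "h \<le> 1" "\<bar>y - z\<bar> = h" "y = z + h"
        using \<open>z < y\<close> unfolding h_def by linarith+
      have h_le: "h \<le> h powr \<beta>" using powr_mono'[of \<beta> 1 h] h \<beta>(2) by simp
      have 1: "\<bar>q * D k y - q * D k z\<bar> \<le> (\<bar>q\<bar> * K) * h powr \<beta>"
      proof -
        have "\<bar>q * D k y - q * D k z\<bar> = \<bar>q\<bar> * \<bar>D k y - D k z\<bar>"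
          by (simp flip: abs_mult right_diff_distrib)
        also have "\<dots> \<le> \<bar>q\<bar> * (K * h)"
          using lip[OF yr zr] h by (intro mult_left_mono) auto
        also have "\<dots> \<le> \<bar>q\<bar> * (K * h powr \<beta>)"
          using h_le K by (intro mult_left_mono) auto
        finally show ?thesis by (simp add: mult.assoc)
      qed
      have dd: "\<bar>(D k (y - g n) - D k y) - (D k (z - g n) - D k z)\<bar>
          \<le> W * h powr \<beta> * min 1 (g n powr \<gamma>)" if n: "0 < a n" for n
      proof (cases "g n < r2")
        case True
        define p where "p = z - g n"
        have sub: "{p..p + h + g n} \<subseteq> ball x r1"
        proof
          fix w assume "w \<in> {p..p + h + g n}"
          hence "x - r1 / 2 < w + r1 / 2" "w < x + r1 / 2"
          proof -
            have "\<bar>x - y\<bar> < r1 / 2" "\<bar>x - z\<bar> < r1 / 2" "z - g n \<le> w" "w \<le> y" "g n < r1 / 2"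
              using \<open>w \<in> _\<close> y z True h by (auto simp: r2_def p_def dist_real_def)
            thus "x - r1 / 2 < w + r1 / 2" "w < x + r1 / 2" by linarith+
          qed
          thus "w \<in> ball x r1" unfolding mem_ball dist_real_def using r1 by linarith
        qed
        have der: "(D k has_real_derivative D (Suc k) y) (at y)" if "y \<in> {p..p + h + g n}" for y
          using dk sub that r1 by (metis subset_ball subsetD)
        \<comment> \<open>The same second difference read twice, with the steps h and g n
          exchanged.\<close>
        have eq: "\<bar>(D k (y - g n) - D k y) - (D k (z - g n) - D k z)\<bar> =
           \<bar>D k (p + h + g n) - D k (p + h) - D k (p + g n) + D k p\<bar>"
          "\<bar>(D k (y - g n) - D k y) - (D k (z - g n) - D k z)\<bar> =
           \<bar>D k (p + g n + h) - D k (p + g n) - D k (p + h) + D k p\<bar>"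
          using h by (simp_all add: p_def algebra_simps)
        have "\<bar>(D k (y - g n) - D k y) - (D k (z - g n) - D k z)\<bar> \<le> K1 * h * g n powr \<alpha>"
          unfolding eq(1)
          by (rule double_difference_bound[OF der hoelder]) (use sub h g_pos[of n] in auto)
        moreover have "\<bar>(D k (y - g n) - D k y) - (D k (z - g n) - D k z)\<bar> \<le> K1 * g n * h powr \<alpha>"
          unfolding eq(2)
          by (rule double_difference_bound[OF der hoelder])
             (use sub h g_pos[of n] in \<open>auto simp: add_ac\<close>)
        ultimately have "\<bar>(D k (y - g n) - D k y) - (D k (z - g n) - D k z)\<bar> \<le>
            K1 * min (g n * h powr \<alpha>) (h * g n powr \<alpha>)"
          by (simp add: min_def mult.assoc)
        also have "\<dots> \<le> K1 * (g n powr \<gamma> * h powr \<beta>)"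
          unfolding \<beta>_def
          by (intro mult_left_mono powr_interpolation r1 g_pos h gamma \<alpha>) (use True r2 in auto)
        also have "\<dots> \<le> W * (g n powr \<gamma> * h powr \<beta>)"
          using W by (intro mult_right_mono) auto
        also have "g n powr \<gamma> = min 1 (g n powr \<gamma>)"
          using True r2 gamma g_pos[of n] by (intro min_absorb2[symmetric] powr_le1) auto
        finally show ?thesis by (simp add: mult_ac)
      next
        case False
        have "r2 powr \<gamma> \<le> min 1 (g n powr \<gamma>)"
          using False r2 gamma by (auto intro: powr_mono2 powr_le1)
        hence one: "1 \<le> min 1 (g n powr \<gamma>) / r2 powr \<gamma>"
          using r2 by (simp add: le_divide_eq)
        have "\<bar>(D k (y - g n) - D k y) - (D k (z - g n) - D k z)\<bar> \<le> 2 * K * h"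
          using lip[OF yr zr] lip_shift[OF n yr zr] unfolding h(3) by (simp add: mult.assoc)
        also have "\<dots> \<le> 2 * K * h powr \<beta> * 1" using h_le K by (simp add: mult_left_mono)
        also have "\<dots> \<le> 2 * K * h powr \<beta> * (min 1 (g n powr \<gamma>) / r2 powr \<gamma>)"
          using one K by (intro mult_left_mono) auto
        also have "\<dots> = (2 * K / r2 powr \<gamma>) * (h powr \<beta> * min 1 (g n powr \<gamma>))"
          by (simp add: field_simps)
        also have "\<dots> \<le> W * (h powr \<beta> * min 1 (g n powr \<gamma>))"
          using W by (intro mult_right_mono) auto
        finally show ?thesis by (simp add: mult_ac)
      qed
      have "\<bar>\<Sum>n. a n * (D k (y - g n) - D k y) - a n * (D k (z - g n) - D k z)\<bar>
          \<le> (\<Sum>n. W * h powr \<beta> * (a n * min 1 (g n powr \<gamma>)))"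
        unfolding real_norm_def[symmetric]
      proof (rule norm_suminf_le)
        show "summable (\<lambda>n. W * h powr \<beta> * (a n * min 1 (g n powr \<gamma>)))"
          by (intro summable_mult summable_powr)
        fix n
        show "norm (a n * (D k (y - g n) - D k y) - a n * (D k (z - g n) - D k z))
            \<le> W * h powr \<beta> * (a n * min 1 (g n powr \<gamma>))"
        proof (cases "a n = 0")
          case False
          hence n: "0 < a n" using a_nonneg[of n] by simp
          have "norm (a n * (D k (y - g n) - D k y) - a n * (D k (z - g n) - D k z)) =
            a n * \<bar>(D k (y - g n) - D k y) - (D k (z - g n) - D k z)\<bar>"
            using n by (simp flip: right_diff_distrib add: abs_mult)
          also have "\<dots> \<le> a n * (W * h powr \<beta> * min 1 (g n powr \<gamma>))"
            using n by (intro mult_left_mono dd) auto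
          finally show ?thesis by (simp add: mult_ac)
        qed auto
      qed
      also have "\<dots> = W * h powr \<beta> * T" unfolding T_def by (rule suminf_mult[OF summable_powr])
      also have "(\<Sum>n. a n * (D k (y - g n) - D k y) - a n * (D k (z - g n) - D k z)) =
        (\<Sum>n. a n * (D k (y - g n) - D k y)) - (\<Sum>n. a n * (D k (z - g n) - D k z))"
        by (rule suminf_diff[symmetric, OF summ[OF yr] summ[OF zr]])
      finally have 2: "\<bar>(\<Sum>n. a n * (D k (y - g n) - D k y)) - (\<Sum>n. a n * (D k (z - g n) - D k z))\<bar>
          \<le> W * T * h powr \<beta>" by (simp add: mult_ac)
      have "\<delta> * \<bar>D (Suc k) y - D (Suc k) z\<bar> = \<bar>\<delta> * D (Suc k) y - \<delta> * D (Suc k) z\<bar>"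
        using delta_pos by (simp flip: right_diff_distrib add: abs_mult)
      also have "\<dots> = \<bar>(\<Sum>n. a n * (D k (y - g n) - D k y)) - (\<Sum>n. a n * (D k (z - g n) - D k z))
           - (q * D k y - q * D k z)\<bar>"
        unfolding deq[OF yr] deq[OF zr] using delta_pos by simp
      also have "\<dots> \<le> (\<bar>q\<bar> * K + W * T) * h powr \<beta>"
        unfolding distrib_right using 1 2 by linarith
      finally show ?thesis using delta_pos h by (simp add: field_simps)
    qed
    have "0 \<le> T" unfolding T_def using a_nonneg by (intro suminf_nonneg summable_powr) auto
    hence "0 \<le> (\<bar>q\<bar> * K + W * T) / \<delta>" using K W delta_pos by auto
    moreover have "\<bar>D (Suc k) y - D (Suc k) z\<bar> \<le> ((\<bar>q\<bar> * K + W * T) / \<delta>) * \<bar>y - z\<bar> powr \<beta>"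
      if "y \<in> ball x r2" "z \<in> ball x r2" for y z
      using main[OF that] main[OF that(2,1)]
      by (cases y z rule: linorder_cases) (auto simp: abs_minus_commute simp del: funpow.simps)
    ultimately show ?case unfolding \<beta>(1)[symmetric] using r2 by blast
  qed
  \<comment> \<open>More than 1 / \<eta> rounds suffice: then the exponent is capped at 1, which is
    the Lipschitz bound.\<close>
  moreover obtain j :: nat where "1 / \<eta> < real j" using reals_Archimedean2 by blast
  hence "min 1 (real j * \<eta>) = 1" using \<eta> by (simp add: field_simps)
  ultimately obtain r' K' where "0 < r'" "r' \<le> r" "\<forall>y\<in>ball x r'. \<forall>z\<in>ball x r'.
     \<bar>D (Suc k) y - D (Suc k) z\<bar> \<le> K' * \<bar>y - z\<bar> powr 1" by metis
  thus ?thesis by (intro that[of r' K']) (auto simp del: funpow.simps)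
qed

section \<open>Sums of atoms and smoothness away from them\<close>

primrec exact_sums :: "nat \<Rightarrow> real set" where
  "exact_sums 0 = {0}"
| "exact_sums (Suc k) = (\<Union>n\<in>{n. 0 < a n}. (+) (g n) ` exact_sums k)"

text \<open>The strict bound makes this the set where k-fold differentiability fails. It contains 0
  for k > 0, the empty sum being the position of the first kink.\<close>

definition sums_below :: "nat \<Rightarrow> real set" where
  "sums_below k = (\<Union>j<k. exact_sums j)"

lemma exact_sums_nonneg: "s \<in> exact_sums k \<Longrightarrow> 0 \<le> s"
  by (induction k arbitrary: s) (auto intro!: add_nonneg_nonneg[OF less_imp_le[OF g_pos]])

lemma sums_below_Suc: "sums_below (Suc k) = sums_below k \<union> exact_sums k"
  by (auto simp: sums_below_def less_Suc_eq)

lemma sums_below_shift: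
  assumes "x \<notin> sums_below (Suc k)" "0 < a n"
  shows "x - g n \<notin> sums_below k"
proof
  assume "x - g n \<in> sums_below k"
  then obtain j where j: "j < k" "x - g n \<in> exact_sums j" by (auto simp: sums_below_def)
  hence "g n + (x - g n) \<in> exact_sums (Suc j)" using assms(2) unfolding exact_sums.simps by blast
  hence "x \<in> exact_sums (Suc j)" by simp
  hence "x \<in> sums_below (Suc k)"
    unfolding sums_below_def using j(1)
    by (intro UN_I[of "Suc j"]) (simp_all del: exact_sums.simps)
  with assms(1) show False by contradiction
qed

text \<open>Neither x nor any x - g n lies in \<open>sums_below k\<close>, so all of them have level
  k. The equation then yields one more derivative at x, and the bootstrap its Lipschitz continuity.
  Level 0 is the global Lipschitz bound.\<close>

theorem smooth_near_outside_sums: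
  "x \<notin> sums_below k \<Longrightarrow> smooth_near k x"
proof (induction k arbitrary: x)
  case 0
  have "smooth_on 0 x 1 L" using U_lipschitz by (auto simp: smooth_on_def)
  thus ?case unfolding smooth_near_def by (intro exI[of _ 1]) auto
next
  case (Suc k)
  \<comment> \<open>The empty sum excludes x = 0, the one point without a neighbourhood on which U
    either vanishes or obeys the equation.\<close>
  have "0 \<in> sums_below (Suc k)" unfolding sums_below_def by (rule UN_I[of 0]) auto
  with Suc.prems have "x \<noteq> 0" by auto
  then consider "x < 0" | "0 < x" by linarith
  thus ?case
  proof cases
    case 2
    have "smooth_near k x" using Suc by (auto simp: sums_below_Suc)
    moreover have "smooth_near k (x - g n)" if "0 < a n" for n
      using Suc.IH sums_below_shift[OF Suc.prems that] by blast
    ultimately obtain r K where r: "0 < r" "r \<le> 1" "r \<le> x" "0 \<le> K" "uniformly_smooth k x r K"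
      by (rule uniformly_smooth_exists[OF _ _ 2])
    obtain r' K' where r': "0 < r'" "r' \<le> r" "\<And>y z. \<lbrakk>y \<in> ball x r'; z \<in> ball x r'\<rbrakk> \<Longrightarrow>
        \<bar>D (Suc k) y - D (Suc k) z\<bar> \<le> K' * \<bar>y - z\<bar>"
      by (rule deriv_lipschitz_bootstrap[OF r(5,1,3,2,4)]) blast
    have sm: "smooth_on k x r' (max K K')"
      using r(5)[unfolded uniformly_smooth_def, THEN conjunct1] r'(2) by (rule smooth_on_mono) simp
    have "smooth_on (Suc k) x r' (max K K')"
      unfolding smooth_on_def
    proof (intro conjI ballI allI impI)
      fix y i assume "y \<in> ball x r'" "i < Suc k"
      thus "(D i has_real_derivative D (Suc i) y) (at y)"
        using r' by (intro higher_deriv_eq(1)[OF r(5,3)]) auto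
    next
      fix y z i assume yz: "y \<in> ball x r'" "z \<in> ball x r'" "i \<le> Suc k"
      show "\<bar>D i y - D i z\<bar> \<le> max K K' * \<bar>y - z\<bar>"
      proof (cases "i = Suc k")
        case True
        have "K' * \<bar>y - z\<bar> \<le> max K K' * \<bar>y - z\<bar>" by (intro mult_right_mono) auto
        with r'(3)[OF yz(1,2)] show ?thesis unfolding True by (rule order_trans)
      next
        case False
        hence "i \<le> k" using yz(3) by simp
        thus ?thesis using sm yz(1,2) unfolding smooth_on_def by blast
      qed
    qed
    thus ?thesis unfolding smooth_near_def using r'(1) by blast
  qed (rule smooth_near_neg)
qed

section \<open>Propagation of the kink\<close>

text \<open>The order l < r is recorded rather than l \<noteq> r, because this is what sums with
  non-negative weights preserve.\<close>

definition kink :: "nat \<Rightarrow> real \<Rightarrow> bool" where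
  "kink k x \<longleftrightarrow> (\<exists>l r. l < r \<and> (D k has_real_derivative l) (at x within {..x}) \<and>
     (D k has_real_derivative r) (at x within {x..}))"

lemma kink_not_differentiable:
  assumes "kink k x"
  shows "\<not> (D k has_real_derivative d) (at x)"
proof
  assume "(D k has_real_derivative d) (at x)"
  hence "(D k has_real_derivative d) (at x within S)" for S
    by (rule has_field_derivative_at_within)
  with assms show False
    unfolding kink_def
    by (metis at_within_halflines_neq_bot has_real_derivative_unique_within less_irrefl)
qed

text \<open>Differentiating the equation \<open>k\<close> times, the kink at \<open>x\<close> is a sum of the kinks one order lower at
  \<open>x - g n\<close> with positive weights, so no cancellation is possible.\<close>

lemma kink_at_exact_sums:
  "\<lbrakk>x \<in> exact_sums k; x \<notin> sums_below k\<rbrakk> \<Longrightarrow> kink k x"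
proof (induction k arbitrary: x)
  case 0
  have "(U has_real_derivative 0) (at 0 within {..0})"
    by (rule has_field_derivative_transform_within[of "\<lambda>_. 0" _ _ _ 1])
       (use U_nonpos in auto)
  thus ?case using U_right_deriv delta_pos 0
    unfolding kink_def by (intro exI[of _ 0] exI[of _ "1 / \<delta>"]) auto
next
  case (Suc k)
  obtain n0 s where n0: "0 < a n0" "s \<in> exact_sums k" "x = g n0 + s"
    using Suc.prems(1) by auto
  have "0 \<le> s" using n0 exact_sums_nonneg by blast
  hence "0 < x" using n0 g_pos[of n0] by linarith
  have notin: "x - g n \<notin> sums_below k" if "0 < a n" for n
    using sums_below_shift[OF Suc.prems(2) that] .
  have sn: "smooth_near k (x - g n)" if "0 < a n" for n
    using smooth_near_outside_sums[OF notin[OF that]] .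
  have "smooth_near k x"
    using Suc.prems(2) by (intro smooth_near_outside_sums) (auto simp: sums_below_Suc)
  from this sn obtain r K where r: "0 < r" "r \<le> 1" "r \<le> x" "0 \<le> K" "uniformly_smooth k x r K"
    by (rule uniformly_smooth_exists[OF _ _ \<open>0 < x\<close>])
  note deq = higher_deriv_eq(2)[OF r(5,3) order_refl]
  obtain r1 C where r1: "0 < r1" "smooth_on (Suc k) x r1 C"
    using smooth_near_outside_sums[OF Suc.prems(2)] unfolding smooth_near_def by blast
  \<comment> \<open>The ball of radius \<rho>, shifted by less than \<rho>, stays within radius 2
    \<rho>, where \<open>D k\<close> has a Lipschitz derivative.\<close>
  define \<rho> where "\<rho> = min r1 r / 2"
  have \<rho>: "0 < \<rho>" "2 * \<rho> \<le> r1" "\<rho> \<le> r" "\<rho> < 1" using r r1 by (auto simp: \<rho>_def)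
  define C' where "C' = \<bar>C\<bar>"
  have sm: "smooth_on (Suc k) x (2 * \<rho>) C'"
    using smooth_on_mono[OF r1(2) \<rho>(2)] by (simp add: C'_def)
  have "0 \<le> C'" by (simp add: C'_def)
  have der: "(D k has_real_derivative D (Suc k) y) (at y)" if "y \<in> ball x (2 * \<rho>)" for y
    using sm that unfolding smooth_on_def by blast
  define F where "F = {n. 0 < a n \<and> \<rho> \<le> g n \<and> g n \<le> x + 1}"
  have "finite F" unfolding F_def by (rule locally_finite[OF \<rho>(1)])
  \<comment> \<open>If x - g n is a sum of k atoms, the induction hypothesis gives a kink there. If
    not, it lies outside \<open>sums_below (Suc k)\<close>, so \<open>D k\<close> is differentiable
    there and both slopes agree.\<close>
  have "\<exists>l u. l \<le> u \<and> (x - g n \<in> exact_sums k \<longrightarrow> l < u) \<and>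
      (D k has_real_derivative l) (at (x - g n) within {..x - g n}) \<and>
      (D k has_real_derivative u) (at (x - g n) within {x - g n..})" if "0 < a n" for n
  proof (cases "x - g n \<in> exact_sums k")
    case True
    from Suc.IH[OF this notin[OF that]] show ?thesis unfolding kink_def by (auto intro: less_imp_le)
  next
    case False
    hence "smooth_near (Suc k) (x - g n)"
      using notin[OF that] by (intro smooth_near_outside_sums) (auto simp: sums_below_Suc)
    then obtain \<rho>' C where "0 < \<rho>'" "smooth_on (Suc k) (x - g n) \<rho>' C"
      unfolding smooth_near_def by blast
    moreover from this have "x - g n \<in> ball (x - g n) \<rho>'" by simp
    ultimately have "(D k has_real_derivative D (Suc k) (x - g n)) (at (x - g n))"
      unfolding smooth_on_def by blast
    hence "(D k has_real_derivative D (Suc k) (x - g n)) (at (x - g n) within S)" for S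
      by (rule has_field_derivative_at_within)
    thus ?thesis using False by blast
  qed
  then obtain l u where lu: "\<And>n. 0 < a n \<Longrightarrow> l n \<le> u n \<and> (x - g n \<in> exact_sums k \<longrightarrow> l n < u n) \<and>
      (D k has_real_derivative l n) (at (x - g n) within {..x - g n}) \<and>
      (D k has_real_derivative u n) (at (x - g n) within {x - g n..})" by metis
  \<comment> \<open>A size g n0 below \<rho> would put s, where \<open>D k\<close> has a kink, into
    the ball on which \<open>D k\<close> is differentiable.\<close>
  have "n0 \<in> F"
  proof -
    have "\<rho> \<le> g n0"
    proof (rule ccontr)
      assume "\<not> \<rho> \<le> g n0"
      hence "s \<in> ball x (2 * \<rho>)" using n0 g_pos[of n0] \<rho> by (auto simp: dist_real_def)
      from der[OF this] have "(D k has_real_derivative D (Suc k) s) (at s)" .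
      moreover have "kink k s" using Suc.IH[OF n0(2)] notin[OF n0(1)] n0(3) by simp
      ultimately show False using kink_not_differentiable by blast
    qed
    thus ?thesis using n0 \<open>0 \<le> s\<close> by (auto simp: F_def)
  qed
  \<comment> \<open>Atoms outside F lead to points near x or on the negative half-line. Their series
    is differentiable at x in the ordinary sense and adds the same d to both one-sided
    slopes.\<close>
  define a' where "a' n = (if n \<in> F then 0 else a n)" for n
  have a': "0 \<le> a' n" "a' n \<le> a n" for n using a_nonneg by (auto simp: a'_def)
  have a'_cases: "g n < \<rho> \<or> x + 1 < g n" if "0 < a' n" for n
    using that by (auto simp: a'_def F_def split: if_splits)
  have summ': "summable (\<lambda>n. a' n * min 1 (g n))"
    by (rule summable_comparison_test'[OF summable_min])
       (use a' g_pos in \<open>auto simp: abs_mult less_imp_le intro!: mult_right_mono\<close>)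
  define B where "B = \<bar>D k x\<bar> + \<bar>D (Suc k) x\<bar> + C'"
  have far: "y - g n < 0" if "x + 1 < g n" "y \<in> ball x \<rho>" for n y
  proof -
    have "\<bar>x - y\<bar> < 1" using that \<rho> by (auto simp: dist_real_def)
    thus ?thesis using that(1) by linarith
  qed
  have near: "y - g n \<in> ball x (2 * \<rho>)" "y \<in> ball x (2 * \<rho>)" if "g n < \<rho>" "y \<in> ball x \<rho>" for n y
  proof -
    have "\<bar>x - y\<bar> < \<rho>" using that by (auto simp: dist_real_def)
    hence "\<bar>x - (y - g n)\<bar> < 2 * \<rho>" "\<bar>x - y\<bar> < 2 * \<rho>" using that(1) g_pos[of n] by linarith+
    thus "y - g n \<in> ball x (2 * \<rho>)" "y \<in> ball x (2 * \<rho>)" by (simp_all add: dist_real_def)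
  qed
  have bound: "\<bar>D i (y - g n) - D i y\<bar> \<le> (C' + B) * min 1 (g n)"
    if "0 < a' n" "y \<in> ball x \<rho>" "i = k \<or> i = Suc k" for n y i
    using a'_cases[OF that(1)]
  proof
    assume gn: "g n < \<rho>"
    have "\<bar>D i (y - g n) - D i y\<bar> \<le> C' * \<bar>(y - g n) - y\<bar>"
      using sm near[OF gn that(2)] that(3) unfolding smooth_on_def by (metis le_Suc_eq order_refl)
    also have "\<dots> \<le> (C' + B) * min 1 (g n)"
      using gn \<rho> g_pos[of n] \<open>0 \<le> C'\<close> by (intro mult_mono) (auto simp: B_def)
    finally show ?thesis .
  next
    assume gn: "x + 1 < g n"
    have "y \<in> ball x (2 * \<rho>)" using that \<rho> by auto
    hence "\<bar>D i y - D i x\<bar> \<le> C' * \<bar>y - x\<bar>"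
      using sm that(3) \<rho> unfolding smooth_on_def by (metis centre_in_ball le_Suc_eq order_refl mult_pos_pos zero_less_numeral)
    also have "\<dots> \<le> C' * 1"
      using that \<rho> \<open>0 \<le> C'\<close> by (intro mult_left_mono) (auto simp: dist_real_def)
    finally have "\<bar>D i y\<bar> \<le> C' + \<bar>D i x\<bar>" by linarith
    also have "\<dots> \<le> C' + B" using that(3) \<open>0 \<le> C'\<close> unfolding B_def by (elim disjE) simp_all
    finally show ?thesis
      using D_neg(1)[OF far[OF gn that(2)], of i] gn \<open>0 < x\<close> by simp
  qed
  define S where "S y = (\<Sum>n. a' n * (D k (y - g n) - D k y))" for y
  define d where "d = (\<Sum>n. a' n * (D (Suc k) (x - g n) - D (Suc k) x))"
  have d: "(S has_real_derivative d) (at x)"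
    unfolding S_def d_def
  proof (rule difference_series_has_derivative)
    show "summable (\<lambda>n. a' n * min 1 (g n))" by (rule summ')
    show "0 < \<rho>" by (rule \<rho>)
    fix n assume n: "0 < a' n"
    show "\<bar>D k (x - g n) - D k x\<bar> \<le> (C' + B) * min 1 (g n)"
      using bound[OF n] \<rho>(1) by simp
    show "0 \<le> g n" using g_pos[of n] by simp
    fix y assume y: "y \<in> ball x \<rho>"
    show "\<bar>D (Suc k) (y - g n) - D (Suc k) y\<bar> \<le> (C' + B) * min 1 (g n)"
      using bound[OF n y] by blast
    show "(D k has_real_derivative D (Suc k) (y - g n)) (at (y - g n))"
      using a'_cases[OF n]
    proof
      assume "g n < \<rho>"
      thus ?thesis using der near[OF _ y] by blast
    next
      assume "x + 1 < g n"
      thus ?thesis using D_neg[OF far[OF _ y]] by metis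
    qed
  next
    fix y assume "y \<in> ball x \<rho>"
    thus "(D k has_real_derivative D (Suc k) y) (at y)" using \<rho> by (intro der) auto
  qed (use a' in auto)
  have split: "(\<Sum>n. a n * (D k (y - g n) - D k y)) = (\<Sum>n\<in>F. a n * (D k (y - g n) - D k y)) + S y"
    if "y \<in> ball x \<rho>" for y
  proof -
    have "summable (\<lambda>n. a' n * (D k (y - g n) - D k y))"
    proof (rule summable_comparison_test'[OF summable_mult[OF summ', of "C' + B"]])
      fix n
      show "norm (a' n * (D k (y - g n) - D k y)) \<le> (C' + B) * (a' n * min 1 (g n))"
        using bound[OF _ that, of n k] a'(1)[of n]
        by (cases "a' n = 0") (auto simp: abs_mult mult.left_commute[of "C' + B"] intro!: mult_left_mono)
    qed
    hence "(\<lambda>n. a' n * (D k (y - g n) - D k y)) sums S y"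
      unfolding S_def by (rule summable_sums)
    from sums_add[OF sums_If_finite_set[OF \<open>finite F\<close>, of "\<lambda>n. a n * (D k (y - g n) - D k y)"] this]
    have "(\<lambda>n. a n * (D k (y - g n) - D k y)) sums ((\<Sum>n\<in>F. a n * (D k (y - g n) - D k y)) + S y)"
      by (rule back_subst[of "\<lambda>f. f sums _"]) (auto simp: a'_def)
    thus ?thesis by (simp add: sums_iff)
  qed
  define c where "c = (if k = 0 then 1 else 0 :: real)"
  \<comment> \<open>The slope of \<open>D (Suc k)\<close> at x as a function of the slopes p n of
    \<open>D k\<close> at x - g n; inserting all left or all right slopes gives the two
    sides.\<close>
  define E where "E p = (- q * D (Suc k) x + ((\<Sum>n\<in>F. a n * (p n - D (Suc k) x)) + d)) / \<delta>" for p
  have one_sided: "(D (Suc k) has_real_derivative E p) (at x within A)"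
    if p: "\<And>n. n \<in> F \<Longrightarrow> (D k has_real_derivative p n) (at (x - g n) within (\<lambda>y. y - g n) ` A)"
      and "x \<in> A" for p A
  proof -
    have dk: "(D k has_real_derivative D (Suc k) x) (at x within A)"
      by (rule has_field_derivative_at_within[OF der]) (use \<rho> in auto)
    have "((\<lambda>y. (c - q * D k y + ((\<Sum>n\<in>F. a n * (D k (y - g n) - D k y)) + S y)) / \<delta>)
        has_real_derivative (0 - q * D (Suc k) x + ((\<Sum>n\<in>F. a n * (p n - D (Suc k) x)) + d)) / \<delta>) (at x within A)"
      by (intro DERIV_cdivide DERIV_add DERIV_diff DERIV_const DERIV_cmult DERIV_sum
            has_real_derivative_shift_within p dk has_field_derivative_at_within[OF d])
    hence "(D (Suc k) has_real_derivative
        (0 - q * D (Suc k) x + ((\<Sum>n\<in>F. a n * (p n - D (Suc k) x)) + d)) / \<delta>) (at x within A)"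
    proof (rule has_field_derivative_transform_within[OF _ \<rho>(1) \<open>x \<in> A\<close>])
      fix y assume "y \<in> A" "dist y x < \<rho>"
      hence "y \<in> ball x \<rho>" by (simp add: dist_commute)
      moreover from this have "y \<in> ball x r" using \<rho> by auto
      ultimately show "(c - q * D k y + ((\<Sum>n\<in>F. a n * (D k (y - g n) - D k y)) + S y)) / \<delta> = D (Suc k) y"
        unfolding deq[OF \<open>y \<in> ball x r\<close>] c_def by (simp add: split)
    qed
    thus ?thesis by (simp add: E_def del: funpow.simps)
  qed
  have "(D (Suc k) has_real_derivative E l) (at x within {..x})"
    by (rule one_sided) (use lu in \<open>auto simp: image_diff_halflines F_def\<close>)
  moreover have "(D (Suc k) has_real_derivative E u) (at x within {x..})"
    by (rule one_sided) (use lu in \<open>auto simp: image_diff_halflines F_def\<close>)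
  moreover have "E l < E u"
  proof -
    have "(\<Sum>n\<in>F. a n * (l n - D (Suc k) x)) < (\<Sum>n\<in>F. a n * (u n - D (Suc k) x))"
    proof (rule sum_strict_mono_ex1[OF \<open>finite F\<close>])
      show "\<forall>n\<in>F. a n * (l n - D (Suc k) x) \<le> a n * (u n - D (Suc k) x)"
        using lu by (auto simp: F_def intro!: mult_left_mono)
      show "\<exists>n\<in>F. a n * (l n - D (Suc k) x) < a n * (u n - D (Suc k) x)"
        using lu[OF n0(1)] n0 \<open>n0 \<in> F\<close> by (intro bexI[of _ n0]) auto
    qed
    thus ?thesis unfolding E_def using delta_pos by (simp add: divide_strict_right_mono)
  qed
  ultimately show ?case unfolding kink_def by blast
qed

section \<open>The exact order of differentiability\<close>

lemma times_differentiable_at_smooth_on: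
  assumes "smooth_on k x r C" "n \<le> k" "y \<in> ball x r"
  shows "times_differentiable_at n U y"
  using assms(2,3)
proof (induction n arbitrary: y)
  case (Suc n)
  have "(D n has_real_derivative D (Suc n) y) (at y)"
    using assms(1) Suc.prems unfolding smooth_on_def by (meson Suc_le_lessD)
  moreover have "\<forall>\<^sub>F y in nhds y. times_differentiable_at n U y"
    unfolding eventually_nhds using Suc by (intro exI[of _ "ball x r"]) auto
  ultimately show ?case by (auto simp: real_differentiable_def simp del: funpow.simps)
qed auto

lemma times_differentiable_at_mono:
  assumes "times_differentiable_at n f x" "m \<le> n"
  shows "times_differentiable_at m f x"
  using assms(2,1)
proof (induction n rule: dec_induct)
  case (step n)
  thus ?case using eventually_nhds_x_imp_x[of "times_differentiable_at n f" x] by simp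
qed

text \<open>For a sum x, the least j with x in \<open>exact_sums j\<close> decides: minimality is
  what \<open>kink_at_exact_sums\<close> asks for, and the kink of \<open>D j\<close> rules out
  differentiability of order j + 1 \<le> k.\<close>

theorem times_differentiable_iff:
  assumes "x \<noteq> 0"
  shows "times_differentiable_at k U x \<longleftrightarrow> x \<notin> sums_below k"
proof
  assume "x \<notin> sums_below k"
  from smooth_near_outside_sums[OF this] show "times_differentiable_at k U x"
    unfolding smooth_near_def using times_differentiable_at_smooth_on centre_in_ball by blast
next
  assume diff: "times_differentiable_at k U x"
  show "x \<notin> sums_below k"
  proof
    assume "x \<in> sums_below k"
    hence ex: "\<exists>j. j < k \<and> x \<in> exact_sums j" by (auto simp: sums_below_def)
    define j where "j = (LEAST j. j < k \<and> x \<in> exact_sums j)"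
    from LeastI_ex[OF ex] have j: "j < k" "x \<in> exact_sums j" by (auto simp: j_def)
    have "x \<notin> sums_below j"
      using not_less_Least[where P = "\<lambda>j. j < k \<and> x \<in> exact_sums j"] j
      by (force simp: sums_below_def j_def[symmetric])
    from kink_at_exact_sums[OF j(2) this] have "\<not> D j differentiable (at x)"
      using kink_not_differentiable by (auto simp: real_differentiable_def)
    moreover have "times_differentiable_at (Suc j) U x"
      by (rule times_differentiable_at_mono[OF diff]) (use j(1) in simp)
    ultimately show False by simp
  qed
qed

lemma exact_sums_eq:
  "exact_sums k = {x. \<exists>h. (\<forall>i\<in>{1..k}. h i \<in> {g n |n. 0 < a n}) \<and> x = (\<Sum>i=1..k. h i)}"
proof (induction k)
  case (Suc k)
  define G where "G = {g n |n. 0 < a n}"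
  have step: "exact_sums (Suc k) = {y + s |y s. y \<in> G \<and> s \<in> exact_sums k}"
    unfolding exact_sums.simps G_def by blast
  have "x \<in> exact_sums (Suc k) \<longleftrightarrow> (\<exists>h. (\<forall>i\<in>{1..Suc k}. h i \<in> G) \<and> x = (\<Sum>i=1..Suc k. h i))" for x
  proof
    assume "x \<in> exact_sums (Suc k)"
    then obtain y h where h: "y \<in> G" "\<forall>i\<in>{1..k}. h i \<in> G" "x = y + (\<Sum>i=1..k. h i)"
      unfolding step Suc.IH G_def[symmetric] by blast
    have "(\<Sum>i=1..k. (h(Suc k := y)) i) = (\<Sum>i=1..k. h i)" by (intro sum.cong) auto
    hence "x = (\<Sum>i=1..Suc k. (h(Suc k := y)) i)" using h(3) by simp
    moreover have "\<forall>i\<in>{1..Suc k}. (h(Suc k := y)) i \<in> G"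
      using h(1,2) by (auto simp: le_Suc_eq)
    ultimately show "\<exists>h. (\<forall>i\<in>{1..Suc k}. h i \<in> G) \<and> x = (\<Sum>i=1..Suc k. h i)"
      by blast
  next
    assume "\<exists>h. (\<forall>i\<in>{1..Suc k}. h i \<in> G) \<and> x = (\<Sum>i=1..Suc k. h i)"
    then obtain h where h: "\<forall>i\<in>{1..Suc k}. h i \<in> G" "x = (\<Sum>i=1..Suc k. h i)"
      by blast
    have "(\<Sum>i=1..k. h i) \<in> exact_sums k"
      unfolding Suc.IH G_def[symmetric] mem_Collect_eq using h(1) by (intro exI[of _ h]) auto
    moreover have "h (Suc k) \<in> G" "x = h (Suc k) + (\<Sum>i=1..k. h i)" using h by auto
    ultimately show "x \<in> exact_sums (Suc k)" unfolding step by blast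
  qed
  thus ?case unfolding G_def by blast
qed auto

text \<open>The left side allows 1 to k summands and the right side 0 to k; the empty sum
  contributes only 0. The positivity demanded by \<open>sums_upto\<close> comes from the positivity
  of the atoms.\<close>

lemma sums_upto_iff:
  assumes "x \<noteq> 0"
  shows "x \<in> sums_upto {g n |n. 0 < a n} k \<longleftrightarrow> x \<in> sums_below (Suc k)"
proof -
  have "x \<in> sums_below (Suc k) \<longleftrightarrow> (\<exists>j. j \<le> k \<and> x \<in> exact_sums j)"
    by (auto simp: sums_below_def less_Suc_eq_le)
  also have "\<dots> \<longleftrightarrow> (\<exists>j. 1 \<le> j \<and> j \<le> k \<and> x \<in> exact_sums j)"
    using assms by (metis One_nat_def Suc_leI exact_sums.simps(1) neq0_conv singletonD)
  also have "\<dots> \<longleftrightarrow> 0 < x \<and> (\<exists>j. 1 \<le> j \<and> j \<le> k \<and> x \<in> exact_sums j)"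
    using exact_sums_nonneg[of x] assms by (auto simp: order.strict_iff_order simp del: exact_sums.simps)
  also have "\<dots> \<longleftrightarrow> x \<in> sums_upto {g n |n. 0 < a n} k"
    unfolding sums_upto_def exact_sums_eq mem_Collect_eq ex_simps
    by (simp only: conj_assoc)
  finally show ?thesis ..
qed

end

section \<open>Finitely many jump sizes\<close>

text \<open>Meaningful for every real r: \<open>0 ^ 0 = 1\<close> turns rate 0 into the point mass
  at 0, which covers time 0 and indices of mass 0, and negative rates permit two-sided derivatives
  at time 0.\<close>

definition poisson_weight :: "real \<Rightarrow> nat \<Rightarrow> real" where
  "poisson_weight r k = r ^ k / fact k * exp (- r)"

lemma poisson_weight_nonneg: "0 \<le> r \<Longrightarrow> 0 \<le> poisson_weight r k"
  by (simp add: poisson_weight_def)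

lemma poisson_weight_0: "poisson_weight 0 k = (if k = 0 then 1 else 0)"
  by (simp add: poisson_weight_def)

lemma poisson_weight_sums: "poisson_weight r sums 1"
proof -
  have "(\<lambda>k. r ^ k / fact k * exp (- r)) sums (exp r * exp (- r))"
    using exp_converges[of r] by (intro sums_mult2) (simp add: scaleR_conv_of_real field_simps)
  thus ?thesis by (simp add: poisson_weight_def[abs_def] flip: exp_add)
qed

lemma sum_poisson_weight_le_1:
  assumes "0 \<le> r"
  shows "(\<Sum>k<K. poisson_weight r k) \<le> 1"
  using sum_le_suminf[OF sums_summable[OF poisson_weight_sums], of "{..<K}" r]
    poisson_weight_nonneg[OF assms] sums_unique[OF poisson_weight_sums[of r]] by simp

lemma poisson_weight_measurable[measurable]:
  "(\<lambda>r. poisson_weight r k) \<in> borel_measurable borel"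
  unfolding poisson_weight_def by measurable

text \<open>Kolmogorov's forward equation of the Poisson process with rate a. The conditional is the
  weight 0 at -1, since \<open>k - 1\<close> is 0 for k = 0.\<close>

lemma DERIV_poisson_weight:
  "((\<lambda>t. poisson_weight (a * t) k) has_real_derivative
      a * ((if k = 0 then 0 else poisson_weight (a * t) (k - 1)) - poisson_weight (a * t) k)) (at t)"
proof (cases k)
  case 0
  show ?thesis unfolding 0 poisson_weight_def by (auto intro!: derivative_eq_intros)
next
  case (Suc m)
  show ?thesis unfolding Suc poisson_weight_def
    by (rule derivative_eq_intros refl | simp add: field_simps del: fact_Suc)+
       (simp add: field_simps)
qed

text \<open>\<open>jump_cdf n t z\<close> is the probability that \<open>\<Sum>i<n. g i * N i \<le> z\<close> for independent Poisson
  variables \<open>N i\<close> with means \<open>a i * t\<close>.\<close>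

locale jump_sizes =
  fixes g a :: "nat \<Rightarrow> real" and \<delta> q :: real
  assumes g_pos: "0 < g n" and a_nonneg: "0 \<le> a n" and delta_pos: "0 < \<delta>" and q_nonneg: "0 \<le> q"
begin

primrec jump_cdf :: "nat \<Rightarrow> real \<Rightarrow> real \<Rightarrow> real" where
  "jump_cdf 0 t z = (if 0 \<le> z then 1 else 0)"
| "jump_cdf (Suc n) t z = (\<Sum>k. poisson_weight (a n * t) k * jump_cdf n t (z - real k * g n))"

lemma jump_cdf_neg: "z < 0 \<Longrightarrow> jump_cdf n t z = 0"
proof (induction n arbitrary: z)
  case (Suc n)
  have "z - real k * g n < 0" for k
    using Suc.prems mult_nonneg_nonneg[of "real k" "g n"] g_pos[of n] by linarith
  thus ?case using Suc.IH by simp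
qed simp

text \<open>Only finitely many multiples of g n fit below z. Every series is thus a finite sum, with
  a K that may be enlarged at will, and can be differentiated and rearranged freely.\<close>

lemma jump_cdf_Suc:
  assumes "z < real K * g n"
  shows "jump_cdf (Suc n) t z = (\<Sum>k<K. poisson_weight (a n * t) k * jump_cdf n t (z - real k * g n))"
  unfolding jump_cdf.simps
proof (rule suminf_finite)
  fix k assume "k \<notin> {..<K}"
  hence "real K * g n \<le> real k * g n" using g_pos[of n] by (intro mult_right_mono) auto
  hence "z - real k * g n < 0" using assms by linarith
  thus "poisson_weight (a n * t) k * jump_cdf n t (z - real k * g n) = 0"
    using jump_cdf_neg by simp
qed simp

lemma ex_bound: "\<exists>K. z < real K * g n"
proof -
  obtain K where "z / g n < real K" using reals_Archimedean2 by blast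
  thus ?thesis using g_pos[of n] by (auto simp: field_simps)
qed

lemma jump_cdf_bounds:
  assumes "0 \<le> t"
  shows "0 \<le> jump_cdf n t z \<and> jump_cdf n t z \<le> 1"
proof (induction n arbitrary: z)
  case (Suc n)
  obtain K where K: "z < real K * g n" using ex_bound by blast
  have w: "0 \<le> poisson_weight (a n * t) k" for k
    using a_nonneg assms by (intro poisson_weight_nonneg) auto
  have "(\<Sum>k<K. poisson_weight (a n * t) k * jump_cdf n t (z - real k * g n)) \<le>
      (\<Sum>k<K. poisson_weight (a n * t) k * 1)"
    using w Suc by (intro sum_mono mult_left_mono) auto
  also have "\<dots> \<le> 1" using sum_poisson_weight_le_1[of "a n * t" K] a_nonneg assms by simp
  finally show ?case unfolding jump_cdf_Suc[OF K] using w Suc by (auto intro!: sum_nonneg)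
qed simp

lemma jump_cdf_mono:
  assumes "0 \<le> t" "z \<le> z'"
  shows "jump_cdf n t z \<le> jump_cdf n t z'"
  using assms(2)
proof (induction n arbitrary: z z')
  case (Suc n)
  obtain K where K: "z' < real K * g n" using ex_bound by blast
  hence K': "z < real K * g n" using Suc.prems by linarith
  have "0 \<le> poisson_weight (a n * t) k" for k
    using a_nonneg assms by (intro poisson_weight_nonneg) auto
  thus ?case unfolding jump_cdf_Suc[OF K] jump_cdf_Suc[OF K']
    using Suc.prems by (intro sum_mono mult_left_mono Suc.IH) auto
qed simp

lemma jump_cdf_at_0: "jump_cdf n 0 z = (if 0 \<le> z then 1 else 0)"
proof (induction n arbitrary: z)
  case (Suc n)
  have "jump_cdf (Suc n) 0 z = (\<Sum>k\<in>{0}. poisson_weight (a n * 0) k * jump_cdf n 0 (z - real k * g n))"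
    unfolding jump_cdf.simps by (rule suminf_finite) (auto simp: poisson_weight_0)
  thus ?case using Suc by (simp add: poisson_weight_0)
qed simp

lemma jump_cdf_measurable:
  "(\<lambda>(t, z). jump_cdf n t z) \<in> borel_measurable (borel \<Otimes>\<^sub>M borel)"
proof (induction n)
  case (Suc n)
  have "(\<lambda>(t, z). jump_cdf n t (z - real k * g n)) \<in> borel_measurable (borel \<Otimes>\<^sub>M borel)" for k
    using measurable_compose[OF _ Suc, of "\<lambda>(t, z). (t, z - real k * g n)" "borel \<Otimes>\<^sub>M borel"]
    by (simp add: case_prod_beta')
  thus ?case by (simp add: case_prod_beta')
qed (simp add: case_prod_beta')

lemma jump_cdf_measurable'[measurable (raw)]:
  assumes [measurable]: "f \<in> borel_measurable N" "h \<in> borel_measurable N"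
  shows "(\<lambda>x. jump_cdf n (f x) (h x)) \<in> borel_measurable N"
  using measurable_compose[OF _ jump_cdf_measurable, of "\<lambda>x. (f x, h x)" N n] by simp

text \<open>In the product rule, the derivative of the n-th Poisson weight lowers its index by one,
  which amounts to replacing z by z - g n; the other factor is differentiated by the induction
  hypothesis.\<close>

lemma DERIV_jump_cdf:
  "((\<lambda>t. jump_cdf n t z) has_real_derivative
     (\<Sum>i<n. a i * (jump_cdf n t (z - g i) - jump_cdf n t z))) (at t)"
proof (induction n arbitrary: z)
  case (Suc n)
  obtain K where K: "z < real K * g n" using ex_bound by blast
  define p where "p k = poisson_weight (a n * t) k" for k
  define h where "h z = jump_cdf n t z" for z
  \<comment> \<open>The index shift below consumes one of the Suc K summands and leaves the K that
    suffice for z - g n.\<close>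
  have KS: "z < real (Suc K) * g n" using K g_pos[of n] by (simp add: algebra_simps)
  have Kg: "z - g i < real (Suc K) * g n" for i using KS g_pos[of i] by linarith
  have KS': "z - g n < real K * g n" using K g_pos[of n] by linarith
  have "((\<lambda>t. \<Sum>k<Suc K. poisson_weight (a n * t) k * jump_cdf n t (z - real k * g n)) has_real_derivative
     (\<Sum>k<Suc K. (a n * ((if k = 0 then 0 else p (k - 1)) - p k)) * h (z - real k * g n) +
        (\<Sum>i<n. a i * (h (z - real k * g n - g i) - h (z - real k * g n))) * p k)) (at t)"
    unfolding p_def h_def by (intro DERIV_sum DERIV_mult DERIV_poisson_weight Suc)
  also have "(\<lambda>t. \<Sum>k<Suc K. poisson_weight (a n * t) k * jump_cdf n t (z - real k * g n)) =
     (\<lambda>t. jump_cdf (Suc n) t z)"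
    using jump_cdf_Suc[OF KS] by auto
  also have "(\<Sum>k<Suc K. (a n * ((if k = 0 then 0 else p (k - 1)) - p k)) * h (z - real k * g n) +
        (\<Sum>i<n. a i * (h (z - real k * g n - g i) - h (z - real k * g n))) * p k) =
     a n * (\<Sum>k<Suc K. (if k = 0 then 0 else p (k - 1)) * h (z - real k * g n)) -
     a n * (\<Sum>k<Suc K. p k * h (z - real k * g n)) +
     (\<Sum>k<Suc K. \<Sum>i<n. a i * (p k * h (z - g i - real k * g n) - p k * h (z - real k * g n)))"
    unfolding sum_distrib_left sum_distrib_right sum.distrib[symmetric] sum_subtractf[symmetric]
    by (intro sum.cong refl arg_cong2[where f = "(+)"])
       (simp_all add: algebra_simps)
  also have "(\<Sum>k<Suc K. (if k = 0 then 0 else p (k - 1)) * h (z - real k * g n)) =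
      (\<Sum>k<K. p k * h (z - g n - real k * g n))"
    by (subst sum.lessThan_Suc_shift) (simp add: algebra_simps)
  also have "\<dots> = jump_cdf (Suc n) t (z - g n)"
    unfolding jump_cdf_Suc[OF KS'] by (simp add: p_def h_def)
  also have "(\<Sum>k<Suc K. p k * h (z - real k * g n)) = jump_cdf (Suc n) t z"
    unfolding jump_cdf_Suc[OF KS] by (simp add: p_def h_def)
  also have "(\<Sum>k<Suc K. \<Sum>i<n. a i * (p k * h (z - g i - real k * g n) - p k * h (z - real k * g n)))
     = (\<Sum>i<n. a i * (jump_cdf (Suc n) t (z - g i) - jump_cdf (Suc n) t z))"
    unfolding jump_cdf_Suc[OF KS] jump_cdf_Suc[OF Kg] sum.swap[of _ "{..<n}"] p_def h_def
    by (simp only: sum_distrib_left sum_subtractf right_diff_distrib)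
  finally show ?case by (simp add: algebra_simps del: jump_cdf.simps)
qed simp

lemma jump_cdf_antimono:
  assumes "0 \<le> s" "s \<le> t"
  shows "jump_cdf n t z \<le> jump_cdf n s z"
proof (rule DERIV_nonpos_imp_nonincreasing[OF assms(2)])
  fix u assume "s \<le> u" "u \<le> t"
  hence "(\<Sum>i<n. a i * (jump_cdf n u (z - g i) - jump_cdf n u z)) \<le> 0"
    using assms a_nonneg g_pos
    by (intro sum_nonpos mult_nonneg_nonpos) (auto simp: less_imp_le intro!: jump_cdf_mono)
  with DERIV_jump_cdf show "\<exists>y. ((\<lambda>t. jump_cdf n t z) has_real_derivative y) (at u) \<and> y \<le> 0"
    by blast
qed

section \<open>Potentials of the process with finitely many jump sizes\<close>

definition killed_cdf :: "nat \<Rightarrow> real \<Rightarrow> real \<Rightarrow> real" where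
  "killed_cdf n t z = exp (- q * t) * jump_cdf n t z"

text \<open>With the jump sizes g 0, ..., g (n - 1) only, the process is at most x at time t iff its
  jumps sum to at most x - \<delta> t. By Fubini this is the distribution function of its
  q-potential measure.\<close>

definition approx_potential :: "nat \<Rightarrow> real \<Rightarrow> real" where
  "approx_potential n x = (LINT t|lborel. indicator {0..} t * killed_cdf n t (x - \<delta> * t))"

lemma killed_cdf_neg: "z < 0 \<Longrightarrow> killed_cdf n t z = 0"
  by (simp add: killed_cdf_def jump_cdf_neg)

lemma killed_cdf_bounds:
  assumes "0 \<le> t"
  shows "0 \<le> killed_cdf n t z" "killed_cdf n t z \<le> 1"
proof -
  have "exp (- q * t) * jump_cdf n t z \<le> 1 * 1"
    using assms q_nonneg jump_cdf_bounds[OF assms] by (intro mult_mono) auto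
  thus "killed_cdf n t z \<le> 1" by (simp add: killed_cdf_def)
qed (use jump_cdf_bounds[OF assms] in \<open>simp add: killed_cdf_def\<close>)

lemma killed_cdf_mono:
  "0 \<le> t \<Longrightarrow> z \<le> z' \<Longrightarrow> killed_cdf n t z \<le> killed_cdf n t z'"
  unfolding killed_cdf_def by (intro mult_left_mono jump_cdf_mono) auto

lemma killed_cdf_antimono:
  assumes "0 \<le> s" "s \<le> t"
  shows "killed_cdf n t z \<le> killed_cdf n s z"
  unfolding killed_cdf_def
  using assms q_nonneg jump_cdf_bounds[of t n z]
  by (intro mult_mono jump_cdf_antimono) (auto simp: mult_left_mono)

lemma killed_cdf_at_0: "0 \<le> z \<Longrightarrow> killed_cdf n 0 z = 1"
  by (simp add: killed_cdf_def jump_cdf_at_0)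

lemma killed_cdf_measurable[measurable (raw)]:
  assumes [measurable]: "f \<in> borel_measurable N" "h \<in> borel_measurable N"
  shows "(\<lambda>x. killed_cdf n (f x) (h x)) \<in> borel_measurable N"
  unfolding killed_cdf_def by measurable

lemma DERIV_killed_cdf:
  "((\<lambda>t. killed_cdf n t z) has_real_derivative
     (\<Sum>i<n. a i * (killed_cdf n t (z - g i) - killed_cdf n t z)) - q * killed_cdf n t z) (at t)"
proof -
  have "((\<lambda>t. exp (- q * t) * jump_cdf n t z) has_real_derivative
      exp (- q * t) * (- q) * jump_cdf n t z +
      (\<Sum>i<n. a i * (jump_cdf n t (z - g i) - jump_cdf n t z)) * exp (- q * t)) (at t)"
    by (intro DERIV_mult DERIV_jump_cdf) (auto intro!: derivative_eq_intros)
  also have "exp (- q * t) * (- q) * jump_cdf n t z +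
      (\<Sum>i<n. a i * (jump_cdf n t (z - g i) - jump_cdf n t z)) * exp (- q * t) =
      (\<Sum>i<n. a i * (killed_cdf n t (z - g i) - killed_cdf n t z)) - q * killed_cdf n t z"
    unfolding killed_cdf_def sum_distrib_right by (simp add: algebra_simps)
  finally show ?thesis unfolding killed_cdf_def .
qed

end

section \<open>Integration along the drift lines\<close>

lemma integrable_bounded_box:
  fixes f :: "real \<times> real \<Rightarrow> real"
  assumes [measurable]: "f \<in> borel_measurable (borel \<Otimes>\<^sub>M borel)"
    and "\<And>x. \<bar>f x\<bar> \<le> C" and "\<And>s y. f (s, y) \<noteq> 0 \<Longrightarrow> s \<in> {a..b} \<and> y \<in> {c..d}"
  shows "integrable (lborel \<Otimes>\<^sub>M lborel) f"
proof (rule integrableI_bounded_set[where A = "{a..b} \<times> {c..d}" and B = C])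
  have "emeasure (lborel \<Otimes>\<^sub>M lborel) ({a..b} \<times> {c..d}) = emeasure lborel {a..b} * emeasure lborel {c..d}"
    by (rule lborel.emeasure_pair_measure_Times) auto
  thus "emeasure (lborel \<Otimes>\<^sub>M lborel) ({a..b} \<times> {c..d}) < \<infinity>"
    by (simp add: emeasure_lborel_Icc_eq ennreal_mult_less_top)
  show "f \<in> borel_measurable (lborel \<Otimes>\<^sub>M lborel)" by measurable
qed (use assms in auto)

text \<open>Fubini, the translation y = z + \<delta> s - c for fixed time s, and Fubini again. In
  the coordinate z the drift is frozen, so the inner integral runs over time alone. Boundedness and
  bounded support give integrability.\<close>

lemma integral_shear:
  fixes f :: "real \<Rightarrow> real \<Rightarrow> real"
  assumes meas: "case_prod f \<in> borel_measurable (borel \<Otimes>\<^sub>M borel)"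
    and bound: "\<And>s y. \<bar>f s y\<bar> \<le> C"
    and supp: "\<And>s y. f s y \<noteq> 0 \<Longrightarrow> 0 \<le> s \<and> s \<le> A \<and> 0 \<le> y \<and> y \<le> B" and "0 \<le> \<delta>"
  shows "(LINT y|lborel. LINT s|lborel. f s y) = (LINT z|lborel. LINT s|lborel. f s (z + \<delta> * s - c))"
proof -
  have "integrable (lborel \<Otimes>\<^sub>M lborel) (case_prod f)"
    by (rule integrable_bounded_box[OF meas, of C 0 A 0 B]) (use bound supp in auto)
  hence "(LINT y|lborel. LINT s|lborel. f s y) = (LINT s|lborel. LINT y|lborel. f s y)"
    by (rule lborel_pair.Fubini_integral)
  also have "\<dots> = (LINT s|lborel. LINT z|lborel. f s (z + \<delta> * s - c))"
  proof (rule Bochner_Integration.integral_cong[OF refl])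
    fix s
    show "(LINT y|lborel. f s y) = (LINT z|lborel. f s (z + \<delta> * s - c))"
      by (subst lborel_integral_real_affine[of 1 _ "\<delta> * s - c"]) (auto simp: algebra_simps)
  qed
  also have "\<dots> = (LINT z|lborel. LINT s|lborel. f s (z + \<delta> * s - c))"
  proof (rule lborel_pair.Fubini_integral[symmetric])
    have [measurable]: "(\<lambda>x. f (fst x) (snd x)) \<in> borel_measurable (borel \<Otimes>\<^sub>M borel)"
      using meas by (simp add: case_prod_beta')
    have "(\<lambda>x. (fst x, snd x + \<delta> * fst x - c)) \<in> measurable (borel \<Otimes>\<^sub>M borel) (borel \<Otimes>\<^sub>M borel)"
      by measurable
    from measurable_compose[OF this meas]
    have m: "(\<lambda>(s, z). f s (z + \<delta> * s - c)) \<in> borel_measurable (borel \<Otimes>\<^sub>M borel)"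
      by (simp add: case_prod_beta')
    show "integrable (lborel \<Otimes>\<^sub>M lborel) (\<lambda>(s, z). f s (z + \<delta> * s - c))"
    proof (rule integrable_bounded_box[OF m, of C 0 A "c - \<delta> * A" "B + c"])
      fix s z assume "(case (s, z) of (s, z) \<Rightarrow> f s (z + \<delta> * s - c)) \<noteq> 0"
      hence "f s (z + \<delta> * s - c) \<noteq> 0" by simp
      from supp[OF this] have s: "0 \<le> s" "s \<le> A" "0 \<le> z + \<delta> * s - c" "z + \<delta> * s - c \<le> B" by auto
      moreover have "\<delta> * s \<le> \<delta> * A" "0 \<le> \<delta> * s" using s \<open>0 \<le> \<delta>\<close> by (auto intro: mult_left_mono)
      ultimately show "s \<in> {0..A} \<and> z \<in> {c - \<delta> * A..B + c}" by auto
    qed (use bound in \<open>auto split: prod.splits\<close>)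
  qed
  finally show ?thesis .
qed

lemma integrable_indicator_Icc: "integrable lborel (indicator {a..b::real} :: real \<Rightarrow> real)"
  by (simp add: integrable_indicator_iff emeasure_lborel_Icc_eq)

context jump_sizes begin

text \<open>The drift alone exceeds x after time x / \<delta>. The bound depends neither on n nor on
  q and is the dominating function for the limit.\<close>

lemma killed_drift_bounds:
  "0 \<le> indicator {0..} t * killed_cdf n t (x - \<delta> * t)"
  "indicator {0..} t * killed_cdf n t (x - \<delta> * t) \<le> indicator {0..x / \<delta>} t"
proof -
  show "0 \<le> indicator {0..} t * killed_cdf n t (x - \<delta> * t)"
    using killed_cdf_bounds(1)[of t n "x - \<delta> * t"] by (simp add: indicator_def)
  show "indicator {0..} t * killed_cdf n t (x - \<delta> * t) \<le> indicator {0..x / \<delta>} t"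
  proof (cases "0 \<le> t \<and> t \<le> x / \<delta>")
    case True
    thus ?thesis using killed_cdf_bounds(2)[of t n "x - \<delta> * t"] by simp
  next
    case False
    hence "t < 0 \<or> x - \<delta> * t < 0" using delta_pos by (auto simp: field_simps)
    thus ?thesis by (auto simp: killed_cdf_neg)
  qed
qed

lemma integrable_killed_drift:
  "integrable lborel (\<lambda>t. indicator {0..} t * killed_cdf n t (x - \<delta> * t))"
proof (rule Bochner_Integration.integrable_bound[OF integrable_indicator_Icc])
  show "AE t in lborel. norm (indicator {0..} t * killed_cdf n t (x - \<delta> * t)) \<le>
      norm (indicator {0..x / \<delta>} t :: real)"
    using killed_drift_bounds by (intro AE_I2) (auto simp: abs_mult[symmetric])
qed measurable

lemma approx_potential_nonneg: "0 \<le> approx_potential n x"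
  unfolding approx_potential_def
  by (intro integral_nonneg_AE AE_I2) (auto simp: indicator_def killed_cdf_bounds)

lemma approx_potential_le: "approx_potential n x \<le> max 0 x / \<delta>"
proof -
  have "approx_potential n x \<le> (LINT t|lborel. indicator {0..x / \<delta>} t)"
    unfolding approx_potential_def
    by (intro integral_mono integrable_killed_drift integrable_indicator_Icc killed_drift_bounds)
  also have "\<dots> = max 0 x / \<delta>" using delta_pos by (simp add: max_def field_simps)
  finally show ?thesis .
qed

lemma approx_potential_nonpos: "x \<le> 0 \<Longrightarrow> approx_potential n x = 0"
  using approx_potential_nonneg[of n x] approx_potential_le[of n x] by (simp add: max_absorb1)

lemma approx_potential_mono:
  assumes "x \<le> y"
  shows "approx_potential n x \<le> approx_potential n y"
  unfolding approx_potential_def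
  by (intro integral_mono integrable_killed_drift)
     (use assms in \<open>auto simp: indicator_def intro!: killed_cdf_mono\<close>)

lemma approx_potential_measurable[measurable]: "approx_potential n \<in> borel_measurable borel"
  by (rule borel_measurable_mono) (simp add: approx_potential_mono mono_def)

text \<open>The substitution z = x - \<delta> t moves x from the space argument to the time
  argument, in which \<open>killed_cdf\<close> is differentiable and non-increasing.\<close>

lemma approx_potential_alt:
  "\<delta> * approx_potential n x = (LINT z|lborel. indicator {0..x} z * killed_cdf n ((x - z) / \<delta>) z)"
proof -
  have "(LINT z|lborel. indicator {0..x} z * killed_cdf n ((x - z) / \<delta>) z) =
      \<delta> * (LINT t|lborel. indicator {0..x} (x - \<delta> * t) * killed_cdf n t (x - \<delta> * t))"
    using delta_pos by (subst lborel_integral_real_affine[of "- \<delta>" _ x]) auto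
  also have "(LINT t|lborel. indicator {0..x} (x - \<delta> * t) * killed_cdf n t (x - \<delta> * t)) =
      approx_potential n x"
    unfolding approx_potential_def
  proof (rule Bochner_Integration.integral_cong[OF refl])
    fix t
    show "indicator {0..x} (x - \<delta> * t) * killed_cdf n t (x - \<delta> * t) =
        indicator {0..} t * killed_cdf n t (x - \<delta> * t)"
    proof (cases "x - \<delta> * t < 0")
      case False
      thus ?thesis using delta_pos by (auto simp: indicator_def zero_le_mult_iff)
    qed (simp add: killed_cdf_neg)
  qed
  finally show ?thesis by simp
qed

lemma integrable_killed_alt:
  "integrable lborel (\<lambda>z. indicator {0..x} z * killed_cdf n ((x - z) / \<delta>) z)"
proof (rule Bochner_Integration.integrable_bound[OF integrable_indicator_Icc])
  show "AE z in lborel. norm (indicator {0..x} z * killed_cdf n ((x - z) / \<delta>) z) \<le>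
      norm (indicator {0..x} z :: real)"
    using killed_cdf_bounds[of "(x - z) / \<delta>" n z for z] delta_pos
    by (intro AE_I2) (auto simp: indicator_def)
qed measurable

text \<open>In the form of \<open>approx_potential_alt\<close>, passing from x to y lengthens the
  times and so lowers the old integrand, while the new part is at most 1 on an interval of length y
  - x. The constant does not depend on n.\<close>

lemma approx_potential_lipschitz:
  "\<bar>approx_potential n x - approx_potential n y\<bar> \<le> (1 / \<delta>) * \<bar>x - y\<bar>"
proof -
  have pos: "\<delta> * approx_potential n y \<le> \<delta> * approx_potential n x + (y - x)" if "0 \<le> x" "x \<le> y" for x y
  proof -
    have "\<delta> * approx_potential n y \<le>
        (LINT z|lborel. indicator {0..x} z * killed_cdf n ((x - z) / \<delta>) z + indicator {x..y} z)"
      unfolding approx_potential_alt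
    proof (intro integral_mono Bochner_Integration.integrable_add integrable_killed_alt)
      show "integrable lborel (indicator {x..y} :: real \<Rightarrow> real)"
        by (rule integrable_indicator_Icc)
      fix z
      show "indicator {0..y} z * killed_cdf n ((y - z) / \<delta>) z \<le>
          indicator {0..x} z * killed_cdf n ((x - z) / \<delta>) z + indicator {x..y} z"
      proof (cases "z \<in> {0..x}")
        case True
        have "killed_cdf n ((y - z) / \<delta>) z \<le> killed_cdf n ((x - z) / \<delta>) z"
          using True that delta_pos by (intro killed_cdf_antimono) (auto simp: divide_right_mono)
        thus ?thesis using True that by (auto simp: indicator_def)
      next
        case False
        thus ?thesis using delta_pos killed_cdf_bounds[of "(y - z) / \<delta>" n z]
          by (auto simp: indicator_def)
      qed
    qed
    also have "\<dots> = \<delta> * approx_potential n x + (y - x)"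
      unfolding approx_potential_alt using that
      by (subst Bochner_Integration.integral_add)
         (auto intro!: integrable_killed_alt integrable_indicator_Icc)
    finally show ?thesis .
  qed
  have main: "approx_potential n y - approx_potential n x \<le> (1 / \<delta>) * (y - x)" if "x \<le> y" for x y
  proof (cases "0 \<le> x")
    case True
    thus ?thesis using pos[OF True that] delta_pos by (simp add: field_simps)
  next
    case False
    hence "approx_potential n x = 0" by (simp add: approx_potential_nonpos)
    moreover have "max 0 y / \<delta> \<le> (y - x) / \<delta>"
      using False that delta_pos by (intro divide_right_mono) auto
    ultimately show ?thesis using approx_potential_le[of n y] by simp
  qed
  show ?thesis
    using main[of x y] main[of y x] approx_potential_mono[of x y n] approx_potential_mono[of y x n]
    by (cases "x \<le> y") auto
qed

section \<open>The integrated renewal equation\<close>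

definition approx_primitive :: "nat \<Rightarrow> real \<Rightarrow> real" where
  "approx_primitive n x = (LINT y|lborel. indicator {0..x} y * approx_potential n y)"

text \<open>After the shear c occurs only in the space argument of \<open>killed_cdf\<close>, while
  the time window is the same for every c. The primitives at x and at all x - g i can thus be
  combined under one integral.\<close>

lemma approx_primitive_shift:
  assumes "0 \<le> c"
  shows "approx_primitive n (x - c) =
    (LINT z|lborel. indicator {0..x} z * (LINT s|lborel. indicator {0..(x - z) / \<delta>} s * killed_cdf n s (z - c)))"
proof -
  define f where "f s y = (indicator {0..} s * indicator {0..x - c} y * killed_cdf n s (y - \<delta> * s) :: real)" for s y
  have "approx_primitive n (x - c) = (LINT y|lborel. LINT s|lborel. f s y)"
    unfolding approx_primitive_def approx_potential_def f_def
  proof (rule Bochner_Integration.integral_cong[OF refl])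
    fix y
    show "indicator {0..x - c} y * (LINT t|lborel. indicator {0..} t * killed_cdf n t (y - \<delta> * t)) =
        (LINT s|lborel. indicator {0..} s * indicator {0..x - c} y * killed_cdf n s (y - \<delta> * s))"
      unfolding integral_mult_right_zero[symmetric]
      by (intro Bochner_Integration.integral_cong refl) simp
  qed
  also have "\<dots> = (LINT z|lborel. LINT s|lborel. f s (z + \<delta> * s - c))"
  proof (rule integral_shear[where C = 1 and A = "(x - c) / \<delta>" and B = "x - c"])
    show "case_prod f \<in> borel_measurable (borel \<Otimes>\<^sub>M borel)"
      unfolding f_def case_prod_beta' by measurable
    fix s y
    show "\<bar>f s y\<bar> \<le> 1" using killed_cdf_bounds[of s n "y - \<delta> * s"] by (auto simp: f_def indicator_def)
    assume nz: "f s y \<noteq> 0"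
    hence "0 \<le> y - \<delta> * s" using killed_cdf_neg[of "y - \<delta> * s" n s] by (force simp: f_def)
    thus "0 \<le> s \<and> s \<le> (x - c) / \<delta> \<and> 0 \<le> y \<and> y \<le> x - c"
      using nz delta_pos by (auto simp: f_def indicator_def field_simps split: if_splits)
  qed (use delta_pos in simp)
  also have "\<dots> = (LINT z|lborel. indicator {0..x} z * (LINT s|lborel. indicator {0..(x - z) / \<delta>} s * killed_cdf n s (z - c)))"
  proof (rule Bochner_Integration.integral_cong[OF refl])
    fix z
    \<comment> \<open>For z < c both sides vanish. For z \<ge> c and s \<ge> 0 the lower end of the
      range of y is respected automatically, and the upper end becomes s \<le> (x - z) /
      \<delta>.\<close>
    have "f s (z + \<delta> * s - c) = indicator {0..x} z * (indicator {0..(x - z) / \<delta>} s * killed_cdf n s (z - c))" for s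
    proof (cases "z < c \<or> s < 0")
      case True
      thus ?thesis using killed_cdf_neg[of "z - c" n s] by (auto simp: f_def indicator_def)
    next
      case False
      hence "0 \<le> \<delta> * s" using delta_pos by simp
      moreover have "z + \<delta> * s \<le> x \<longleftrightarrow> s \<le> (x - z) / \<delta>" using delta_pos by (simp add: field_simps)
      ultimately show ?thesis using False assms by (auto simp: f_def indicator_def)
    qed
    thus "(LINT s|lborel. f s (z + \<delta> * s - c)) =
        indicator {0..x} z * (LINT s|lborel. indicator {0..(x - z) / \<delta>} s * killed_cdf n s (z - c))"
      by simp
  qed
  finally show ?thesis .
qed

lemma integrable_killed_interval:
  "integrable lborel (\<lambda>s. indicator {0..T} s * killed_cdf n s z)"
proof (rule Bochner_Integration.integrable_bound[OF integrable_indicator_Icc])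
  show "AE s in lborel. norm (indicator {0..T} s * killed_cdf n s z) \<le> norm (indicator {0..T} s :: real)"
    using killed_cdf_bounds[of _ n z] by (intro AE_I2) (auto simp: indicator_def)
qed measurable

text \<open>For fixed z, the Kolmogorov equation integrated over the times from 0 to (x - z) /
  \<delta> gives the final value of \<open>killed_cdf\<close> minus its initial value 1. Integrated
  over z in [0, x], the final values yield \<open>\<delta> * approx_potential n x\<close> and the
  initial ones x.\<close>

lemma approx_potential_equation:
  assumes "0 \<le> x"
  shows "\<delta> * approx_potential n x = x +
    (\<Sum>i<n. a i * (approx_primitive n (x - g i) - approx_primitive n x)) - q * approx_primitive n x"
proof -
  define J where "J z c = (LINT s|lborel. indicator {0..(x - z) / \<delta>} s * killed_cdf n s (z - c))" for z c
  have J01: "0 \<le> J z c \<and> J z c \<le> x / \<delta>" if "z \<in> {0..x}" for z c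
  proof -
    have "J z c \<le> (LINT s|lborel. indicator {0..(x - z) / \<delta>} s)"
      unfolding J_def
      by (intro integral_mono integrable_killed_interval integrable_indicator_Icc)
         (auto simp: indicator_def killed_cdf_bounds)
    also have "\<dots> \<le> x / \<delta>" using that delta_pos by (auto simp: field_simps)
    finally show ?thesis
      unfolding J_def by (auto intro!: integral_nonneg_AE simp: indicator_def killed_cdf_bounds)
  qed
  have intJ: "integrable lborel (\<lambda>z. indicator {0..x} z * J z c)" for c
  proof (rule integrableI_bounded_set[where A = "{0..x}" and B = "x / \<delta>"])
    show "(\<lambda>z. indicator {0..x} z * J z c) \<in> borel_measurable lborel"
      unfolding J_def atLeastAtMost_def atLeast_def atMost_def by measurable
    show "AE z in lborel. z \<in> {0..x} \<longrightarrow> norm (indicator {0..x} z * J z c) \<le> x / \<delta>"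
      using J01 by (auto simp: indicator_def)
  qed (auto simp: emeasure_lborel_Icc_eq)
  have P: "approx_primitive n (x - c) = (LINT z|lborel. indicator {0..x} z * J z c)" if "0 \<le> c" for c
    using approx_primitive_shift[OF that] by (simp add: J_def)
  have P0: "approx_primitive n x = (LINT z|lborel. indicator {0..x} z * J z 0)"
    using P[of 0] by simp
  have "(\<Sum>i<n. a i * (approx_primitive n (x - g i) - approx_primitive n x)) - q * approx_primitive n x =
    (LINT z|lborel. (\<Sum>i<n. a i * (indicator {0..x} z * J z (g i) - indicator {0..x} z * J z 0))
        - q * (indicator {0..x} z * J z 0))"
    unfolding P0 using P g_pos intJ by (simp add: less_imp_le)
  also have "\<dots> = (LINT z|lborel. indicator {0..x} z * killed_cdf n ((x - z) / \<delta>) z - indicator {0..x} z)"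
  proof (rule Bochner_Integration.integral_cong[OF refl])
    fix z
    show "(\<Sum>i<n. a i * (indicator {0..x} z * J z (g i) - indicator {0..x} z * J z 0))
        - q * (indicator {0..x} z * J z 0) =
        indicator {0..x} z * killed_cdf n ((x - z) / \<delta>) z - indicator {0..x} z"
    proof (cases "z \<in> {0..x}")
      case True
      define T where "T = (x - z) / \<delta>"
      define W where "W s = (\<Sum>i<n. a i * (killed_cdf n s (z - g i) - killed_cdf n s z)) - q * killed_cdf n s z" for s
      have "0 \<le> T" using True delta_pos by (simp add: T_def)
      have "(\<Sum>i<n. a i * (J z (g i) - J z 0)) - q * J z 0 = (LINT s|lborel.
          (\<Sum>i<n. a i * (indicator {0..T} s * killed_cdf n s (z - g i) - indicator {0..T} s * killed_cdf n s (z - 0)))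
          - q * (indicator {0..T} s * killed_cdf n s (z - 0)))"
        unfolding J_def T_def[symmetric] using integrable_killed_interval by simp
      also have "\<dots> = (LINT s|lborel. W s * indicator {0..T} s)"
        by (intro Bochner_Integration.integral_cong refl) (auto simp: W_def indicator_def)
      also have "\<dots> = killed_cdf n T z - killed_cdf n 0 z"
      proof (rule integral_FTC_Icc_real[OF \<open>0 \<le> T\<close>])
        fix s
        show "((\<lambda>s. killed_cdf n s z) has_real_derivative W s) (at s)"
          unfolding W_def by (rule DERIV_killed_cdf)
        show "isCont W s"
          unfolding W_def using DERIV_killed_cdf DERIV_isCont by (intro continuous_intros) blast+
      qed
      finally show ?thesis using True by (simp add: T_def killed_cdf_at_0)
    qed auto
  qed
  also have "\<dots> = \<delta> * approx_potential n x - x"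
    unfolding approx_potential_alt using assms
    by (subst Bochner_Integration.integral_diff)
       (auto intro!: integrable_killed_alt integrable_indicator_Icc)
  finally show ?thesis by simp
qed

end

section \<open>Infinitely many jump sizes\<close>

text \<open>As f vanishes left of 0, the integral may start at - b < x. This makes x an interior
  point and the derivative two-sided, even at x = 0.\<close>

lemma DERIV_integral_from_zero:
  fixes f :: "real \<Rightarrow> real"
  assumes cont: "continuous_on UNIV f" and zero: "\<And>x. x \<le> 0 \<Longrightarrow> f x = 0"
  shows "((\<lambda>x. LINT y|lborel. indicator {0..x} y * f y) has_real_derivative f x) (at x)"
proof -
  define b where "b = \<bar>x\<bar> + 1"
  have eq: "(LINT y|lborel. indicator {0..t} y * f y) = integral {- b..t} f" for t
  proof -
    have "(LINT y|lborel. indicator {0..t} y * f y) = (LINT y:{- b..t}|lborel. f y)"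
      unfolding set_lebesgue_integral_def
    proof (rule Bochner_Integration.integral_cong[OF refl])
      fix y
      show "indicator {0..t} y * f y = indicator {- b..t} y *\<^sub>R f y"
        using zero[of y] by (cases "y \<le> 0") (auto simp: indicator_def b_def)
    qed
    also have "\<dots> = integral {- b..t} f"
      using borel_integrable_atLeastAtMost'[OF continuous_on_subset[OF cont]]
      by (intro set_borel_integral_eq_integral) auto
    finally show ?thesis .
  qed
  have "((\<lambda>t. integral {- b..t} f) has_real_derivative f x) (at x within {- b..b})"
    by (rule integral_has_real_derivative) (use cont in \<open>auto intro: continuous_on_subset simp: b_def\<close>)
  moreover have "at x within {- b..b} = at x"
    by (rule at_within_interior) (auto simp: b_def)
  ultimately show ?thesis unfolding eq by simp
qed

context jump_sizes begin

text \<open>Uniform in n, as Tannery's theorem requires. The increment integrates a function bounded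
  by x / \<delta> over a length min x h, and the factor x + 1 makes this a multiple of min 1
  h.\<close>

lemma approx_primitive_diff_le:
  assumes "0 \<le> x" "0 \<le> h"
  shows "\<bar>approx_primitive n (x - h) - approx_primitive n x\<bar> \<le> (x + 1) * x / \<delta> * min 1 h"
proof -
  have int: "integrable lborel (\<lambda>y. indicator {0..x} y * approx_potential n y)" for x
  proof (rule integrableI_bounded_set[where A = "{0..x}" and B = "\<bar>x\<bar> / \<delta>"])
    have "norm (indicator {0..x} y * approx_potential n y) \<le> \<bar>x\<bar> / \<delta>" if "y \<in> {0..x}" for y
    proof -
      have "max 0 y / \<delta> \<le> \<bar>x\<bar> / \<delta>"
        using that delta_pos by (intro divide_right_mono) auto
      thus ?thesis using that approx_potential_nonneg[of n y] approx_potential_le[of n y] by simp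
    qed
    thus "AE y in lborel. y \<in> {0..x} \<longrightarrow> norm (indicator {0..x} y * approx_potential n y) \<le> \<bar>x\<bar> / \<delta>"
      by simp
  qed (auto simp: emeasure_lborel_Icc_eq)
  define I where "I = (LINT y|lborel. indicator {0..x} y * approx_potential n y - indicator {0..x - h} y * approx_potential n y)"
  have 1: "approx_primitive n x - approx_primitive n (x - h) = I"
    unfolding approx_primitive_def I_def using int by simp
  have 2: "0 \<le> I"
    unfolding I_def by (intro integral_nonneg_AE AE_I2) (use assms in \<open>auto simp: indicator_def approx_potential_nonneg\<close>)
  have "I \<le> (LINT y|lborel. x / \<delta> * indicator {max 0 (x - h)..x} y)"
    unfolding I_def
  proof (intro integral_mono Bochner_Integration.integrable_diff int integrable_mult_right integrable_indicator_Icc)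
    fix y
    have "approx_potential n y \<le> x / \<delta>" if "0 \<le> y" "y \<le> x"
      using approx_potential_le[of n y] that delta_pos divide_right_mono[of y x \<delta>] by (simp add: max_def)
    thus "indicator {0..x} y * approx_potential n y - indicator {0..x - h} y * approx_potential n y \<le>
        x / \<delta> * indicator {max 0 (x - h)..x} y"
      using assms delta_pos by (auto simp: indicator_def)
  qed
  also have "\<dots> = x / \<delta> * (x - max 0 (x - h))" using assms by simp
  also have "\<dots> \<le> x / \<delta> * ((x + 1) * min 1 h)"
  proof (rule mult_left_mono)
    have "h \<le> (x + 1) * h" using assms by (simp add: distrib_right)
    thus "x - max 0 (x - h) \<le> (x + 1) * min 1 h" using assms by (auto simp: min_def max_def)
    show "0 \<le> x / \<delta>" using assms delta_pos by simp
  qed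
  finally have "I \<le> (x + 1) * x / \<delta> * min 1 h" by (simp add: mult_ac)
  thus ?thesis using 1 2 by linarith
qed

text \<open>Pointwise convergence and domination suffice for the limit of the integrated equation,
  which is differentiated only afterwards: the primitive P of the limit is differentiable, and the
  Lipschitz bound of U dominates the series of derivatives.\<close>

lemma limit_drift_renewal_equation:
  assumes lim: "\<And>x. (\<lambda>n. approx_potential n x) \<longlonglongrightarrow> U x"
    and gamma: "0 < \<gamma>" "\<gamma> < 1"
    and summ: "summable (\<lambda>n. a n * min 1 (g n powr \<gamma>))"
    and fin: "\<And>e r. 0 < e \<Longrightarrow> finite {n. 0 < a n \<and> e \<le> g n \<and> g n \<le> r}"
  shows "drift_renewal_equation g a U \<delta> q \<gamma> (1 / \<delta>)"
proof -
  have U_nonpos: "U x = 0" if "x \<le> 0" for x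
    using lim[of x] that by (simp add: approx_potential_nonpos LIMSEQ_const_iff)
  have U_lip: "\<bar>U x - U y\<bar> \<le> 1 / \<delta> * \<bar>x - y\<bar>" for x y
    by (rule LIMSEQ_le_const2[OF tendsto_rabs[OF tendsto_diff[OF lim lim]]])
       (use approx_potential_lipschitz in blast)
  have U_nonneg: "0 \<le> U x" for x
    by (rule LIMSEQ_le_const[OF lim]) (use approx_potential_nonneg in blast)
  have U_le: "U x \<le> max 0 x / \<delta>" for x
    by (rule LIMSEQ_le_const2[OF lim]) (use approx_potential_le in blast)
  have cont: "continuous_on UNIV U"
    by (rule lipschitz_on_continuous_on[of "1 / \<delta>"], rule lipschitz_onI)
       (use U_lip delta_pos in \<open>auto simp: dist_real_def\<close>)
  define P where "P x = (LINT y|lborel. indicator {0..x} y * U y)" for x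
  have P_deriv: "(P has_real_derivative U x) (at x)" for x
    using DERIV_integral_from_zero[OF cont U_nonpos, of x] by (simp add: P_def[abs_def])
  have P_lim: "(\<lambda>n. approx_primitive n x) \<longlonglongrightarrow> P x" for x
    unfolding approx_primitive_def P_def
  proof (rule integral_dominated_convergence[where w = "\<lambda>y. \<bar>x\<bar> / \<delta> * indicator {0..x} y"])
    show "(\<lambda>y. indicator {0..x} y * U y) \<in> borel_measurable lborel"
      using borel_measurable_continuous_onI[OF cont] by measurable
    show "AE y in lborel. (\<lambda>i. indicator {0..x} y * approx_potential i y) \<longlonglongrightarrow> indicator {0..x} y * U y"
      by (intro AE_I2 tendsto_mult_left lim)
    fix n
    have "norm (indicator {0..x} y * approx_potential n y) \<le> \<bar>x\<bar> / \<delta> * indicator {0..x} y" for y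
    proof (cases "y \<in> {0..x}")
      case True
      hence "max 0 y / \<delta> \<le> \<bar>x\<bar> / \<delta>" using delta_pos by (intro divide_right_mono) auto
      thus ?thesis using True approx_potential_nonneg[of n y] approx_potential_le[of n y] by simp
    qed auto
    thus "AE y in lborel. norm (indicator {0..x} y * approx_potential n y) \<le> \<bar>x\<bar> / \<delta> * indicator {0..x} y"
      by simp
  qed (auto intro!: integrable_mult_right integrable_indicator_Icc)
  have P_diff: "\<bar>P (x - h) - P x\<bar> \<le> (x + 1) * x / \<delta> * min 1 h" if "0 \<le> x" "0 \<le> h" for x h
    by (rule LIMSEQ_le_const2[OF tendsto_rabs[OF tendsto_diff[OF P_lim P_lim]]])
       (use approx_primitive_diff_le[OF that] in blast)
  have P_neg: "P x = 0" if "x < 0" for x using that by (simp add: P_def)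
  have P_0: "P 0 = 0"
  proof -
    have "P 0 = (LINT y|lborel. indicator {0..0::real} y * 0)"
      unfolding P_def by (intro Bochner_Integration.integral_cong refl) (auto simp: indicator_def U_nonpos)
    thus ?thesis by simp
  qed
  have summ1: "summable (\<lambda>n. a n * min 1 (g n))"
  proof (rule summable_comparison_test'[OF summ])
    fix n
    have "min 1 (g n) \<le> min 1 (g n powr \<gamma>)"
    proof (cases "g n \<le> 1")
      case True
      thus ?thesis using powr_mono'[of \<gamma> 1 "g n"] gamma g_pos[of n] by (simp add: min_def)
    next
      case False
      thus ?thesis using gamma by (simp add: ge_one_powr_ge_zero)
    qed
    thus "norm (a n * min 1 (g n)) \<le> a n * min 1 (g n powr \<gamma>)"
      using a_nonneg[of n] g_pos[of n] by (auto simp: abs_mult intro!: mult_left_mono)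
  qed
  have eq: "\<delta> * U x = x + (\<Sum>n. a n * (P (x - g n) - P x)) - q * P x" if "0 \<le> x" for x
  proof -
    have "(\<lambda>n. \<Sum>i<n. a i * (approx_primitive n (x - g i) - approx_primitive n x))
        \<longlonglongrightarrow> (\<Sum>n. a n * (P (x - g n) - P x))"
    proof -
      \<comment> \<open>Extension by 0 turns the partial sums, whose terms also depend on n, into
        full series.\<close>
      define f where "f k n = (if k < n then a k * (approx_primitive n (x - g k) - approx_primitive n x) else 0)"
        for k n
      have "(\<lambda>n. \<Sum>k. f k n) \<longlonglongrightarrow> (\<Sum>k. a k * (P (x - g k) - P x))"
      proof (rule tannerys_theorem[THEN conjunct2, THEN conjunct2])
        fix k
        have "(\<lambda>n. a k * (approx_primitive n (x - g k) - approx_primitive n x))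
            \<longlonglongrightarrow> a k * (P (x - g k) - P x)"
          by (intro tendsto_intros P_lim)
        moreover have "\<forall>\<^sub>F n in sequentially.
            a k * (approx_primitive n (x - g k) - approx_primitive n x) = f k n"
          using eventually_gt_at_top[of k] by eventually_elim (simp add: f_def)
        ultimately show "(\<lambda>n. f k n) \<longlonglongrightarrow> a k * (P (x - g k) - P x)"
          by (rule Lim_transform_eventually)
      next
        have "norm (f k n) \<le> (x + 1) * x / \<delta> * (a k * min 1 (g k))" for k n
        proof -
          have "a k * \<bar>approx_primitive n (x - g k) - approx_primitive n x\<bar> \<le>
              a k * ((x + 1) * x / \<delta> * min 1 (g k))"
            by (intro mult_left_mono approx_primitive_diff_le a_nonneg that less_imp_le[OF g_pos])
          hence 1: "norm (a k * (approx_primitive n (x - g k) - approx_primitive n x)) \<le>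
              (x + 1) * x / \<delta> * (a k * min 1 (g k))"
            unfolding mult.left_commute[of _ "a k"] real_norm_def abs_mult abs_of_nonneg[OF a_nonneg] .
          thus ?thesis unfolding f_def using order_trans[OF norm_ge_zero 1] by simp
        qed
        thus "\<forall>\<^sub>F (k, n) in at_top \<times>\<^sub>F sequentially. norm (f k n) \<le> (x + 1) * x / \<delta> * (a k * min 1 (g k))"
          by (intro always_eventually) auto
        show "summable (\<lambda>k. (x + 1) * x / \<delta> * (a k * min 1 (g k)))"
          by (intro summable_mult summ1)
      qed simp
      also have "(\<lambda>n. \<Sum>k. f k n) =
          (\<lambda>n. \<Sum>i<n. a i * (approx_primitive n (x - g i) - approx_primitive n x))"
      proof
        fix n
        have "(\<Sum>k. f k n) = (\<Sum>k<n. f k n)" by (rule suminf_finite) (auto simp: f_def)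
        thus "(\<Sum>k. f k n) = (\<Sum>i<n. a i * (approx_primitive n (x - g i) - approx_primitive n x))"
          by (simp add: f_def)
      qed
      finally show ?thesis .
    qed
    hence "(\<lambda>n. x + (\<Sum>i<n. a i * (approx_primitive n (x - g i) - approx_primitive n x))
        - q * approx_primitive n x) \<longlonglongrightarrow> x + (\<Sum>n. a n * (P (x - g n) - P x)) - q * P x"
      by (intro tendsto_intros P_lim)
    moreover have "(\<lambda>n. \<delta> * approx_potential n x) \<longlonglongrightarrow> \<delta> * U x"
      by (intro tendsto_intros lim)
    ultimately show ?thesis
      unfolding approx_potential_equation[OF that] by (rule LIMSEQ_unique[rotated])
  qed
  define C where "C x = (\<Sum>n. a n * (P (x - g n) - P x)) - q * P x" for x
  have C_deriv: "(C has_real_derivative (\<Sum>n. a n * (U (x - g n) - U x)) - q * U x) (at x)" if "0 \<le> x" for x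
  proof -
    have "((\<lambda>x. \<Sum>n. a n * (P (x - g n) - P x)) has_real_derivative (\<Sum>n. a n * (U (x - g n) - U x))) (at x)"
    \<comment> \<open>On the unit ball \<delta> U lies between 0 and x + 1, so increments of
      \<delta> U are at most min (x + 1) (g n), hence at most (x + 2) min 1 (g n).\<close>
    proof (rule difference_series_has_derivative[where r = 1 and K = "(x + 2) / \<delta>"
          and ?K0.0 = "(x + 1) * x / \<delta>"])
      fix n y assume y: "y \<in> ball x 1"
      have gn: "0 < g n" by (rule g_pos)
      have "\<bar>U (y - g n) - U y\<bar> \<le> 1 / \<delta> * g n" using U_lip[of "y - g n" y] gn by simp
      moreover have "\<bar>U (y - g n) - U y\<bar> \<le> 1 / \<delta> * (x + 1)"
      proof -
        have "U z \<le> 1 / \<delta> * (x + 1)" if "z \<le> y" for z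
        proof -
          have "max 0 z / \<delta> \<le> (x + 1) / \<delta>"
            using that y \<open>0 \<le> x\<close> delta_pos by (intro divide_right_mono) (auto simp: dist_real_def)
          thus ?thesis using U_le[of z] by simp
        qed
        from this[of y] this[of "y - g n"] show ?thesis
          using U_nonneg[of y] U_nonneg[of "y - g n"] gn by auto
      qed
      ultimately have "\<bar>U (y - g n) - U y\<bar> \<le> 1 / \<delta> * min (x + 1) (g n)" by (simp add: min_def)
      also have "\<dots> \<le> 1 / \<delta> * ((x + 2) * min 1 (g n))"
      proof (rule mult_left_mono)
        have "g n \<le> (x + 2) * g n" using gn \<open>0 \<le> x\<close> by simp
        thus "min (x + 1) (g n) \<le> (x + 2) * min 1 (g n)"
          unfolding min_def using \<open>0 \<le> x\<close> by auto
      qed (use delta_pos in simp)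
      finally show "\<bar>U (y - g n) - U y\<bar> \<le> (x + 2) / \<delta> * min 1 (g n)" by simp
    next
      fix n
      show "\<bar>P (x - g n) - P x\<bar> \<le> (x + 1) * x / \<delta> * min 1 (g n)"
        using P_diff[OF that, of "g n"] g_pos[of n] by simp
    qed (simp_all add: a_nonneg summ1 less_imp_le[OF g_pos] P_deriv)
    thus ?thesis unfolding C_def[abs_def] by (rule DERIV_diff[OF _ DERIV_cmult[OF P_deriv]])
  qed
  show ?thesis
  proof
    fix x :: real
    assume x: "0 < x"
    have "((\<lambda>x. (x + C x) / \<delta>) has_real_derivative (1 + ((\<Sum>n. a n * (U (x - g n) - U x)) - q * U x)) / \<delta>) (at x)"
      using x by (intro DERIV_cdivide DERIV_add DERIV_ident C_deriv) auto
    hence "(U has_real_derivative (1 + ((\<Sum>n. a n * (U (x - g n) - U x)) - q * U x)) / \<delta>) (at x)"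
      by (rule has_field_derivative_transform_within_open[where S = "{0<..}"])
         (use x eq delta_pos in \<open>auto simp: C_def field_simps\<close>)
    thus "(U has_real_derivative (1 - q * U x + (\<Sum>n. a n * (U (x - g n) - U x))) / \<delta>) (at x)"
      by (simp add: algebra_simps)
  next
    \<comment> \<open>The formula is differentiable at 0 from both sides, but the equation
      identifies it with U only on [0, \<infinity>); so a one-sided derivative is transferred. Its
      value is 1 / \<delta> because U vanishes at 0 and at every - g n.\<close>
    have "((\<lambda>x. (x + C x) / \<delta>) has_real_derivative (1 + ((\<Sum>n. a n * (U (0 - g n) - U 0)) - q * U 0)) / \<delta>) (at 0)"
      by (intro DERIV_cdivide DERIV_add DERIV_ident C_deriv) auto
    moreover have "U (0 - g n) = 0" for n using g_pos[of n] by (intro U_nonpos) simp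
    ultimately have "((\<lambda>x. (x + C x) / \<delta>) has_real_derivative 1 / \<delta>) (at 0)"
      using U_nonpos[of 0] by simp
    from has_field_derivative_at_within[OF this, of "{0..}"]
    show "(U has_real_derivative 1 / \<delta>) (at 0 within {0..})"
      by (rule has_field_derivative_transform_within[where d = 1])
         (use eq delta_pos in \<open>auto simp: C_def field_simps\<close>)
  qed (fact g_pos a_nonneg gamma summ fin delta_pos U_nonpos U_lip | assumption)+
qed

end

section \<open>Subordinators with atomic Levy measure\<close>

text \<open>The disjoint events Y = k have total probability 1, since Poisson weights sum to 1. In
  particular the count is almost surely finite.\<close>

lemma (in prob_space) AE_nat_if_poisson:
  fixes Y :: "'a \<Rightarrow> ennreal"
  assumes [measurable]: "Y \<in> borel_measurable M"
    and law: "\<And>k. prob {\<omega> \<in> space M. Y \<omega> = of_nat k} = poisson_weight r k"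
  shows "AE \<omega> in M. \<exists>k. Y \<omega> = of_nat k"
proof -
  have "(\<lambda>k. prob {\<omega> \<in> space M. Y \<omega> = of_nat k}) sums prob (\<Union>k. {\<omega> \<in> space M. Y \<omega> = of_nat k})"
    by (rule finite_measure_UNION) (auto simp: disjoint_family_on_def)
  from sums_unique2[OF this[unfolded law] poisson_weight_sums]
  have "prob (\<Union>k. {\<omega> \<in> space M. Y \<omega> = of_nat k}) = 1" .
  hence "AE \<omega> in M. \<omega> \<in> (\<Union>k. {\<omega> \<in> space M. Y \<omega> = of_nat k})"
    by (rule AE_prob_1)
  thus ?thesis by auto
qed

text \<open>Splitting by the value k of the last variable and using independence reproduces the
  recursion of \<open>jump_cdf\<close>.\<close>

lemma (in jump_sizes) prob_sum_eq_jump_cdf: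
  fixes M :: "'a measure" and Z :: "nat \<Rightarrow> 'a \<Rightarrow> real"
  assumes "prob_space M"
    and indep: "\<And>n. prob_space.indep_vars M (\<lambda>_. borel) Z {..<n}"
    and law: "\<And>i k. measure M {\<omega> \<in> space M. Z i \<omega> = real k} = poisson_weight (a i * t) k"
    and nat: "\<And>i. AE \<omega> in M. \<exists>k. Z i \<omega> = real k"
  shows "measure M {\<omega> \<in> space M. (\<Sum>i<n. g i * Z i \<omega>) \<le> z} = jump_cdf n t z"
proof -
  interpret prob_space M by fact
  have Z_meas[measurable]: "Z i \<in> borel_measurable M" for i
    using indep[of "Suc i"] by (auto simp: indep_vars_def)
  show ?thesis
  proof (induction n arbitrary: z)
    case 0
    show ?case by (simp add: prob_space)
  next
    case (Suc n)
    define S where "S \<omega> = (\<Sum>i<n. g i * Z i \<omega>)" for \<omega>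
    have [measurable]: "S \<in> borel_measurable M" unfolding S_def by measurable
    have "indep_vars (\<lambda>_. borel) (\<lambda>i \<omega>. g i * Z i \<omega>) (insert n {..<n})"
      using indep_vars_compose2[OF indep[of "Suc n"], of "\<lambda>i. (*) (g i)" "\<lambda>_. borel"]
      by (simp add: lessThan_Suc)
    hence ind: "indep_var borel (\<lambda>\<omega>. g n * Z n \<omega>) borel S"
      unfolding S_def by (intro indep_vars_sum) auto
    define E where "E k = {\<omega> \<in> space M. Z n \<omega> = real k \<and> S \<omega> \<le> z - real k * g n}" for k :: nat
    have E: "prob (E k) = poisson_weight (a n * t) k * jump_cdf n t (z - real k * g n)" for k
    proof -
      have "E k = (\<lambda>x. (g n * Z n x, S x)) -` ({g n * real k} \<times> {..z - real k * g n}) \<inter> space M"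
        using g_pos[of n] by (auto simp: E_def)
      also have "prob \<dots> = prob ((\<lambda>\<omega>. g n * Z n \<omega>) -` {g n * real k} \<inter> space M) *
          prob (S -` {..z - real k * g n} \<inter> space M)"
        by (rule indep_varD[OF ind]) auto
      also have "(\<lambda>\<omega>. g n * Z n \<omega>) -` {g n * real k} \<inter> space M = {\<omega> \<in> space M. Z n \<omega> = real k}"
        using g_pos[of n] by auto
      also have "S -` {..z - real k * g n} \<inter> space M = {\<omega> \<in> space M. S \<omega> \<le> z - real k * g n}"
        by auto
      finally show ?thesis unfolding law S_def Suc .
    qed
    have [measurable]: "E k \<in> events" for k unfolding E_def by measurable
    have "(\<lambda>k. prob (E k)) sums prob (\<Union>k. E k)"
      by (rule finite_measure_UNION) (auto simp: disjoint_family_on_def E_def)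
    hence "prob (\<Union>k. E k) = jump_cdf (Suc n) t z"
      unfolding E by (simp add: sums_iff)
    moreover have "prob {\<omega> \<in> space M. (\<Sum>i<Suc n. g i * Z i \<omega>) \<le> z} = prob (\<Union>k. E k)"
    proof (rule measure_eq_AE)
      show "AE \<omega> in M. \<omega> \<in> {\<omega> \<in> space M. (\<Sum>i<Suc n. g i * Z i \<omega>) \<le> z} \<longleftrightarrow> \<omega> \<in> (\<Union>k. E k)"
        using nat[of n]
      proof eventually_elim
        case (elim \<omega>)
        then obtain k where "Z n \<omega> = real k" by blast
        thus ?case by (auto simp: E_def S_def algebra_simps)
      qed
    qed measurable
    ultimately show ?case by simp
  qed
qed

section \<open>Atoms of the Levy measure\<close>

lemma levy_measure_sets: "levy_measure \<nu> \<Longrightarrow> sets \<nu> = sets borel"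
  by (simp add: levy_measure_def)

lemma levy_measure_tail_finite:
  assumes \<nu>: "levy_measure \<nu>" and "0 < e"
  shows "emeasure \<nu> {e..} < \<infinity>"
proof -
  have [measurable_cong]: "sets \<nu> = sets borel" using \<nu> by (rule levy_measure_sets)
  have "ennreal (min 1 e) * emeasure \<nu> {e..} = (\<integral>\<^sup>+ x. ennreal (min 1 e) * indicator {e..} x \<partial>\<nu>)"
    by (subst nn_integral_cmult_indicator) auto
  also have "\<dots> \<le> (\<integral>\<^sup>+ x. ennreal (min 1 x) \<partial>\<nu>)"
    by (intro nn_integral_mono) (auto simp: indicator_def intro!: ennreal_leI)
  also have "\<dots> < \<infinity>" using \<nu> by (simp add: levy_measure_def)
  finally show ?thesis using \<open>0 < e\<close> by (auto simp: ennreal_mult_less_top)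
qed

lemma levy_measure_sigma_finite:
  assumes \<nu>: "levy_measure \<nu>"
  shows "sigma_finite_measure \<nu>"
proof
  have sets: "sets \<nu> = sets borel" using \<nu> by (rule levy_measure_sets)
  define C where "C = insert {..0} (range (\<lambda>n. {1 / real (Suc n)..}))"
  have "\<Union> C = UNIV"
  proof (intro set_eqI iffI UNIV_I)
    fix x :: real
    show "x \<in> \<Union> C"
    proof (cases "x \<le> 0")
      case False
      then obtain n where "1 / real (Suc n) < x" using nat_approx_posE[of x] by (auto simp: not_le)
      hence "x \<in> {1 / real (Suc n)..}" by simp
      thus ?thesis unfolding C_def by blast
    qed (auto simp: C_def)
  qed
  moreover have "emeasure \<nu> c \<noteq> \<infinity>" if c: "c \<in> C" for c
  proof -
    consider "c = {..0}" | n where "c = {1 / real (Suc n)..}" using c unfolding C_def by blast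
    thus ?thesis
    proof cases
      case 1
      thus ?thesis using \<nu> by (simp add: levy_measure_def)
    next
      case (2 n)
      thus ?thesis using levy_measure_tail_finite[OF \<nu>, of "1 / real (Suc n)"] by (simp add: less_top)
    qed
  qed
  moreover have "countable C" "C \<subseteq> sets \<nu>" unfolding C_def sets by auto
  moreover have "space \<nu> = UNIV" using sets_eq_imp_space_eq[OF sets] by simp
  ultimately show "\<exists>A. countable A \<and> A \<subseteq> sets \<nu> \<and> \<Union> A = space \<nu> \<and> (\<forall>a\<in>A. emeasure \<nu> a \<noteq> \<infinity>)"
    by (intro exI[of _ C] conjI ballI) simp_all
qed

lemma atoms_pos:
  assumes \<nu>: "levy_measure \<nu>" and "x \<in> atoms \<nu>"
  shows "0 < x"
proof (rule ccontr)
  assume "\<not> 0 < x"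
  hence "emeasure \<nu> {x} \<le> emeasure \<nu> {..0}"
    by (intro emeasure_mono) (auto simp: levy_measure_sets[OF \<nu>])
  thus False using assms by (simp add: levy_measure_def atoms_def)
qed

text \<open>Otherwise Bolzano-Weierstrass gives an accumulation point in the compact interval
  [e, r], away from 0.\<close>

lemma atoms_locally_finite:
  assumes "\<forall>x. x islimpt atoms \<nu> \<longrightarrow> x = 0" and "0 < e"
  shows "finite {x \<in> atoms \<nu>. e \<le> x \<and> x \<le> r}"
proof (rule ccontr)
  let ?A = "{x \<in> atoms \<nu>. e \<le> x \<and> x \<le> r}"
  assume "infinite ?A"
  moreover have "?A \<subseteq> {e..r}" by auto
  ultimately obtain x where "x \<in> {e..r}" "x islimpt ?A"
    using compact_eq_Bolzano_Weierstrass[THEN iffD1, OF compact_Icc] by blast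
  moreover from this have "x islimpt atoms \<nu>" by (auto intro: islimpt_subset)
  ultimately show False using assms by auto
qed

lemma countable_atoms:
  assumes \<nu>: "levy_measure \<nu>" and lim: "\<forall>x. x islimpt atoms \<nu> \<longrightarrow> x = 0"
  shows "countable (atoms \<nu>)"
proof -
  have "atoms \<nu> \<subseteq> (\<Union>n m. {x \<in> atoms \<nu>. 1 / real (Suc n) \<le> x \<and> x \<le> real m})"
  proof
    fix x assume x: "x \<in> atoms \<nu>"
    obtain n where "1 / real (Suc n) < x" using nat_approx_posE[OF atoms_pos[OF \<nu> x]] by auto
    moreover obtain m where "x \<le> real m" using real_arch_simple by blast
    ultimately show "x \<in> (\<Union>n m. {x \<in> atoms \<nu>. 1 / real (Suc n) \<le> x \<and> x \<le> real m})"
      using x by (auto intro!: less_imp_le)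
  qed
  moreover have "countable (\<Union>n m. {x \<in> atoms \<nu>. 1 / real (Suc n) \<le> x \<and> x \<le> real m})"
    by (intro countable_UN countableI_type countable_finite atoms_locally_finite[OF lim]) auto
  ultimately show ?thesis by (rule countable_subset)
qed

text \<open>The atoms are enumerated by \<open>to_nat_on\<close>, so a block is empty or a singleton. The junk index of an
  empty block gets the size \<open>1\<close> and the mass \<open>0\<close>.\<close>

definition atom_block :: "real measure \<Rightarrow> nat \<Rightarrow> real set" where
  "atom_block \<nu> n = {x \<in> atoms \<nu>. to_nat_on (atoms \<nu>) x = n}"

definition atom_size :: "real measure \<Rightarrow> nat \<Rightarrow> real" where
  "atom_size \<nu> n = (if atom_block \<nu> n = {} then 1 else the_elem (atom_block \<nu> n))"

definition atom_mass :: "real measure \<Rightarrow> nat \<Rightarrow> real" where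
  "atom_mass \<nu> n = measure \<nu> (atom_block \<nu> n)"

locale atomic_levy_measure =
  fixes \<nu> :: "real measure"
  assumes levy: "levy_measure \<nu>" and accum: "\<forall>x. x islimpt atoms \<nu> \<longrightarrow> x = 0"
begin

lemmas countable = countable_atoms[OF levy accum]

lemma sets_nu[measurable_cong, simp]: "sets \<nu> = sets borel"
  using levy by (rule levy_measure_sets)

lemma atom_block_cases:
  obtains "atom_block \<nu> n = {}" "atom_size \<nu> n = 1" "atom_mass \<nu> n = 0"
  | "atom_block \<nu> n = {atom_size \<nu> n}" "atom_size \<nu> n \<in> atoms \<nu>" "0 < atom_mass \<nu> n"
proof (cases "atom_block \<nu> n = {}")
  case True
  thus ?thesis by (intro that(1)) (auto simp: atom_size_def atom_mass_def)
next
  case False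
  then obtain x where x: "x \<in> atoms \<nu>" "to_nat_on (atoms \<nu>) x = n" by (auto simp: atom_block_def)
  hence eq: "atom_block \<nu> n = {x}"
    using inj_on_to_nat_on[OF countable] by (auto simp: atom_block_def inj_on_def)
  have "emeasure \<nu> {x} \<le> emeasure \<nu> {x..}" by (intro emeasure_mono) auto
  also have "\<dots> < \<infinity>" by (rule levy_measure_tail_finite[OF levy atoms_pos[OF levy x(1)]])
  finally have "0 < measure \<nu> {x}"
    using x(1) by (auto simp: atoms_def measure_def enn2real_positive_iff)
  thus ?thesis using x eq by (intro that(2)) (auto simp: atom_size_def atom_mass_def)
qed

lemma atom_size_pos: "0 < atom_size \<nu> n"
  by (cases n rule: atom_block_cases) (auto intro: atoms_pos[OF levy])

lemma atom_mass_nonneg: "0 \<le> atom_mass \<nu> n"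
  by (simp add: atom_mass_def)

lemma in_atom_block: "x \<in> atom_block \<nu> n \<Longrightarrow> x = atom_size \<nu> n \<and> x \<in> atoms \<nu>"
  by (cases n rule: atom_block_cases) auto

lemma emeasure_atom_block: "emeasure \<nu> (atom_block \<nu> n) = ennreal (atom_mass \<nu> n)"
proof (cases n rule: atom_block_cases)
  case 2
  have "emeasure \<nu> (atom_block \<nu> n) \<le> emeasure \<nu> {atom_size \<nu> n..}"
    using 2 by (intro emeasure_mono) auto
  also have "\<dots> < \<infinity>" by (rule levy_measure_tail_finite[OF levy atom_size_pos])
  finally show ?thesis by (simp add: atom_mass_def emeasure_eq_ennreal_measure)
qed simp

lemma atom_block_sets[measurable, simp]: "atom_block \<nu> n \<in> sets borel"
  by (cases n rule: atom_block_cases) auto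

lemma UN_atom_block: "(\<Union>n. atom_block \<nu> n) = atoms \<nu>"
  by (auto simp: atom_block_def)

lemma atoms_eq_atom_size: "{atom_size \<nu> n |n. 0 < atom_mass \<nu> n} = atoms \<nu>"
proof (intro set_eqI iffI)
  fix x assume "x \<in> {atom_size \<nu> n |n. 0 < atom_mass \<nu> n}"
  then obtain n where "x = atom_size \<nu> n" "0 < atom_mass \<nu> n" by auto
  thus "x \<in> atoms \<nu>" by (cases n rule: atom_block_cases) auto
next
  fix x assume "x \<in> atoms \<nu>"
  then obtain n where "x \<in> atom_block \<nu> n" using UN_atom_block by auto
  thus "x \<in> {atom_size \<nu> n |n. 0 < atom_mass \<nu> n}" by (cases n rule: atom_block_cases) auto
qed

lemma atom_size_locally_finite:
  assumes "0 < e"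
  shows "finite {n. 0 < atom_mass \<nu> n \<and> e \<le> atom_size \<nu> n \<and> atom_size \<nu> n \<le> r}"
proof (rule inj_on_finite[OF _ _ atoms_locally_finite[OF accum assms, of r]])
  show "inj_on (atom_size \<nu>) {n. 0 < atom_mass \<nu> n \<and> e \<le> atom_size \<nu> n \<and> atom_size \<nu> n \<le> r}"
  proof (rule inj_onI)
    fix n m assume *: "n \<in> {n. 0 < atom_mass \<nu> n \<and> e \<le> atom_size \<nu> n \<and> atom_size \<nu> n \<le> r}"
      "m \<in> {n. 0 < atom_mass \<nu> n \<and> e \<le> atom_size \<nu> n \<and> atom_size \<nu> n \<le> r}" "atom_size \<nu> n = atom_size \<nu> m"
    have "atom_size \<nu> n \<in> atom_block \<nu> n" using * by (cases n rule: atom_block_cases) auto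
    moreover have "atom_size \<nu> m \<in> atom_block \<nu> m" using * by (cases m rule: atom_block_cases) auto
    ultimately show "n = m" using * by (auto simp: atom_block_def)
  qed
  show "atom_size \<nu> ` {n. 0 < atom_mass \<nu> n \<and> e \<le> atom_size \<nu> n \<and> atom_size \<nu> n \<le> r} \<subseteq>
      {x \<in> atoms \<nu>. e \<le> x \<and> x \<le> r}"
    using atoms_eq_atom_size by auto
qed

text \<open>Atoms up to 1 are controlled by the \<gamma>-moment, larger ones by the integrability of
  min 1 x. Each x lies in at most one block, so the series under the integral has at most one
  non-zero term.\<close>

lemma summable_atom_powr:
  assumes "0 < \<gamma>" and fin: "(\<integral>\<^sup>+ x\<in>{0<..1}. ennreal (x powr \<gamma>) \<partial>\<nu>) < \<infinity>"
  shows "summable (\<lambda>n. atom_mass \<nu> n * min 1 (atom_size \<nu> n powr \<gamma>))"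
proof (rule summable_suminf_not_top)
  show "0 \<le> atom_mass \<nu> n * min 1 (atom_size \<nu> n powr \<gamma>)" for n
    using atom_mass_nonneg by simp
  have "(\<Sum>n. ennreal (atom_mass \<nu> n * min 1 (atom_size \<nu> n powr \<gamma>))) =
      (\<Sum>n. \<integral>\<^sup>+ x. ennreal (min 1 (atom_size \<nu> n powr \<gamma>)) * indicator (atom_block \<nu> n) x \<partial>\<nu>)"
  proof (intro arg_cong[where f = suminf] ext)
    fix n
    have "(\<integral>\<^sup>+ x. ennreal (min 1 (atom_size \<nu> n powr \<gamma>)) * indicator (atom_block \<nu> n) x \<partial>\<nu>) =
        ennreal (min 1 (atom_size \<nu> n powr \<gamma>)) * ennreal (atom_mass \<nu> n)"
      by (subst nn_integral_cmult_indicator) (simp_all add: emeasure_atom_block)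
    thus "ennreal (atom_mass \<nu> n * min 1 (atom_size \<nu> n powr \<gamma>)) =
        (\<integral>\<^sup>+ x. ennreal (min 1 (atom_size \<nu> n powr \<gamma>)) * indicator (atom_block \<nu> n) x \<partial>\<nu>)"
      by (simp add: ennreal_mult atom_mass_nonneg mult.commute)
  qed
  also have "\<dots> = (\<integral>\<^sup>+ x. (\<Sum>n. ennreal (min 1 (atom_size \<nu> n powr \<gamma>)) * indicator (atom_block \<nu> n) x) \<partial>\<nu>)"
    by (rule nn_integral_suminf[symmetric]) measurable
  also have "\<dots> \<le> (\<integral>\<^sup>+ x. ennreal (x powr \<gamma>) * indicator {0<..1} x + ennreal (min 1 x) \<partial>\<nu>)"
  proof (rule nn_integral_mono)
    fix x
    show "(\<Sum>n. ennreal (min 1 (atom_size \<nu> n powr \<gamma>)) * indicator (atom_block \<nu> n) x) \<le>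
        ennreal (x powr \<gamma>) * indicator {0<..1} x + ennreal (min 1 x)"
    proof (cases "x \<in> atoms \<nu>")
      case True
      define m where "m = to_nat_on (atoms \<nu>) x"
      have xm: "x \<in> atom_block \<nu> m" using True by (simp add: atom_block_def m_def)
      have "(\<Sum>n. ennreal (min 1 (atom_size \<nu> n powr \<gamma>)) * indicator (atom_block \<nu> n) x) =
          (\<Sum>n\<in>{m}. ennreal (min 1 (atom_size \<nu> n powr \<gamma>)) * indicator (atom_block \<nu> n) x)"
        by (rule suminf_finite) (auto simp: atom_block_def m_def)
      also have "\<dots> = ennreal (min 1 (x powr \<gamma>))"
        using xm in_atom_block[OF xm] by simp
      also have "\<dots> \<le> ennreal (x powr \<gamma>) * indicator {0<..1} x + ennreal (min 1 x)"
      proof (cases "x \<le> 1")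
        case True
        have "ennreal (min 1 (x powr \<gamma>)) \<le> ennreal (x powr \<gamma>)" by (intro ennreal_leI) simp
        also have "\<dots> \<le> ennreal (x powr \<gamma>) * indicator {0<..1} x + ennreal (min 1 x)"
          using True atoms_pos[OF levy \<open>x \<in> atoms \<nu>\<close>] by (simp add: add_increasing2)
        finally show ?thesis .
      next
        case False
        have "ennreal (min 1 (x powr \<gamma>)) \<le> ennreal (min 1 x)"
          using False by (intro ennreal_leI) simp
        thus ?thesis by (simp add: add_increasing)
      qed
      finally show ?thesis .
    next
      case False
      hence "indicator (atom_block \<nu> n) x = (0 :: ennreal)" for n by (auto simp: atom_block_def)
      thus ?thesis by simp
    qed
  qed
  also have "\<dots> = (\<integral>\<^sup>+ x\<in>{0<..1}. ennreal (x powr \<gamma>) \<partial>\<nu>) + (\<integral>\<^sup>+ x. ennreal (min 1 x) \<partial>\<nu>)"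
    by (rule nn_integral_add) measurable
  also have "\<dots> < \<infinity>" using fin levy by (simp add: levy_measure_def)
  finally show "(\<Sum>n. ennreal (atom_mass \<nu> n * min 1 (atom_size \<nu> n powr \<gamma>))) \<noteq> top" by simp
qed

end

section \<open>Jumps of the path counted by size\<close>

text \<open>An unordered sum of non-negative terms is the supremum of its finite partial sums, and
  each of these is eventually dominated by \<open>sum f (F n)\<close>, because the F n absorb every
  point with a non-zero term.\<close>

lemma has_sum_LIMSEQ_exhausting:
  fixes f :: "'a \<Rightarrow> real"
  assumes sum: "(f has_sum S) A" and nonneg: "\<And>x. x \<in> A \<Longrightarrow> 0 \<le> f x"
    and F: "\<And>n. finite (F n)" "\<And>n. F n \<subseteq> A" "incseq F" "{x \<in> A. f x \<noteq> 0} \<subseteq> (\<Union>n. F n)"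
  shows "(\<lambda>n. sum f (F n)) \<longlonglongrightarrow> S"
proof (rule order_tendstoI)
  fix y assume "y < S"
  with sum have "\<forall>\<^sub>F B in finite_subsets_at_top A. y < sum f B"
    unfolding has_sum_def by (rule order_tendstoD)
  then obtain B where B: "finite B" "B \<subseteq> A" "y < sum f B"
    unfolding eventually_finite_subsets_at_top by blast
  define B' where "B' = {x \<in> B. f x \<noteq> 0}"
  have "sum f B = sum f B'" unfolding B'_def using B(1) by (intro sum.mono_neutral_right) auto
  have "\<forall>x\<in>B'. \<forall>\<^sub>F n in sequentially. x \<in> F n"
  proof
    fix x assume "x \<in> B'"
    then obtain m where "x \<in> F m" using F(4) B(2) by (auto simp: B'_def)
    thus "\<forall>\<^sub>F n in sequentially. x \<in> F n"
      using incseqD[OF F(3)] unfolding eventually_sequentially by blast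
  qed
  moreover have "finite B'" using B(1) by (simp add: B'_def)
  ultimately have "\<forall>\<^sub>F n in sequentially. \<forall>x\<in>B'. x \<in> F n"
    by (intro eventually_ball_finite) auto
  thus "\<forall>\<^sub>F n in sequentially. y < sum f (F n)"
  proof eventually_elim
    case (elim n)
    have "sum f B' \<le> sum f (F n)"
    proof (rule sum_mono2[OF F(1)])
      show "B' \<subseteq> F n" using elim by blast
      show "0 \<le> f x" if "x \<in> F n - B'" for x using that F(2) nonneg by blast
    qed
    thus ?case using B(3) \<open>sum f B = sum f B'\<close> by simp
  qed
next
  fix y assume "S < y"
  moreover have "sum f (F n) \<le> S" for n
    by (rule finite_sum_le_has_sum[OF sum F(1,2)]) (use nonneg in auto)
  ultimately show "\<forall>\<^sub>F n in sequentially. sum f (F n) < y"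
    by (intro always_eventually) (auto intro: le_less_trans)
qed

lemma finite_level_set_if_summable:
  fixes f :: "'a \<Rightarrow> real"
  assumes "f summable_on A" "0 < c"
  shows "finite {x \<in> A. f x = c}"
proof (rule ccontr)
  assume inf: "infinite {x \<in> A. f x = c}"
  have "f summable_on {x \<in> A. f x = c}"
    by (rule summable_on_subset_banach[OF assms(1)]) auto
  hence "(\<lambda>_. c) summable_on {x \<in> A. f x = c}"
    by (rule summable_on_cong[THEN iffD1, rotated]) auto
  thus False using infsum_diverge_constant[OF inf, of c] assms(2) by simp
qed

locale atomic_subordinator = atomic_levy_measure \<nu> for \<nu> :: "real measure" +
  fixes M :: "'a measure" and X :: "real \<Rightarrow> 'a \<Rightarrow> real" and \<delta> :: real
    and N :: "'a \<Rightarrow> (real \<times> real) measure"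
  assumes levy_proc: "levy_process M X"
    and mono: "AE \<omega> in M. mono_on {0..} (\<lambda>t. X t \<omega>)"
    and atomic: "purely_atomic \<nu>"
    and poisson: "poisson_random_measure M (density lborel (indicator {0<..}) \<Otimes>\<^sub>M \<nu>) N"
    and count: "AE \<omega> in M. \<forall>A\<in>sets (borel \<Otimes>\<^sub>M borel). emeasure (N \<omega>) A =
      emeasure (count_space UNIV) {s. s > 0 \<and> jump X \<omega> s \<noteq> 0 \<and> (s, jump X \<omega> s) \<in> A}"
    and jumps: "AE \<omega> in M. \<forall>t\<ge>0. (jump X \<omega> has_sum (X t \<omega> - \<delta> * t)) {0<..t}"
begin

sublocale prob_space M using levy_proc by (simp add: levy_process_def)

sublocale nu: sigma_finite_measure \<nu> using levy by (rule levy_measure_sigma_finite)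

abbreviation intensity :: "(real \<times> real) measure" where
  "intensity \<equiv> density lborel (indicator {0<..}) \<Otimes>\<^sub>M \<nu>"

lemma sets_intensity[measurable_cong, simp]: "sets intensity = sets (borel \<Otimes>\<^sub>M borel)"
  by (intro sets_pair_measure_cong) auto

lemma emeasure_intensity:
  assumes [measurable]: "B \<in> sets borel" and "0 \<le> t"
  shows "emeasure intensity ({0<..t} \<times> B) = ennreal t * emeasure \<nu> B"
proof -
  have "emeasure (density lborel (indicator {0<..})) {0<..t} =
      (\<integral>\<^sup>+ s. indicator {0<..} s * indicator {0<..t} s \<partial>lborel)"
    by (rule emeasure_density) auto
  also have "\<dots> = (\<integral>\<^sup>+ s. indicator {0<..t} s \<partial>lborel)"
    by (intro nn_integral_cong) (auto simp: indicator_def)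
  also have "\<dots> = ennreal t" using assms by simp
  finally show ?thesis using nu.emeasure_pair_measure_Times[of "{0<..t}" _ B] by simp
qed

lemma poisson_law:
  assumes "A \<in> sets intensity" "emeasure intensity A < \<infinity>"
  shows "prob {\<omega> \<in> space M. emeasure (N \<omega>) A = of_nat k} = poisson_weight (measure intensity A) k"
  using poisson[unfolded poisson_random_measure_def, THEN conjunct2, THEN conjunct2, THEN conjunct1,
      rule_format, OF assms]
  by (simp add: poisson_weight_def)

text \<open>Kept in \<open>ennreal\<close>, since finiteness holds only almost surely and is derived
  from the Poisson law.\<close>

definition jump_count :: "real \<Rightarrow> nat \<Rightarrow> 'a \<Rightarrow> ennreal" where
  "jump_count t i \<omega> = emeasure (N \<omega>) ({0<..t} \<times> atom_block \<nu> i)"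

lemma measurable_jump_count[measurable]: "jump_count t i \<in> borel_measurable M"
  using poisson unfolding poisson_random_measure_def jump_count_def[abs_def] sets_intensity
  by (auto intro!: pair_measureI)

lemma jump_count_law:
  assumes "0 \<le> t"
  shows "prob {\<omega> \<in> space M. jump_count t i \<omega> = of_nat k} = poisson_weight (atom_mass \<nu> i * t) k"
proof -
  have em: "emeasure intensity ({0<..t} \<times> atom_block \<nu> i) = ennreal (atom_mass \<nu> i * t)"
    using assms atom_mass_nonneg
    by (simp add: emeasure_intensity emeasure_atom_block ennreal_mult mult.commute)
  hence "measure intensity ({0<..t} \<times> atom_block \<nu> i) = atom_mass \<nu> i * t"
    using assms atom_mass_nonneg by (simp add: measure_def)
  moreover have "{0<..t} \<times> atom_block \<nu> i \<in> sets intensity" by (auto intro!: pair_measureI)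
  ultimately show ?thesis
    unfolding jump_count_def by (subst poisson_law) (simp_all add: em)
qed

lemma jump_count_indep:
  "indep_vars (\<lambda>_. borel) (jump_count t) {..<n}"
proof -
  have "(\<forall>i<n. {0<..t} \<times> atom_block \<nu> i \<in> sets intensity) \<and>
      disjoint_family_on (\<lambda>i. {0<..t} \<times> atom_block \<nu> i) {..<n}"
  proof
    show "\<forall>i<n. {0<..t} \<times> atom_block \<nu> i \<in> sets intensity" by (auto intro!: pair_measureI)
    show "disjoint_family_on (\<lambda>i. {0<..t} \<times> atom_block \<nu> i) {..<n}"
      by (auto simp: disjoint_family_on_def atom_block_def)
  qed
  from poisson[unfolded poisson_random_measure_def, THEN conjunct2, THEN conjunct2, THEN conjunct2,
      THEN conjunct2, rule_format, OF this]
  show ?thesis unfolding jump_count_def[abs_def] .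
qed

lemma AE_jump_count_nat:
  assumes "0 \<le> t"
  shows "AE \<omega> in M. \<exists>k. jump_count t i \<omega> = of_nat k"
  by (rule AE_nat_if_poisson[OF measurable_jump_count jump_count_law[OF assms]])

lemma prob_jump_count_sum:
  assumes "0 \<le> t" and js: "jump_sizes (atom_size \<nu>) (atom_mass \<nu>) \<delta> q"
  shows "prob {\<omega> \<in> space M. (\<Sum>i<n. atom_size \<nu> i * enn2real (jump_count t i \<omega>)) \<le> z} =
    jump_sizes.jump_cdf (atom_size \<nu>) (atom_mass \<nu>) n t z"
proof (rule jump_sizes.prob_sum_eq_jump_cdf[OF js prob_space_axioms])
  show "indep_vars (\<lambda>_. borel) (\<lambda>i \<omega>. enn2real (jump_count t i \<omega>)) {..<n}" for n
    by (rule indep_vars_compose2[OF jump_count_indep]) simp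
  show nat: "AE \<omega> in M. \<exists>k. enn2real (jump_count t i \<omega>) = real k" for i
    using AE_jump_count_nat[OF assms(1), of i] by eventually_elim auto
  show "prob {\<omega> \<in> space M. enn2real (jump_count t i \<omega>) = real k} = poisson_weight (atom_mass \<nu> i * t) k" for i k
    unfolding jump_count_law[OF assms(1), symmetric]
  proof (rule measure_eq_AE)
    show "AE \<omega> in M. \<omega> \<in> {\<omega> \<in> space M. enn2real (jump_count t i \<omega>) = real k} \<longleftrightarrow>
        \<omega> \<in> {\<omega> \<in> space M. jump_count t i \<omega> = of_nat k}"
      using AE_jump_count_nat[OF assms(1), of i] by eventually_elim auto
  qed measurable
qed

text \<open>Jump sizes outside the atoms have intensity 0, so their number is Poisson with mean
  0.\<close>

lemma AE_jump_in_atoms: "AE \<omega> in M. \<forall>s>0. jump X \<omega> s \<in> insert 0 (atoms \<nu>)"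
proof -
  have atoms[measurable]: "atoms \<nu> \<in> sets borel"
    using countable by (rule sets.countable[rotated]) auto
  define A where "A = {0::real<..} \<times> (- atoms \<nu>)"
  have A: "A \<in> sets intensity" unfolding A_def by (auto intro!: pair_measureI)
  have "AE x in \<nu>. x \<notin> - atoms \<nu>" using atomic by (simp add: purely_atomic_def)
  hence "emeasure \<nu> (- atoms \<nu>) = 0" by (subst (asm) AE_iff_measurable[OF _ refl]) (auto simp: sets_eq_imp_space_eq[OF sets_nu] Compl_eq)
  hence "emeasure intensity A = 0"
    unfolding A_def by (subst nu.emeasure_pair_measure_Times) auto
  moreover from this have "measure intensity A = 0" by (simp add: measure_def)
  ultimately have "prob {\<omega> \<in> space M. emeasure (N \<omega>) A = of_nat 0} = 1"
    by (subst poisson_law[OF A]) (auto simp: poisson_weight_def)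
  hence "AE \<omega> in M. \<omega> \<in> {\<omega> \<in> space M. emeasure (N \<omega>) A = of_nat 0}" by (rule AE_prob_1)
  with count show ?thesis
  proof eventually_elim
    case (elim \<omega>)
    hence "emeasure (count_space UNIV) {s. s > 0 \<and> jump X \<omega> s \<noteq> 0 \<and> (s, jump X \<omega> s) \<in> A} = 0"
      using A by simp
    hence "{s. s > 0 \<and> jump X \<omega> s \<noteq> 0 \<and> (s, jump X \<omega> s) \<in> A} = {}"
      by (simp add: emeasure_count_space_eq_0)
    thus ?case by (auto simp: A_def)
  qed
qed

text \<open>The jumps up to t are grouped by size, F n collecting those of the first n sizes. Each
  group is finite because the jumps are summable, so it contributes size times count; the groups
  exhaust all jumps because almost surely every jump size is an atom.\<close>

lemma AE_jump_sums_tendsto: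
  assumes "0 \<le> t"
  shows "AE \<omega> in M. incseq (\<lambda>n. \<Sum>i<n. atom_size \<nu> i * enn2real (jump_count t i \<omega>)) \<and>
    (\<lambda>n. \<Sum>i<n. atom_size \<nu> i * enn2real (jump_count t i \<omega>)) \<longlonglongrightarrow> X t \<omega> - \<delta> * t"
  using AE_jump_in_atoms count jumps
proof eventually_elim
  case (elim \<omega>)
  define J where "J i = {s \<in> {0<..t}. jump X \<omega> s \<in> atom_block \<nu> i}" for i
  have sum: "(jump X \<omega> has_sum (X t \<omega> - \<delta> * t)) {0<..t}" using elim(3) assms by blast
  have J_val: "jump X \<omega> s = atom_size \<nu> i" if "s \<in> J i" for s i
    using that in_atom_block by (auto simp: J_def)
  have "finite (J i)" for i
  proof (rule finite_subset)
    show "J i \<subseteq> {s \<in> {0<..t}. jump X \<omega> s = atom_size \<nu> i}"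
      using J_val by (auto simp: J_def)
    show "finite {s \<in> {0<..t}. jump X \<omega> s = atom_size \<nu> i}"
      using has_sum_imp_summable[OF sum] atom_size_pos by (rule finite_level_set_if_summable)
  qed
  have card: "enn2real (jump_count t i \<omega>) = real (card (J i))" for i
  proof -
    have "{0<..t} \<times> atom_block \<nu> i \<in> sets (borel \<Otimes>\<^sub>M borel)" by (auto intro!: pair_measureI)
    hence "jump_count t i \<omega> = emeasure (count_space UNIV)
        {s. s > 0 \<and> jump X \<omega> s \<noteq> 0 \<and> (s, jump X \<omega> s) \<in> {0<..t} \<times> atom_block \<nu> i}"
      unfolding jump_count_def using elim(2) by blast
    also have "{s. s > 0 \<and> jump X \<omega> s \<noteq> 0 \<and> (s, jump X \<omega> s) \<in> {0<..t} \<times> atom_block \<nu> i} = J i"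
      using atom_size_pos[of i] in_atom_block[of _ i] by (auto simp: J_def)
    finally show ?thesis using \<open>finite (J i)\<close> by simp
  qed
  define F where "F n = (\<Union>i<n. J i)" for n
  have part: "(\<Sum>i<n. atom_size \<nu> i * enn2real (jump_count t i \<omega>)) = sum (jump X \<omega>) (F n)" for n
  proof -
    have "sum (jump X \<omega>) (F n) = (\<Sum>i<n. sum (jump X \<omega>) (J i))"
      unfolding F_def
      by (rule sum.UNION_disjoint) (use \<open>\<And>i. finite (J i)\<close> in \<open>auto simp: J_def atom_block_def\<close>)
    also have "\<dots> = (\<Sum>i<n. atom_size \<nu> i * enn2real (jump_count t i \<omega>))"
      unfolding card by (intro sum.cong refl) (simp add: J_val)
    finally show ?thesis ..
  qed
  have "(\<lambda>n. sum (jump X \<omega>) (F n)) \<longlonglongrightarrow> X t \<omega> - \<delta> * t"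
  proof (rule has_sum_LIMSEQ_exhausting[OF sum])
    fix s assume "s \<in> {0<..t}"
    hence "jump X \<omega> s = 0 \<or> jump X \<omega> s \<in> atoms \<nu>" using elim(1) by auto
    thus "0 \<le> jump X \<omega> s" using atoms_pos[OF levy] by (auto intro: less_imp_le)
  next
    show "{s \<in> {0<..t}. jump X \<omega> s \<noteq> 0} \<subseteq> (\<Union>n. F n)"
    proof
      fix s assume "s \<in> {s \<in> {0<..t}. jump X \<omega> s \<noteq> 0}"
      moreover from this have "jump X \<omega> s \<in> atoms \<nu>" using elim(1) by auto
      then obtain i where "jump X \<omega> s \<in> atom_block \<nu> i" using UN_atom_block by blast
      ultimately have "s \<in> F (Suc i)" by (auto simp: F_def J_def)
      thus "s \<in> (\<Union>n. F n)" by blast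
    qed
    show "incseq F" unfolding F_def by (intro incseq_SucI) (auto simp: less_Suc_eq)
  qed (use \<open>\<And>i. finite (J i)\<close> in \<open>auto simp: F_def J_def\<close>)
  moreover have "incseq (\<lambda>n. \<Sum>i<n. atom_size \<nu> i * enn2real (jump_count t i \<omega>))"
    using atom_size_pos by (intro incseq_SucI) (simp add: less_imp_le)
  ultimately show ?case unfolding part by blast
qed

text \<open>The partial sums increase to X t - \<delta> t, so for almost every outcome the indicator
  of staying at or below x - \<delta> t is eventually that of X t \<le> x. Monotonicity gives
  convergence at every x, not only at continuity points of the law.\<close>

lemma jump_cdf_tendsto:
  assumes "0 \<le> t" and js: "jump_sizes (atom_size \<nu>) (atom_mass \<nu>) \<delta> q"
  shows "(\<lambda>n. jump_sizes.jump_cdf (atom_size \<nu>) (atom_mass \<nu>) n t (x - \<delta> * t))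
    \<longlonglongrightarrow> prob {\<omega> \<in> space M. X t \<omega> \<le> x}"
proof -
  have [measurable]: "X t \<in> borel_measurable M"
    using levy_proc assms(1) by (auto simp: levy_process_def)
  define T where "T n \<omega> = (\<Sum>i<n. atom_size \<nu> i * enn2real (jump_count t i \<omega>))" for n \<omega>
  have [measurable]: "T n \<in> borel_measurable M" for n unfolding T_def by measurable
  have "(\<lambda>n. expectation (indicator {\<omega> \<in> space M. T n \<omega> \<le> x - \<delta> * t})) \<longlonglongrightarrow>
      expectation (indicator {\<omega> \<in> space M. X t \<omega> \<le> x} :: 'a \<Rightarrow> real)"
  proof (rule integral_dominated_convergence[where w = "\<lambda>_. 1"])
    show "AE \<omega> in M. (\<lambda>n. indicator {\<omega> \<in> space M. T n \<omega> \<le> x - \<delta> * t} \<omega>) \<longlonglongrightarrow>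
        (indicator {\<omega> \<in> space M. X t \<omega> \<le> x} \<omega> :: real)"
      using AE_jump_sums_tendsto[OF assms(1)] AE_space
    proof eventually_elim
      case (elim \<omega>)
      hence inc: "incseq (\<lambda>n. T n \<omega>)" and lim: "(\<lambda>n. T n \<omega>) \<longlonglongrightarrow> X t \<omega> - \<delta> * t"
        by (auto simp: T_def)
      have "\<forall>\<^sub>F n in sequentially. indicator {\<omega> \<in> space M. T n \<omega> \<le> x - \<delta> * t} \<omega> =
          (indicator {\<omega> \<in> space M. X t \<omega> \<le> x} \<omega> :: real)"
      proof (cases "X t \<omega> \<le> x")
        case True
        have "T n \<omega> \<le> x - \<delta> * t" for n using incseq_le[OF inc lim, of n] True by linarith
        thus ?thesis using True by (simp add: indicator_def)
      next
        case False
        hence "x - \<delta> * t < X t \<omega> - \<delta> * t" by simp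
        with lim have "\<forall>\<^sub>F n in sequentially. x - \<delta> * t < T n \<omega>" by (rule order_tendstoD)
        thus ?thesis by eventually_elim (use False in \<open>simp add: indicator_def\<close>)
      qed
      thus ?case by (rule tendsto_eventually)
    qed
  qed (auto simp: indicator_def)
  moreover have "expectation (indicator {\<omega> \<in> space M. T n \<omega> \<le> x - \<delta> * t}) =
      jump_sizes.jump_cdf (atom_size \<nu>) (atom_mass \<nu>) n t (x - \<delta> * t)" for n
    using prob_jump_count_sum[OF assms, of n "x - \<delta> * t"] by (simp add: T_def)
  ultimately show ?thesis by simp
qed

text \<open>Only the single random variables \<open>X t\<close> are known to be measurable. Fubini's theorem is applied to the
  limit \<open>Y\<close> of dyadic approximations from the right, which is jointly measurable and agrees with \<open>X\<close>
  on right-continuous paths.\<close>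

lemma potential_measure_eq:
  "potential_measure M X q {0..x} =
    (\<integral>\<^sup>+ t\<in>{0..}. ennreal (exp (- q * t) * prob {\<omega> \<in> space M. X t \<omega> \<le> x}) \<partial>lborel)"
proof -
  have X_meas: "X t \<in> borel_measurable M" if "0 \<le> t" for t
    using levy_proc that by (auto simp: levy_process_def)
  \<comment> \<open>The + 1 keeps u m t above t, as right-continuity is stated with
    \<open>at_right\<close>. For each m only countably many times occur, which gives joint
    measurability.\<close>
  define u where "u m t = real (nat \<lfloor>t * 2 ^ m\<rfloor> + 1) / 2 ^ m" for m :: nat and t :: real
  define Y where "Y = (\<lambda>(\<omega>, t). lim (\<lambda>m. X (u m t) \<omega>))"
  have [measurable]: "Y \<in> borel_measurable (M \<Otimes>\<^sub>M lborel)"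
  proof -
    have "(\<lambda>x :: 'a \<times> real. X (real (nat \<lfloor>snd x * 2 ^ m\<rfloor> + 1) / 2 ^ m) (fst x))
        \<in> borel_measurable (M \<Otimes>\<^sub>M lborel)" for m :: nat
    proof (rule measurable_compose_countable[where f = "\<lambda>k x. X (real (k + 1) / 2 ^ m) (fst x)"
          and g = "\<lambda>x. nat \<lfloor>snd x * 2 ^ m\<rfloor>"])
      show "(\<lambda>x. X (real (k + 1) / 2 ^ m) (fst x)) \<in> borel_measurable (M \<Otimes>\<^sub>M lborel)" for k :: nat
        by (rule measurable_compose[OF measurable_fst X_meas]) simp
    qed measurable
    hence "(\<lambda>x. X (u m (snd x)) (fst x)) \<in> borel_measurable (M \<Otimes>\<^sub>M lborel)" for m
      unfolding u_def .
    hence "(\<lambda>x. lim (\<lambda>m. X (u m (snd x)) (fst x))) \<in> borel_measurable (M \<Otimes>\<^sub>M lborel)"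
      by (rule borel_measurable_lim_metric)
    thus ?thesis by (simp add: Y_def case_prod_beta')
  qed
  have u: "filterlim (\<lambda>m. u m t) (at_right t) sequentially" if "0 \<le> t" for t
  proof -
    have b: "t < u m t \<and> u m t \<le> t + 1 / 2 ^ m" for m
    proof -
      define c where "c = real (nat \<lfloor>t * 2 ^ m\<rfloor>)"
      have "c = of_int \<lfloor>t * 2 ^ m\<rfloor>" using that by (simp add: c_def)
      hence "t * 2 ^ m < c + 1" "c \<le> t * 2 ^ m" by linarith+
      moreover have "u m t = (c + 1) / 2 ^ m" by (simp add: u_def c_def add.commute)
      ultimately show ?thesis
        by (simp add: pos_less_divide_eq pos_divide_le_eq distrib_right)
    qed
    have "(\<lambda>m. t + 1 / 2 ^ m) \<longlonglongrightarrow> t + 0"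
      by (intro tendsto_add tendsto_const LIMSEQ_divide_realpow_zero) simp
    hence "(\<lambda>m. u m t) \<longlonglongrightarrow> t"
      using tendsto_sandwich[of "\<lambda>_. t" "\<lambda>m. u m t" sequentially "\<lambda>m. t + 1 / 2 ^ m" t]
        b by (simp add: less_imp_le)
    moreover have "u m t \<in> {t<..} \<and> u m t \<noteq> t" for m using b[of m] by simp
    ultimately show ?thesis unfolding filterlim_at by simp
  qed
  have "AE \<omega> in M. \<forall>t\<ge>0. ((\<lambda>s. X s \<omega>) \<longlongrightarrow> X t \<omega>) (at_right t)"
    using levy_proc unfolding levy_process_def by (auto elim: eventually_mono)
  hence Y_eq: "AE \<omega> in M. \<forall>t\<ge>0. Y (\<omega>, t) = X t \<omega>"
  proof eventually_elim
    case (elim \<omega>)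
    show ?case
    proof (intro allI impI)
      fix t :: real assume "0 \<le> t"
      have "(\<lambda>m. X (u m t) \<omega>) \<longlonglongrightarrow> X t \<omega>"
        by (rule filterlim_compose[OF elim[rule_format, OF \<open>0 \<le> t\<close>] u[OF \<open>0 \<le> t\<close>]])
      thus "Y (\<omega>, t) = X t \<omega>" by (simp add: Y_def limI)
    qed
  qed
  have "AE \<omega> in M. X 0 \<omega> = 0" using levy_proc by (simp add: levy_process_def)
  with mono have X_nonneg: "AE \<omega> in M. \<forall>t\<ge>0. 0 \<le> X t \<omega>"
  proof eventually_elim
    case (elim \<omega>)
    show ?case using mono_onD[OF elim(1), of 0] elim(2) by auto
  qed
  \<comment> \<open>The condition is z \<le> x instead of 0 \<le> z \<le> x; by
    \<open>X_nonneg\<close> they agree along almost every path.\<close>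
  define h where "h = (\<lambda>(\<omega>, t). ennreal (exp (- q * t)) * indicator {z. z \<le> x} (Y (\<omega>, t)) * indicator {0..} t)"
  have [measurable]: "h \<in> borel_measurable (M \<Otimes>\<^sub>M lborel)"
    unfolding h_def case_prod_beta' by measurable
  interpret pair: pair_sigma_finite M lborel ..
  have "potential_measure M X q {0..x} = (\<integral>\<^sup>+ \<omega>. \<integral>\<^sup>+ t. h (\<omega>, t) \<partial>lborel \<partial>M)"
    unfolding potential_measure_def
  proof (rule nn_integral_cong_AE)
    show "AE \<omega> in M. (\<integral>\<^sup>+ t\<in>{0..}. ennreal (exp (- q * t)) * indicator {0..x} (X t \<omega>) \<partial>lborel) =
        (\<integral>\<^sup>+ t. h (\<omega>, t) \<partial>lborel)"
      using Y_eq X_nonneg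
    proof eventually_elim
      case (elim \<omega>)
      thus ?case by (intro nn_integral_cong) (auto simp: h_def indicator_def)
    qed
  qed
  also have "\<dots> = (\<integral>\<^sup>+ t. \<integral>\<^sup>+ \<omega>. h (\<omega>, t) \<partial>M \<partial>lborel)"
    by (rule pair.Fubini[symmetric]) measurable
  also have "\<dots> = (\<integral>\<^sup>+ t\<in>{0..}. ennreal (exp (- q * t) * prob {\<omega> \<in> space M. X t \<omega> \<le> x}) \<partial>lborel)"
  proof (rule nn_integral_cong)
    fix t :: real
    show "(\<integral>\<^sup>+ \<omega>. h (\<omega>, t) \<partial>M) =
        ennreal (exp (- q * t) * prob {\<omega> \<in> space M. X t \<omega> \<le> x}) * indicator {0..} t"
    proof (cases "0 \<le> t")
      case True
      note [measurable] = X_meas[OF True]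
      have "(\<integral>\<^sup>+ \<omega>. h (\<omega>, t) \<partial>M) =
          (\<integral>\<^sup>+ \<omega>. ennreal (exp (- q * t)) * indicator {\<omega> \<in> space M. X t \<omega> \<le> x} \<omega> \<partial>M)"
      proof (rule nn_integral_cong_AE)
        show "AE \<omega> in M. h (\<omega>, t) = ennreal (exp (- q * t)) * indicator {\<omega> \<in> space M. X t \<omega> \<le> x} \<omega>"
          using Y_eq AE_space by eventually_elim (use True in \<open>auto simp: h_def indicator_def\<close>)
      qed
      also have "\<dots> = ennreal (exp (- q * t)) * emeasure M {\<omega> \<in> space M. X t \<omega> \<le> x}"
        by (rule nn_integral_cmult_indicator) measurable
      finally show ?thesis using True by (simp add: emeasure_eq_measure ennreal_mult)
    qed (simp add: h_def)
  qed
  finally show ?thesis .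
qed

text \<open>Dominated convergence in t with the indicator of [0, x / \<delta>]. The limit is
  integrable too, so \<open>enn2real\<close> in \<open>potential_cdf\<close> hides no infinite
  value.\<close>

lemma approx_potential_tendsto:
  assumes js: "jump_sizes (atom_size \<nu>) (atom_mass \<nu>) \<delta> q"
  shows "(\<lambda>n. jump_sizes.approx_potential (atom_size \<nu>) (atom_mass \<nu>) \<delta> q n x)
    \<longlonglongrightarrow> potential_cdf M X q x"
proof -
  interpret jump_sizes "atom_size \<nu>" "atom_mass \<nu>" \<delta> q by (rule js)
  define p where "p t = prob {\<omega> \<in> space M. X t \<omega> \<le> x}" for t
  define f where "f t = indicator {0..} t * (exp (- q * t) * p t)" for t
  have lim: "(\<lambda>n. indicator {0..} t * killed_cdf n t (x - \<delta> * t)) \<longlonglongrightarrow> f t" for t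
  proof (cases "0 \<le> t")
    case True
    thus ?thesis unfolding f_def killed_cdf_def p_def by (intro tendsto_intros jump_cdf_tendsto[OF _ js])
  qed (simp add: f_def)
  have [measurable]: "f \<in> borel_measurable lborel"
    by (rule borel_measurable_LIMSEQ_metric[OF _ lim]) measurable
  have norm_le: "norm (indicator {0..} t * killed_cdf n t (x - \<delta> * t)) \<le> indicator {0..x / \<delta>} t" for n t
    using killed_drift_bounds[of t n x] by simp
  have "integrable lborel f"
    by (rule integrable_dominated_convergence[OF _ _ integrable_indicator_Icc[of 0 "x / \<delta>"] AE_I2[OF lim] AE_I2[OF norm_le]])
       measurable
  have "(\<lambda>n. approx_potential n x) \<longlonglongrightarrow> integral\<^sup>L lborel f"
    unfolding approx_potential_def
    by (rule integral_dominated_convergence[OF _ _ integrable_indicator_Icc[of 0 "x / \<delta>"] AE_I2[OF lim] AE_I2[OF norm_le]])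
       measurable
  also have "integral\<^sup>L lborel f = potential_cdf M X q x"
  proof -
    have "potential_measure M X q {0..x} = (\<integral>\<^sup>+ t. ennreal (f t) \<partial>lborel)"
      unfolding potential_measure_eq f_def p_def
      by (intro nn_integral_cong) (auto simp: indicator_def)
    also have "\<dots> = ennreal (integral\<^sup>L lborel f)"
      by (rule nn_integral_eq_integral[OF \<open>integrable lborel f\<close>]) (auto simp: f_def p_def)
    finally show ?thesis
      by (simp add: potential_cdf_def f_def p_def integral_nonneg_AE)
  qed
  finally show ?thesis .
qed

end

text \<open>The exponent 1 belongs to the set, because x powr 1 = min 1 x on (0, 1]. The infimum is
  thus over a non-empty set, and a value below 1 forces a member below 1.\<close>

lemma blumenthal_getoor_indexD:
  assumes "levy_measure \<nu>" "blumenthal_getoor_index \<nu> < 1"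
  obtains \<gamma> where "0 < \<gamma>" "\<gamma> < 1" "(\<integral>\<^sup>+ x\<in>{0<..1}. ennreal (x powr \<gamma>) \<partial>\<nu>) < \<infinity>"
proof -
  let ?S = "{\<gamma>. \<gamma> > 0 \<and> (\<integral>\<^sup>+ x\<in>{0<..1}. ennreal (x powr \<gamma>) \<partial>\<nu>) < \<infinity>}"
  have "(\<integral>\<^sup>+ x\<in>{0<..1}. ennreal (x powr 1) \<partial>\<nu>) \<le> (\<integral>\<^sup>+ x. ennreal (min 1 x) \<partial>\<nu>)"
    by (intro nn_integral_mono) (auto simp: indicator_def)
  also have "\<dots> < \<infinity>" using assms(1) by (simp add: levy_measure_def)
  finally have "1 \<in> ?S" by simp
  hence "\<exists>\<gamma>\<in>?S. \<gamma> < 1"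
    using assms(2) unfolding blumenthal_getoor_index_def by (intro cInf_lessD) blast+
  thus ?thesis using that by blast
qed

theorem theorem2:
  fixes M :: "'a measure" and X :: "real \<Rightarrow> 'a \<Rightarrow> real"
    and \<delta> q :: real and \<nu> :: "real measure"
  assumes "subordinator M X \<delta> \<nu>"
    and "\<delta> > 0"
    and "blumenthal_getoor_index \<nu> < 1"
    and "q \<ge> 0"
    and "purely_atomic \<nu>"
    and "\<forall>a. a islimpt atoms \<nu> \<longrightarrow> a = 0"
  shows "(\<forall>k\<ge>1. \<forall>x>0.
            times_differentiable_at (k + 1) (potential_cdf M X q) x \<longleftrightarrow>
            x \<notin> sums_upto (atoms \<nu>) k) \<and>
         (\<forall>x>0. x \<notin> (\<Union>k\<in>{1..}. sums_upto (atoms \<nu>) k) \<longrightarrow>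
            (\<forall>n. times_differentiable_at n (potential_cdf M X q) x))"
proof -
  note sub = assms(1)[unfolded subordinator_def]
  have levy: "levy_measure \<nu>" using sub by blast
  obtain N where N: "poisson_random_measure M (density lborel (indicator {0<..}) \<Otimes>\<^sub>M \<nu>) N"
    "AE \<omega> in M. \<forall>A\<in>sets (borel \<Otimes>\<^sub>M borel). emeasure (N \<omega>) A =
      emeasure (count_space UNIV) {s. s > 0 \<and> jump X \<omega> s \<noteq> 0 \<and> (s, jump X \<omega> s) \<in> A}"
    using sub by blast
  interpret atomic_subordinator \<nu> M X \<delta> N
    by unfold_locales (use sub N assms levy in blast)+
  obtain \<gamma> where \<gamma>: "0 < \<gamma>" "\<gamma> < 1" "(\<integral>\<^sup>+ x\<in>{0<..1}. ennreal (x powr \<gamma>) \<partial>\<nu>) < \<infinity>"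
    using blumenthal_getoor_indexD[OF levy assms(3)] by blast
  interpret jump_sizes "atom_size \<nu>" "atom_mass \<nu>" \<delta> q
    by unfold_locales (use assms atom_size_pos atom_mass_nonneg in auto)
  interpret drift_renewal_equation "atom_size \<nu>" "atom_mass \<nu>" "potential_cdf M X q" \<delta> q \<gamma> "1 / \<delta>"
    by (rule limit_drift_renewal_equation[OF approx_potential_tendsto[OF jump_sizes_axioms] \<gamma>(1,2)
          summable_atom_powr[OF \<gamma>(1,3)] atom_size_locally_finite])
  have iff: "x \<in> sums_upto (atoms \<nu>) k \<longleftrightarrow> x \<in> sums_below (Suc k)" if "0 < x" for x k
    using sums_upto_iff[of x k] that unfolding atoms_eq_atom_size by simp
  show ?thesis
  proof (intro conjI allI impI)
    fix k :: nat and x :: real assume "0 < x"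
    thus "times_differentiable_at (k + 1) (potential_cdf M X q) x \<longleftrightarrow> x \<notin> sums_upto (atoms \<nu>) k"
      using times_differentiable_iff[of x "Suc k"] iff[of x k] by simp
  next
    fix x :: real and n :: nat
    assume x: "0 < x" "x \<notin> (\<Union>k\<in>{1..}. sums_upto (atoms \<nu>) k)"
    \<comment> \<open>Suc n instead of n keeps the index at least 1 when n = 0.\<close>
    have "x \<notin> sums_upto (atoms \<nu>) (Suc n)" using x(2) by auto
    hence "x \<notin> sums_below n" using iff[OF x(1), of "Suc n"] by (auto simp: sums_below_Suc)
    thus "times_differentiable_at n (potential_cdf M X q) x"
      using times_differentiable_iff[of x n] x(1) by simp
  qed
qed

end
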